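(* Let $\Phi\in M_1(\mathbf{k})$ and let $\mu_\Phi\in\mathrm{TAut}_2$ be the automorphism of $\hat{\mathfrak f}_2$ given by $$\mu_\Phi: x\mapsto \Phi(x,-x-y)\,x\,\Phi(x,-x-y)^{-1},\qquad y\mapsto e^{-(x+y)/2}\Phi(y,-x-y)\,y\,\Phi(y,-x-y)^{-1}e^{(x+y)/2}.$$ Then the following identity holds in $\mathrm{TAut}_3$: $$\mathrm{Ad}\,\Phi(t_{12},t_{23})\circ\mu_\Phi^{12,3}\circ\mu_\Phi^{1,2}=\mu_\Phi^{1,23}\circ\mu_\Phi^{2,3}.$$
   Context: $\mathbf{k}$ is a field of characteristic $0$; $\hat{\mathfrak f}_n$ is the degree completion of the free Lie algebra on $x_1,\dots,x_n$ (for $n=2$: $x,y$). $\mathrm{TAut}_n$ is the group of automorphisms of $\hat{\mathfrak f}_n$ of the form $x_k\mapsto U_kx_kU_k^{-1}$ with $U_k\in\exp(\hat{\mathfrak f}_n)$; such an automorphism is denoted $[\![U_1,\dots,U_n]\!]$, and the $U_k$ are uniquely determined by the normalization that the linear part of $\log U_k$ has zero $x_k$-coefficient. **Simplicial maps.** For $g=[\![U_1,U_2]\!]\in\mathrm{TAut}_2$ normalized and disjoint subsets $I_1,I_2\subset\{1,2,3\}$, $g^{I_1,I_2}\in\mathrm{TAut}_3$ is the automorphism which for $\ell\in I_k$ sends $x_\ell\mapsto V x_\ell V^{-1}$, $V=U_k(\sum_{i\in I_1}x_i,\sum_{i\in I_2}x_i)$, and fixes $x_\ell$ for $\ell\notin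 I_1\cup I_2$. A set $\{1,2\}$ is written $12$, etc. For $\mu_\Phi$ the normalized components are $U_1=\Phi(x,-x-y)$ and $U_2=e^{-(x+y)/2}\Phi(y,-x-y)e^{y/2}$. **Infinitesimal braids.** $\mathfrak t_n$ is the Lie algebra generated by $t_{ij}$, $i\ne j\in\{1,\dots,n\}$, with relations $t_{ji}=t_{ij}$, $[t_{ij},t_{ik}+t_{jk}]=0$ ($i,j,k$ distinct), $[t_{ij},t_{kl}]=0$ ($i,j,k,l$ distinct); $\hat{\mathfrak t}_n$ is its degree completion. For disjoint subsets $I_1,\dots,I_n$ of $\{1,\dots,m\}$, $a\mapsto a^{I_1,\dots,I_n}$ is the morphism $\mathfrak t_n\to\mathfrak t_m$, $t_{ij}\mapsto\sum_{i'\in I_i,j'\in I_j}t_{i'j'}$. There is a Lie algebra morphism from $\mathfrak t_3$ to derivations of $\mathfrak f_3$, $\mathrm{ad}\,t_{ij}: x_i\mapsto[x_i,x_j],\ x_j\mapsto[x_j,x_i],\ x_k\mapsto0$ ($k\ne i,j$); $\mathrm{Ad}:\exp(\hat{\mathfrak t}_3)\to\mathrm{TAut}_3$ is its exponentiation. **Associators.** $M_1(\mathbf{k})$ is the set of $\Phi=\Phi(t_{12},t_{23})\in\exp(\hat{\mathfrak t}_3)$, with $\Phi(a,b)$ in the exponential of the completed free Lie algebra on $a,b$, such that $\Phi^{3,2,1}=\Phi^{-1}$, $e^{t_{23}/2}\Phi^{1,2,3}e^{t_{12}/2}\Phi^{3,1,2}e^{t_{31}/2}\Phi^{2,3,1}=e^{(t_{12}+t_{23}+t_{31})/2}$,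 and $\Phi^{2,3,4}\Phi^{1,23,4}\Phi^{1,2,3}=\Phi^{1,2,34}\Phi^{12,3,4}$. *)

theory Defs
  imports "HOL-Library.Numeral_Type" "HOL-Library.FuncSet"
begin

section \<open>Noncommutative formal power series\<close>

text \<open>
  The completed free Lie algebra is realised inside the algebra of noncommutative power series
  in the letters \<open>'a\<close>, that is, the completed free associative algebra on \<open>'a\<close>, which is its
  completed universal enveloping algebra. A series is the function sending a word to its
  coefficient.
\<close>

typedef ('a, 'k) ncs = "UNIV :: ('a list \<Rightarrow> 'k) set"
  morphisms nc_coeff Abs_ncs ..

lemma nc_coeff_Abs [simp]: "nc_coeff (Abs_ncs f) = f"
  by (simp add: Abs_ncs_inverse)

lemma ncs_eqI: "(\<And>w. nc_coeff f w = nc_coeff g w) \<Longrightarrow> f = g"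
  by (metis ext nc_coeff_inject)

instantiation ncs :: (type, ring_1) ring_1
begin

definition zero_ncs :: "('a, 'b) ncs" where
  "0 = Abs_ncs (\<lambda>w. 0)"

definition one_ncs :: "('a, 'b) ncs" where
  "1 = Abs_ncs (\<lambda>w. if w = [] then 1 else 0)"

definition plus_ncs :: "('a, 'b) ncs \<Rightarrow> ('a, 'b) ncs \<Rightarrow> ('a, 'b) ncs" where
  "f + g = Abs_ncs (\<lambda>w. nc_coeff f w + nc_coeff g w)"

definition minus_ncs :: "('a, 'b) ncs \<Rightarrow> ('a, 'b) ncs \<Rightarrow> ('a, 'b) ncs" where
  "f - g = Abs_ncs (\<lambda>w. nc_coeff f w - nc_coeff g w)"

definition uminus_ncs :: "('a, 'b) ncs \<Rightarrow> ('a, 'b) ncs" where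
  "- f = Abs_ncs (\<lambda>w. - nc_coeff f w)"

definition times_ncs :: "('a, 'b) ncs \<Rightarrow> ('a, 'b) ncs \<Rightarrow> ('a, 'b) ncs" where
  "f * g = Abs_ncs (\<lambda>w. \<Sum>i\<le>length w. nc_coeff f (take i w) * nc_coeff g (drop i w))"

instance
proof
  fix f g h :: "('a, 'b) ncs"
  show "f + g + h = f + (g + h)" "f + g = g + f" "0 + f = f" "- f + f = 0" "f - g = f + - g"
    by (auto intro!: ncs_eqI simp: plus_ncs_def zero_ncs_def uminus_ncs_def minus_ncs_def
        algebra_simps)
  show "(f + g) * h = f * h + g * h" "f * (g + h) = f * g + f * h"
    by (auto intro!: ncs_eqI simp: plus_ncs_def times_ncs_def algebra_simps sum.distrib)
  have "nc_coeff 1 [] \<noteq> nc_coeff (0 :: ('a, 'b) ncs) []"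
    by (simp add: one_ncs_def zero_ncs_def)
  then show "(0 :: ('a, 'b) ncs) \<noteq> 1"
    by metis
  show "1 * f = f"
  proof (rule ncs_eqI)
    fix w :: "'a list"
    have "nc_coeff (1 * f) w = (\<Sum>i\<le>length w. if i = 0 then nc_coeff f w else 0)"
      unfolding times_ncs_def one_ncs_def nc_coeff_Abs by (rule sum.cong) auto
    then show "nc_coeff (1 * f) w = nc_coeff f w" by simp
  qed
  show "f * 1 = f"
  proof (rule ncs_eqI)
    fix w :: "'a list"
    have "nc_coeff (f * 1) w = (\<Sum>i\<le>length w. if i = length w then nc_coeff f w else 0)"
      unfolding times_ncs_def one_ncs_def nc_coeff_Abs by (rule sum.cong) auto
    then show "nc_coeff (f * 1) w = nc_coeff f w" by simp
  qed
  show "f * g * h = f * (g * h)"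
  proof (rule ncs_eqI)
    fix w :: "'a list"
    let ?n = "length w"
    let ?F = "\<lambda>i j. nc_coeff f (take j w) * nc_coeff g (take (i - j) (drop j w))
                      * nc_coeff h (drop i w)"
    have "nc_coeff (f * g * h) w = (\<Sum>i\<le>?n. \<Sum>j\<le>i. ?F i j)"
      unfolding times_ncs_def nc_coeff_Abs sum_distrib_right
      by (rule sum.cong[OF refl], rule sum.cong) (simp_all add: min_def drop_take)
    also have "\<dots> = (\<Sum>(i, j)\<in>(SIGMA i:{..?n}. {..i}). ?F i j)"
      by (simp add: sum.Sigma)
    also have "\<dots> = (\<Sum>(j, m)\<in>(SIGMA j:{..?n}. {..?n - j}). ?F (m + j) j)"
      by (rule sum.reindex_bij_witness[where i = "\<lambda>(j, m). (m + j, j)"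
            and j = "\<lambda>(i, j). (j, i - j)"]) auto
    also have "\<dots> = (\<Sum>j\<le>?n. \<Sum>m\<le>?n - j. ?F (m + j) j)"
      by (simp add: sum.Sigma)
    also have "\<dots> = nc_coeff (f * (g * h)) w"
      unfolding times_ncs_def nc_coeff_Abs sum_distrib_left
      by (rule sum.cong[OF refl], rule sum.cong) (simp_all add: mult.assoc)
    finally show "nc_coeff (f * g * h) w = nc_coeff (f * (g * h)) w" .
  qed
qed

end

definition nc_mono :: "'a list \<Rightarrow> ('a, 'k::ring_1) ncs" where
  "nc_mono v = Abs_ncs (\<lambda>w. if w = v then 1 else 0)"

definition nc_var :: "'a \<Rightarrow> ('a, 'k::ring_1) ncs" where
  "nc_var a = nc_mono [a]"

definition nc_smult :: "'k::ring_1 \<Rightarrow> ('a, 'k) ncs \<Rightarrow> ('a, 'k) ncs" where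
  "nc_smult c f = Abs_ncs (\<lambda>w. c * nc_coeff f w)"

definition nc_bracket :: "('a, 'k::ring_1) ncs \<Rightarrow> ('a, 'k) ncs \<Rightarrow> ('a, 'k) ncs" where
  "nc_bracket f g = f * g - g * f"

definition nc_homog_part :: "nat \<Rightarrow> ('a, 'k::ring_1) ncs \<Rightarrow> ('a, 'k) ncs" where
  "nc_homog_part d f = Abs_ncs (\<lambda>w. if length w = d then nc_coeff f w else 0)"

definition nc_inverse :: "('a, 'k::ring_1) ncs \<Rightarrow> ('a, 'k) ncs" where
  "nc_inverse g = (THE h. g * h = 1 \<and> h * g = 1)"

text \<open>
  The infinite sums below are written coefficientwise and truncated at the length of the word:
  the omitted terms do not contribute, because these functions are only applied to series with
  vanishing constant coefficient (constant coefficient 1 for \<open>nc_log\<close>).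
\<close>

definition nc_exp :: "('a, 'k::field_char_0) ncs \<Rightarrow> ('a, 'k) ncs" where
  "nc_exp f = Abs_ncs (\<lambda>w. \<Sum>n\<le>length w. nc_coeff (f ^ n) w / fact n)"

definition nc_log :: "('a, 'k::field_char_0) ncs \<Rightarrow> ('a, 'k) ncs" where
  "nc_log g = Abs_ncs (\<lambda>w. \<Sum>n = 1..length w. (-1) ^ (n + 1) / of_nat n * nc_coeff ((g - 1) ^ n) w)"

text \<open>The continuous algebra morphism sending the letter \<open>a\<close> to \<open>\<sigma> a\<close>.\<close>

definition nc_subst ::
    "('a::finite \<Rightarrow> ('b, 'k::field_char_0) ncs) \<Rightarrow> ('a, 'k) ncs \<Rightarrow> ('b, 'k) ncs" where
  "nc_subst \<sigma> f = Abs_ncs (\<lambda>w. \<Sum>v\<in>{v. length v \<le> length w}.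
     nc_coeff f v * nc_coeff (prod_list (map \<sigma> v)) w)"

text \<open>The continuous derivation sending the letter \<open>a\<close> to \<open>\<delta> a\<close>.\<close>

definition nc_derivation ::
    "('a::finite \<Rightarrow> ('a, 'k::field_char_0) ncs) \<Rightarrow> ('a, 'k) ncs \<Rightarrow> ('a, 'k) ncs" where
  "nc_derivation \<delta> f = Abs_ncs (\<lambda>w. \<Sum>v\<in>{v. length v \<le> length w}.
     nc_coeff f v *
     nc_coeff (\<Sum>i<length v. nc_mono (take i v) * \<delta> (v ! i) * nc_mono (drop (Suc i) v)) w)"


section \<open>Free Lie algebras, their completions and exponential groups\<close>

text \<open>
  The free Lie algebra on a set \<open>A\<close> of letters is the Lie subalgebra of the free associative
  algebra generated by \<open>A\<close>.
\<close>

inductive_set free_lie :: "'a set \<Rightarrow> ('a, 'k::field_char_0) ncs set" for A where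
  gen: "a \<in> A \<Longrightarrow> nc_var a \<in> free_lie A"
| zero: "0 \<in> free_lie A"
| add: "f \<in> free_lie A \<Longrightarrow> g \<in> free_lie A \<Longrightarrow> f + g \<in> free_lie A"
| smult: "f \<in> free_lie A \<Longrightarrow> nc_smult c f \<in> free_lie A"
| bracket: "f \<in> free_lie A \<Longrightarrow> g \<in> free_lie A \<Longrightarrow> nc_bracket f g \<in> free_lie A"

text \<open>Degree completion of a graded subspace.\<close>

definition degree_completion :: "('a, 'k::field_char_0) ncs set \<Rightarrow> ('a, 'k) ncs set" where
  "degree_completion L = {f. \<forall>d. nc_homog_part d f \<in> L}"

definition free_lie_hat :: "'a set \<Rightarrow> ('a, 'k::field_char_0) ncs set" where
  "free_lie_hat A = degree_completion (free_lie A)"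

definition exp_free_lie :: "'a set \<Rightarrow> ('a, 'k::field_char_0) ncs set" where
  "exp_free_lie A = nc_exp ` free_lie_hat A"


section \<open>Tangential automorphisms and simplicial maps\<close>

text \<open>
  The index set of the generators of the free Lie algebra is a finite type, here one of the
  numeral types \<open>2\<close>, \<open>3\<close>, \<open>4\<close>; the last index is then the same element as 0
  (for example \<open>(3::3) = 0\<close>), and 1, 2, 3 are distinct in \<open>3\<close>.
  Automorphisms are extensional functions on the completed free Lie algebra.
\<close>

definition lie_endo ::
    "('n::finite \<Rightarrow> ('n, 'k::field_char_0) ncs) \<Rightarrow> ('n, 'k) ncs \<Rightarrow> ('n, 'k) ncs" where
  "lie_endo \<sigma> = restrict (nc_subst \<sigma>) (free_lie_hat UNIV)"

text \<open>
  \<open>TAut\<^sub>n\<close> consists of the automorphisms \<open>tang U\<close> with all \<open>U k\<close> in \<open>exp_free_lie UNIV\<close>; the group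
  law is composition, and two elements are equal if they agree on the completed free Lie algebra.
\<close>

definition tang ::
    "('n::finite \<Rightarrow> ('n, 'k::field_char_0) ncs) \<Rightarrow> ('n, 'k) ncs \<Rightarrow> ('n, 'k) ncs" where
  "tang U = lie_endo (\<lambda>k. U k * nc_var k * nc_inverse (U k))"

definition TAut_comp ::
    "(('n::finite, 'k::field_char_0) ncs \<Rightarrow> ('n, 'k) ncs) \<Rightarrow> (('n, 'k) ncs \<Rightarrow> ('n, 'k) ncs)
      \<Rightarrow> ('n, 'k) ncs \<Rightarrow> ('n, 'k) ncs"  (infixr "\<circ>\<^sub>T" 55) where
  "g \<circ>\<^sub>T h = compose (free_lie_hat UNIV) g h"

definition normalized_components ::
    "(('n::finite, 'k::field_char_0) ncs \<Rightarrow> ('n, 'k) ncs) \<Rightarrow> 'n \<Rightarrow> ('n, 'k) ncs" where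
  "normalized_components g = (THE U.
     (\<forall>k. U k \<in> exp_free_lie UNIV \<and> nc_coeff (nc_log (U k)) [k] = 0) \<and> tang U = g)"

definition sets2 :: "'m set \<Rightarrow> 'm set \<Rightarrow> 2 \<Rightarrow> 'm set" where
  "sets2 I1 I2 k = (if k = 1 then I1 else I2)"

definition sets3 :: "'m set \<Rightarrow> 'm set \<Rightarrow> 'm set \<Rightarrow> 3 \<Rightarrow> 'm set" where
  "sets3 I1 I2 I3 k = (if k = 1 then I1 else if k = 2 then I2 else I3)"

definition TAut_simplicial ::
    "('n::finite \<Rightarrow> 'm::finite set) \<Rightarrow> (('n, 'k::field_char_0) ncs \<Rightarrow> ('n, 'k) ncs)
      \<Rightarrow> ('m, 'k) ncs \<Rightarrow> ('m, 'k) ncs" where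
  "TAut_simplicial I g = tang (\<lambda>l.
     if \<exists>k. l \<in> I k
     then nc_subst (\<lambda>j. \<Sum>i\<in>I j. nc_var i) (normalized_components g (THE k. l \<in> I k))
     else 1)"


section \<open>Infinitesimal braids\<close>

definition t_letters :: "('n \<times> 'n) set" where
  "t_letters = {(i, j). i \<noteq> j}"

definition tt :: "'n \<Rightarrow> 'n \<Rightarrow> ('n \<times> 'n, 'k::field_char_0) ncs" where
  "tt i j = nc_var (i, j)"

definition t_relations :: "('n \<times> 'n, 'k::field_char_0) ncs set" where
  "t_relations =
     {tt j i - tt i j | i j. i \<noteq> j}
   \<union> {nc_bracket (tt i j) (tt i k + tt j k) | i j k. distinct [i, j, k]}
   \<union> {nc_bracket (tt i j) (tt k l) | i j k l. distinct [i, j, k, l]}"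

text \<open>
  The infinitesimal braid Lie algebra is the quotient of \<open>free_lie t_letters\<close> by the following
  Lie ideal, generated by the relations. As these are homogeneous, the completed quotient is the quotient of the completions.
\<close>

inductive_set t_ideal :: "('n \<times> 'n, 'k::field_char_0) ncs set" where
  rel: "r \<in> t_relations \<Longrightarrow> r \<in> t_ideal"
| zero: "0 \<in> t_ideal"
| add: "f \<in> t_ideal \<Longrightarrow> g \<in> t_ideal \<Longrightarrow> f + g \<in> t_ideal"
| smult: "f \<in> t_ideal \<Longrightarrow> nc_smult c f \<in> t_ideal"
| bracket: "f \<in> t_ideal \<Longrightarrow> g \<in> free_lie t_letters \<Longrightarrow> nc_bracket g f \<in> t_ideal"

text \<open>
  Elements of the exponential group of the completed infinitesimal braid algebra are represented
  by elements of \<open>exp_free_lie t_letters\<close>; two of them are identified if and only if their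
  logarithms agree in the quotient Lie algebra.
\<close>

definition exp_t_eq ::
    "('n \<times> 'n, 'k::field_char_0) ncs \<Rightarrow> ('n \<times> 'n, 'k) ncs \<Rightarrow> bool"  (infix "\<approx>\<^sub>t" 50) where
  "g \<approx>\<^sub>t h \<longleftrightarrow> nc_log g - nc_log h \<in> degree_completion t_ideal"

definition t_simplicial ::
    "('n::finite \<Rightarrow> 'm::finite set) \<Rightarrow> ('n \<times> 'n, 'k::field_char_0) ncs \<Rightarrow> ('m \<times> 'm, 'k) ncs" where
  "t_simplicial I = nc_subst (\<lambda>(i, j). \<Sum>i'\<in>I i. \<Sum>j'\<in>I j. tt i' j')"

definition ad_gen :: "'n::finite \<times> 'n \<Rightarrow> ('n, 'k::field_char_0) ncs \<Rightarrow> ('n, 'k) ncs" where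
  "ad_gen = (\<lambda>(i, j). nc_derivation (\<lambda>l.
     if l = i then nc_bracket (nc_var i) (nc_var j)
     else if l = j then nc_bracket (nc_var j) (nc_var i)
     else 0))"

text \<open>
  The morphism \<open>ad\<close> is extended from the letters to Lie series as the restriction of the algebra
  morphism sending a word to the composite of the corresponding derivations (each of which raises
  the degree by one, hence the truncation). It vanishes on the relations, so both \<open>ad\<close> and \<open>Ad\<close>
  may be evaluated on representatives.
\<close>

definition ad_t ::
    "('n::finite \<times> 'n, 'k::field_char_0) ncs \<Rightarrow> ('n, 'k) ncs \<Rightarrow> ('n, 'k) ncs" where
  "ad_t a f = Abs_ncs (\<lambda>w. \<Sum>u\<in>{u. length u \<le> length w}.
     nc_coeff a u * nc_coeff (foldr ad_gen u f) w)"

definition Ad_t ::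
    "('n::finite \<times> 'n, 'k::field_char_0) ncs \<Rightarrow> ('n, 'k) ncs \<Rightarrow> ('n, 'k) ncs" where
  "Ad_t g = restrict
     (\<lambda>f. Abs_ncs (\<lambda>w. \<Sum>n\<le>length w. nc_coeff ((ad_t (nc_log g) ^^ n) f) w / fact n))
     (free_lie_hat UNIV)"


section \<open>Associators\<close>

text \<open>The value \<open>\<Phi>(u, v)\<close> of a series \<open>\<Phi>\<close> in the letters \<open>a = 1\<close> and \<open>b = 2\<close>.\<close>

definition nc_eval2 ::
    "(2, 'k::field_char_0) ncs \<Rightarrow> ('b, 'k) ncs \<Rightarrow> ('b, 'k) ncs \<Rightarrow> ('b, 'k) ncs" where
  "nc_eval2 \<Phi> u v = nc_subst (\<lambda>k. if k = 1 then u else v) \<Phi>"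

definition assoc_t3 :: "(2, 'k::field_char_0) ncs \<Rightarrow> (3 \<times> 3, 'k) ncs" where
  "assoc_t3 \<Phi> = nc_eval2 \<Phi> (tt 1 2) (tt 2 3)"

definition assoc_simp ::
    "(2, 'k::field_char_0) ncs \<Rightarrow> 'm::finite set \<Rightarrow> 'm set \<Rightarrow> 'm set \<Rightarrow> ('m \<times> 'm, 'k) ncs" where
  "assoc_simp \<Phi> I1 I2 I3 = t_simplicial (sets3 I1 I2 I3) (assoc_t3 \<Phi>)"

definition associators :: "(2, 'k::field_char_0) ncs set" where
  "associators = {\<Phi> \<in> exp_free_lie UNIV.
     (assoc_simp \<Phi> {3} {2} {1} :: (3 \<times> 3, 'k) ncs) \<approx>\<^sub>t nc_inverse (assoc_t3 \<Phi>)
   \<and> nc_exp (nc_smult (1/2) (tt 2 3)) * (assoc_simp \<Phi> {1} {2} {3} :: (3 \<times> 3, 'k) ncs)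
       * nc_exp (nc_smult (1/2) (tt 1 2)) * assoc_simp \<Phi> {3} {1} {2}
       * nc_exp (nc_smult (1/2) (tt 3 1)) * assoc_simp \<Phi> {2} {3} {1}
     \<approx>\<^sub>t nc_exp (nc_smult (1/2) (tt 1 2 + tt 2 3 + tt 3 1))
   \<and> (assoc_simp \<Phi> {2} {3} {4} :: (4 \<times> 4, 'k) ncs) * assoc_simp \<Phi> {1} {2, 3} {4}
       * assoc_simp \<Phi> {1} {2} {3}
     \<approx>\<^sub>t assoc_simp \<Phi> {1} {2} {3, 4} * assoc_simp \<Phi> {1, 2} {3} {4}}"

definition mu :: "(2, 'k::field_char_0) ncs \<Rightarrow> (2, 'k) ncs \<Rightarrow> (2, 'k) ncs" where
  "mu \<Phi> = (let x = nc_var 1; y = nc_var 2;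
                 P = nc_eval2 \<Phi> x (- x - y); Q = nc_eval2 \<Phi> y (- x - y)
             in lie_endo (\<lambda>k.
                  if k = 1 then P * x * nc_inverse P
                  else nc_exp (nc_smult (-1/2) (x + y)) * Q * y * nc_inverse Q
                         * nc_exp (nc_smult (1/2) (x + y))))"

end

theory Submission
  imports Defs "HOL.Vector_Spaces"
begin

text \<open>
  Let \<open>A\<close> be the algebra of series in \<open>x\<^sub>1, x\<^sub>2, x\<^sub>3\<close>. The infinitesimal braid algebra on four strands
  \<open>0, 1, 2, 3\<close> acts on \<open>A\<close>: the generator \<open>t\<^sub>0\<^sub>k\<close> is the left multiplication with \<open>x\<^sub>k\<close>, and for
  \<open>i, j \<noteq> 0\<close> the generator \<open>t\<^sub>i\<^sub>j\<close> is the derivation \<open>ad t\<^sub>i\<^sub>j\<close> (lemma \<open>braid_strand_op\<close>). The subalgebra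
  generated by the \<open>t\<^sub>0\<^sub>k\<close> acts faithfully, and conjugation with the operator of \<open>g\<close> is \<open>Ad g\<close>
  (\<open>Ad_t_eq\<close>, \<open>act_D_lmul\<close>). So the theorem can be checked in the ring of continuous operators on
  \<open>A\<close>, where the relations of an associator become identities between operators
  (\<open>assoc_inverse\<close>, \<open>assoc_hexagon\<close>, \<open>assoc_pentagon_op\<close>).

  An associator has no linear part, by the pentagon in degree one, so its value does not change
  when central elements are added to its arguments (\<open>act_central_shift\<close>). As
  \<open>t\<^sub>0\<^sub>1 + t\<^sub>0\<^sub>2 + t\<^sub>1\<^sub>2\<close> is central on three strands, \<open>\<Phi>(x\<^sub>1, - x\<^sub>1 - x\<^sub>2)\<close> acts as \<open>\<Phi>(t\<^sub>0\<^sub>1, t\<^sub>1\<^sub>2)\<close>,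
  and likewise for every factor of the automorphisms involved. Both sides of the theorem send \<open>x\<^sub>k\<close> to
  \<open>M x\<^sub>k M\<^sup>-\<^sup>1\<close> for explicit products \<open>M\<close>, and it remains to compare these up to right
  multiplication with the centralizer of \<open>t\<^sub>0\<^sub>k\<close> (\<open>assoc_component_identities\<close>). For
  \<open>k = 1\<close> this is the pentagon on the strands \<open>0, 1, 2, 3\<close>; for \<open>k = 2\<close> the hexagons turn
  the exponential factors into braidings and the pentagon on \<open>3, 2, 0, 1\<close> finishes; for \<open>k = 3\<close>
  the pentagon on \<open>3, 0, 2, 1\<close> is needed in addition.

  To know the normalized components of \<open>\<mu>\<^sub>\<Phi>\<close> one needs that exponentials of Lie series form a group
  (\<open>exp_free_lie_mult\<close>). With the degree derivation \<open>E\<close>, the logarithm of a series \<open>g\<close> is a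
  Lie series if and only if \<open>g\<^sup>-\<^sup>1 E(g)\<close> is one (\<open>hat_log_deriv\<close>, \<open>hat_of_log_deriv\<close>), and
  \<open>(g h)\<^sup>-\<^sup>1 E(g h) = h\<^sup>-\<^sup>1 (g\<^sup>-\<^sup>1 E(g)) h + h\<^sup>-\<^sup>1 E(h)\<close>. Uniqueness of the components holds because the
  centralizer of \<open>x\<^sub>k\<close> consists of the series in \<open>x\<^sub>k\<close> (\<open>centralizer_var\<close>).
\<close>

section \<open>Coefficients and the degree filtration\<close>

lemma coeff_zero [simp]: "nc_coeff 0 w = 0"
  by (simp add: zero_ncs_def)

lemma coeff_one: "nc_coeff 1 w = (if w = [] then 1 else 0)"
  by (simp add: one_ncs_def)

lemma coeff_plus [simp]: "nc_coeff (f + g) w = nc_coeff f w + nc_coeff g w"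
  by (simp add: plus_ncs_def)

lemma coeff_minus [simp]: "nc_coeff (f - g) w = nc_coeff f w - nc_coeff g w"
  by (simp add: minus_ncs_def)

lemma coeff_uminus [simp]: "nc_coeff (- f) w = - nc_coeff f w"
  by (simp add: uminus_ncs_def)

lemma coeff_times:
  "nc_coeff (f * g) w = (\<Sum>i\<le>length w. nc_coeff f (take i w) * nc_coeff g (drop i w))"
  by (simp add: times_ncs_def)

lemma coeff_smult [simp]: "nc_coeff (nc_smult c f) w = c * nc_coeff f w"
  by (simp add: nc_smult_def)

lemma coeff_mono: "nc_coeff (nc_mono v) w = (if w = v then 1 else 0)"
  by (simp add: nc_mono_def)

lemma coeff_var: "nc_coeff (nc_var a) w = (if w = [a] then 1 else 0)"
  by (simp add: nc_var_def coeff_mono)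

lemma coeff_sum [simp]: "nc_coeff (sum f A) w = (\<Sum>a\<in>A. nc_coeff (f a) w)"
  by (induction A rule: infinite_finite_induct) auto

lemma coeff_homog_part [simp]:
  "nc_coeff (nc_homog_part d f) w = (if length w = d then nc_coeff f w else 0)"
  by (simp add: nc_homog_part_def)

interpretation nc: vector_space "nc_smult :: 'k::field_char_0 \<Rightarrow> ('a, 'k) ncs \<Rightarrow> ('a, 'k) ncs"
  by standard (auto intro!: ncs_eqI simp: algebra_simps)

lemma smult_mult_left [simp]:
  "nc_smult c f * g = nc_smult (c :: 'k::field_char_0) (f * g)"
  by (rule ncs_eqI) (simp add: coeff_times sum_distrib_left mult.assoc)

lemma smult_mult_right [simp]:
  "f * nc_smult c g = nc_smult (c :: 'k::field_char_0) (f * g)"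
  by (rule ncs_eqI) (simp add: coeff_times sum_distrib_left mult.left_commute)

lemma nc_mono_Nil: "nc_mono [] = 1"
  by (rule ncs_eqI) (simp add: coeff_mono coeff_one)

lemma coeff_var_times:
  "nc_coeff (nc_var a * f) w = (if w \<noteq> [] \<and> hd w = a then nc_coeff f (tl w) else 0)"
proof (cases w)
  case Nil
  then show ?thesis by (simp add: coeff_times nc_var_def coeff_mono)
next
  case (Cons b v)
  have "nc_coeff (nc_var a * f) w
      = (\<Sum>i\<le>length w. if i = 1 \<and> b = a then nc_coeff f v else 0)"
    unfolding coeff_times nc_var_def coeff_mono
  proof (rule sum.cong)
    fix i assume "i \<in> {..length w}"
    then show "(if take i w = [a] then 1 else 0) * nc_coeff f (drop i w)
        = (if i = 1 \<and> b = a then nc_coeff f v else 0)"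
      using Cons by (cases i; cases "i - 1"; cases v) auto
  qed simp
  also have "\<dots> = (if b = a then nc_coeff f v else 0)"
    using Cons by (cases "b = a") (cases v, simp_all add: sum.delta Suc_le_eq)
  finally show ?thesis using Cons by simp
qed

lemma coeff_times_var:
  "nc_coeff (f * nc_var a) w = (if w \<noteq> [] \<and> last w = a then nc_coeff f (butlast w) else 0)"
proof (cases w rule: rev_cases)
  case Nil
  then show ?thesis by (simp add: coeff_times nc_var_def coeff_mono)
next
  case (snoc v b)
  have "nc_coeff (f * nc_var a) w
      = (\<Sum>i\<le>length w. if i = length v then (if b = a then nc_coeff f v else 0) else 0)"
    unfolding coeff_times nc_var_def coeff_mono
  proof (rule sum.cong)
    fix i assume "i \<in> {..length w}"
    then consider "i = length v" | "i = length w" | "i < length v"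
      using snoc by fastforce
    then show "nc_coeff f (take i w) * (if drop i w = [a] then 1 else 0)
        = (if i = length v then if b = a then nc_coeff f v else 0 else 0)"
      using snoc by cases auto
  qed simp
  then show ?thesis using snoc by (simp add: sum.delta)
qed

lemma nc_mono_Cons: "nc_mono (a # v) = nc_var a * nc_mono v"
  by (rule ncs_eqI) (auto simp: coeff_var_times coeff_mono neq_Nil_conv)

lemma nc_mono_append: "nc_mono (u @ v) = nc_mono u * nc_mono v"
  by (induction u) (simp_all add: nc_mono_Nil nc_mono_Cons mult.assoc)

lemma finite_words_le [simp]: "finite {v :: 'a::finite list. length v \<le> n}"
  using finite_lists_length_le[of "UNIV :: 'a set" n] by simp

lemma finite_words_less [simp]: "finite {v :: 'a::finite list. length v < n}"
  by (rule finite_subset[OF _ finite_words_le[of n]]) auto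

(* the rules about the filtration below are stated with the degree 1, not Suc 0 *)
declare One_nat_def [simp del] plus_1_eq_Suc [simp]

text \<open>The degree filtration: \<open>f\<close> has no terms of degree below \<open>n\<close>.\<close>

definition ord_ge :: "nat \<Rightarrow> ('a, 'k::field_char_0) ncs \<Rightarrow> bool" where
  "ord_ge n f \<longleftrightarrow> (\<forall>w. length w < n \<longrightarrow> nc_coeff f w = 0)"

lemma ord_ge_0 [simp]: "ord_ge 0 f"
  by (simp add: ord_ge_def)

lemma ord_ge_zero [simp]: "ord_ge n 0"
  by (simp add: ord_ge_def)

lemma ord_ge_add: "ord_ge n f \<Longrightarrow> ord_ge n g \<Longrightarrow> ord_ge n (f + g)"
  by (simp add: ord_ge_def)

lemma ord_ge_diff: "ord_ge n f \<Longrightarrow> ord_ge n g \<Longrightarrow> ord_ge n (f - g)"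
  by (simp add: ord_ge_def)

lemma ord_ge_uminus [simp]: "ord_ge n (- f) \<longleftrightarrow> ord_ge n f"
  by (simp add: ord_ge_def)

lemma ord_ge_smult: "ord_ge n f \<Longrightarrow> ord_ge n (nc_smult c f)"
  by (simp add: ord_ge_def)

lemma ord_ge_sum: "(\<And>a. a \<in> A \<Longrightarrow> ord_ge n (f a)) \<Longrightarrow> ord_ge n (sum f A)"
  by (simp add: ord_ge_def)

lemma ord_ge_mono: "ord_ge n f \<Longrightarrow> m \<le> n \<Longrightarrow> ord_ge m f"
  by (simp add: ord_ge_def)

lemma ord_ge_sym: "ord_ge n (f - g) \<Longrightarrow> ord_ge n (g - f)"
  using ord_ge_uminus[of n "f - g"] by simp

lemma ord_ge_mult: "ord_ge m f \<Longrightarrow> ord_ge n g \<Longrightarrow> ord_ge (m + n) (f * g)"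
  unfolding ord_ge_def
proof (intro allI impI)
  fix w :: "'a list"
  assume *: "\<forall>w. length w < m \<longrightarrow> nc_coeff f w = 0" "\<forall>w. length w < n \<longrightarrow> nc_coeff g w = 0"
    "length w < m + n"
  have "nc_coeff f (take i w) * nc_coeff g (drop i w) = 0" if "i \<le> length w" for i
    using * that by (cases "i < m") auto
  then show "nc_coeff (f * g) w = 0"
    unfolding coeff_times by (intro sum.neutral) auto
qed

lemma ord_ge_mult_left: "ord_ge n g \<Longrightarrow> ord_ge n (f * g)"
  using ord_ge_mult[of 0 f n g] by simp

lemma ord_ge_mult_right: "ord_ge n f \<Longrightarrow> ord_ge n (f * g)"
  using ord_ge_mult[of n f 0 g] by simp

lemma ord_ge_power: "ord_ge 1 f \<Longrightarrow> ord_ge n (f ^ n)"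
proof (induction n)
  case (Suc n)
  then show ?case using ord_ge_mult[of 1 f n "f ^ n"] by simp
qed simp

lemma ord_ge_all: "(\<And>n. ord_ge n f) \<Longrightarrow> f = 0"
  by (rule ncs_eqI) (auto simp: ord_ge_def)

lemma ord_ge_eqI: "(\<And>n. ord_ge n (f - g)) \<Longrightarrow> f = g"
  using ord_ge_all[of "f - g"] by simp

lemma ord_ge_1_iff: "ord_ge 1 f \<longleftrightarrow> nc_coeff f [] = 0"
  by (auto simp: ord_ge_def)

lemma ord_ge_nc_mono [simp]: "ord_ge n (nc_mono v) \<longleftrightarrow> n \<le> length v"
  by (auto simp: ord_ge_def coeff_mono)

lemma ord_ge_nc_var [simp]: "ord_ge 1 (nc_var a)"
  by (simp add: nc_var_def)

lemma coeff_Nil_times [simp]: "nc_coeff (f * g) [] = nc_coeff f [] * nc_coeff g []"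
  by (simp add: coeff_times)

lemma ord_ge_trunc:
  fixes f :: "('a::finite, 'k::field_char_0) ncs"
  shows "ord_ge N (f - (\<Sum>v\<in>{v. length v < N}. nc_smult (nc_coeff f v) (nc_mono v)))"
  by (auto simp: ord_ge_def coeff_mono sum.delta' if_distrib cong: if_cong)

text \<open>
  Linear maps that respect the filtration. They are continuous, so they are determined by their
  values on words.
\<close>

definition lin_filt :: "(('a, 'k::field_char_0) ncs \<Rightarrow> ('b, 'k) ncs) \<Rightarrow> bool" where
  "lin_filt T \<longleftrightarrow> (\<forall>f g. T (f + g) = T f + T g) \<and> (\<forall>c f. T (nc_smult c f) = nc_smult c (T f))
     \<and> (\<forall>n f. ord_ge n f \<longrightarrow> ord_ge n (T f))"

lemma lin_filtI:
  assumes "\<And>f g. T (f + g) = T f + T g" "\<And>c f. T (nc_smult c f) = nc_smult c (T f)"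
    "\<And>n f. ord_ge n f \<Longrightarrow> ord_ge n (T f)"
  shows "lin_filt T"
  using assms by (simp add: lin_filt_def)

lemma
  assumes "lin_filt T"
  shows lin_filt_add: "T (f + g) = T f + T g"
    and lin_filt_smult: "T (nc_smult c f) = nc_smult c (T f)"
    and lin_filt_ord: "ord_ge n f \<Longrightarrow> ord_ge n (T f)"
  using assms by (auto simp: lin_filt_def)

lemma lin_filt_0: "lin_filt T \<Longrightarrow> T 0 = 0"
  using lin_filt_smult[of T 0 0] by simp

lemma lin_filt_uminus: "lin_filt T \<Longrightarrow> T (- f) = - T f"
  using lin_filt_add[of T f "- f"] lin_filt_0[of T] by (simp add: eq_neg_iff_add_eq_0 add.commute)

lemma lin_filt_diff: "lin_filt T \<Longrightarrow> T (f - g) = T f - T g"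
  using lin_filt_add[of T f "- g"] lin_filt_uminus[of T g] by simp

lemma lin_filt_sum: "lin_filt T \<Longrightarrow> T (sum f A) = (\<Sum>a\<in>A. T (f a))"
  by (induction A rule: infinite_finite_induct) (auto simp: lin_filt_0 lin_filt_add)

lemma lin_filt_comp: "lin_filt S \<Longrightarrow> lin_filt T \<Longrightarrow> lin_filt (\<lambda>f. S (T f))"
  by (simp add: lin_filt_def)

lemma lin_filt_mult_left: "lin_filt S \<Longrightarrow> lin_filt (\<lambda>f. g * S f)"
  by (auto simp: lin_filt_def algebra_simps intro: ord_ge_mult_left)

lemma lin_filt_mult_right: "lin_filt S \<Longrightarrow> lin_filt (\<lambda>f. S f * g)"
  by (auto simp: lin_filt_def algebra_simps intro: ord_ge_mult_right)

lemma lin_filt_plus: "lin_filt S \<Longrightarrow> lin_filt T \<Longrightarrow> lin_filt (\<lambda>f. S f + T f)"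
  by (auto simp: lin_filt_def algebra_simps nc.scale_right_distrib intro: ord_ge_add)

lemma lin_filt_smult': "lin_filt S \<Longrightarrow> lin_filt (\<lambda>f. nc_smult c (S f))"
  by (auto simp: lin_filt_def algebra_simps nc.scale_right_distrib intro: ord_ge_smult)

lemma lin_filt_minus: "lin_filt S \<Longrightarrow> lin_filt T \<Longrightarrow> lin_filt (\<lambda>f. S f - T f)"
  by (auto simp: lin_filt_def algebra_simps nc.scale_right_diff_distrib intro: ord_ge_diff)

lemma lin_filt_id: "lin_filt (\<lambda>f. f)"
  by (simp add: lin_filt_def)

lemma lin_filt_eqI:
  fixes S T :: "('a::finite, 'k::field_char_0) ncs \<Rightarrow> ('b, 'k) ncs"
  assumes S: "lin_filt S" and T: "lin_filt T" and eq: "\<And>v. S (nc_mono v) = T (nc_mono v)"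
  shows "S f = T f"
proof (rule ord_ge_eqI)
  fix N
  let ?p = "\<Sum>v\<in>{v. length v < N}. nc_smult (nc_coeff f v) (nc_mono v)"
  have "S ?p = T ?p"
    by (simp add: lin_filt_sum[OF S] lin_filt_sum[OF T] lin_filt_smult[OF S] lin_filt_smult[OF T] eq)
  moreover have "ord_ge N (S (f - ?p))" "ord_ge N (T (f - ?p))"
    by (rule lin_filt_ord[OF S ord_ge_trunc] lin_filt_ord[OF T ord_ge_trunc])+
  ultimately show "ord_ge N (S f - T f)"
    using ord_ge_diff[of N "S (f - ?p)" "T (f - ?p)"]
    by (simp add: lin_filt_diff[OF S] lin_filt_diff[OF T])
qed

text \<open>The map \<open>nc_lin c\<close> is the continuous linear map that sends each word \<open>v\<close> to \<open>c v\<close>.\<close>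

definition nc_lin :: "('a::finite list \<Rightarrow> ('b, 'k::field_char_0) ncs) \<Rightarrow> ('a, 'k) ncs \<Rightarrow> ('b, 'k) ncs" where
  "nc_lin c f = Abs_ncs (\<lambda>w. \<Sum>v\<in>{v. length v \<le> length w}. nc_coeff f v * nc_coeff (c v) w)"

lemma lin_filt_nc_lin [intro]: "lin_filt (nc_lin c)"
proof (rule lin_filtI)
  fix n and f :: "('a, 'b) ncs" assume "ord_ge n f"
  then show "ord_ge n (nc_lin c f)"
    by (auto simp: ord_ge_def nc_lin_def intro!: sum.neutral)
qed (auto intro!: ncs_eqI simp: nc_lin_def algebra_simps sum.distrib sum_distrib_left)

lemma nc_lin_mono:
  assumes "ord_ge (length v) (c v)"
  shows "nc_lin c (nc_mono v) = c v"
proof (rule ncs_eqI)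
  fix w
  have "nc_coeff (nc_lin c (nc_mono v)) w
      = (\<Sum>u\<in>{u. length u \<le> length w}. if u = v then nc_coeff (c v) w else 0)"
    unfolding nc_lin_def nc_coeff_Abs by (rule sum.cong) (auto simp: coeff_mono)
  also have "\<dots> = nc_coeff (c v) w"
    using assms by (auto simp: sum.delta ord_ge_def)
  finally show "nc_coeff (nc_lin c (nc_mono v)) w = nc_coeff (c v) w" .
qed

section \<open>The ring of continuous operators\<close>

text \<open>
  The ring of continuous operators: filtered linear endomorphisms of the algebra of series, with
  composition as product.
\<close>

typedef (overloaded) ('a, 'k) nc_op = "{T :: ('a, 'k::field_char_0) ncs \<Rightarrow> ('a, 'k) ncs. lin_filt T}"
  morphisms app Abs_op
  using lin_filt_id by auto

lemma lin_filt_app [intro, simp]: "lin_filt (app P)"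
  using app[of P] by simp

lemma app_Abs: "lin_filt T \<Longrightarrow> app (Abs_op T) = T"
  by (simp add: Abs_op_inverse)

lemma op_eqI: "(\<And>f. app P f = app Q f) \<Longrightarrow> P = Q"
  by (metis app_inject ext)

instantiation nc_op :: (type, field_char_0) ring_1
begin

definition zero_nc_op :: "('a, 'b) nc_op" where "0 = Abs_op (\<lambda>f. 0)"
definition one_nc_op :: "('a, 'b) nc_op" where "1 = Abs_op (\<lambda>f. f)"
definition plus_nc_op :: "('a, 'b) nc_op \<Rightarrow> ('a, 'b) nc_op \<Rightarrow> ('a, 'b) nc_op" where
  "P + Q = Abs_op (\<lambda>f. app P f + app Q f)"
definition minus_nc_op :: "('a, 'b) nc_op \<Rightarrow> ('a, 'b) nc_op \<Rightarrow> ('a, 'b) nc_op" where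
  "P - Q = Abs_op (\<lambda>f. app P f - app Q f)"
definition uminus_nc_op :: "('a, 'b) nc_op \<Rightarrow> ('a, 'b) nc_op" where
  "- P = Abs_op (\<lambda>f. - app P f)"
definition times_nc_op :: "('a, 'b) nc_op \<Rightarrow> ('a, 'b) nc_op \<Rightarrow> ('a, 'b) nc_op" where
  "P * Q = Abs_op (\<lambda>f. app P (app Q f))"

lemma app_zero [simp]: "app 0 f = (0 :: ('a, 'b) ncs)"
  unfolding zero_nc_op_def by (subst app_Abs) (auto intro!: lin_filtI)

lemma app_one [simp]: "app 1 f = (f :: ('a, 'b) ncs)"
  unfolding one_nc_op_def by (subst app_Abs) (auto intro!: lin_filtI)

lemma app_plus [simp]: "app (P + Q) f = app P f + (app Q f :: ('a, 'b) ncs)"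
  unfolding plus_nc_op_def by (subst app_Abs) (auto intro!: lin_filt_plus)

lemma app_minus [simp]: "app (P - Q) f = app P f - (app Q f :: ('a, 'b) ncs)"
  unfolding minus_nc_op_def by (subst app_Abs) (auto intro!: lin_filt_minus)

lemma app_uminus [simp]: "app (- P) f = - (app P f :: ('a, 'b) ncs)"
  unfolding uminus_nc_op_def
  by (subst app_Abs) (auto intro!: lin_filtI simp: lin_filt_add[OF lin_filt_app]
      lin_filt_smult[OF lin_filt_app] lin_filt_ord[OF lin_filt_app])

lemma app_times [simp]: "app (P * Q) f = (app P (app Q f) :: ('a, 'b) ncs)"
  unfolding times_nc_op_def
  using lin_filt_comp[OF lin_filt_app[of P] lin_filt_app[of Q]] by (simp add: app_Abs)

instance
proof
  fix P Q R :: "('a, 'b) nc_op"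
  show "P + Q + R = P + (Q + R)" "P + Q = Q + P" "0 + P = P" "- P + P = 0" "P - Q = P + - Q"
    "P * Q * R = P * (Q * R)" "1 * P = P" "P * 1 = P" "(P + Q) * R = P * R + Q * R"
    "P * (Q + R) = P * Q + P * R"
    by (auto intro!: op_eqI simp: algebra_simps lin_filt_add[OF lin_filt_app])
  have "app 0 (1 :: ('a, 'b) ncs) \<noteq> app 1 1" by simp
  then show "(0 :: ('a, 'b) nc_op) \<noteq> 1" by metis
qed

end

lemma app_sum [simp]: "app (sum P A) f = (\<Sum>a\<in>A. app (P a) f)"
  by (induction A rule: infinite_finite_induct) auto

lemmas app_linear [simp] =
  lin_filt_add[OF lin_filt_app] lin_filt_diff[OF lin_filt_app] lin_filt_uminus[OF lin_filt_app]
  lin_filt_0[OF lin_filt_app] lin_filt_smult[OF lin_filt_app] lin_filt_sum[OF lin_filt_app]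

text \<open>Scalar multiples of operators.\<close>

definition op_smult :: "'k \<Rightarrow> ('a, 'k::field_char_0) nc_op \<Rightarrow> ('a, 'k) nc_op" where
  "op_smult c P = Abs_op (\<lambda>f. nc_smult c (app P f))"

lemma app_smult [simp]: "app (op_smult c P) f = nc_smult c (app P f)"
  unfolding op_smult_def by (subst app_Abs) (auto intro!: lin_filt_smult')

interpretation op: vector_space "op_smult :: 'k::field_char_0 \<Rightarrow> ('a, 'k) nc_op \<Rightarrow> ('a, 'k) nc_op"
  by standard (auto intro!: op_eqI simp: nc.scale_right_distrib nc.scale_left_distrib)

lemma op_smult_mult_left [simp]: "op_smult c P * Q = op_smult c (P * Q)"
  and op_smult_mult_right [simp]: "P * op_smult c Q = op_smult c (P * Q)"
  by (auto intro!: op_eqI)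

text \<open>Left multiplication embeds the algebra of series into the ring of operators.\<close>

definition lmul :: "('a, 'k::field_char_0) ncs \<Rightarrow> ('a, 'k) nc_op" where
  "lmul f = Abs_op (\<lambda>h. f * h)"

lemma app_lmul [simp]: "app (lmul f) h = f * h"
  unfolding lmul_def by (subst app_Abs) (auto intro!: lin_filt_mult_left lin_filt_id)

lemma lmul_simps [simp]:
  "lmul (f + g) = lmul f + lmul g" "lmul (f - g) = lmul f - lmul g" "lmul (- f) = - lmul f"
  "lmul (f * g) = lmul f * lmul g" "lmul (nc_smult c f) = op_smult c (lmul f)"
  "lmul 0 = 0" "lmul 1 = 1"
  by (auto intro!: op_eqI simp: distrib_right left_diff_distrib mult.assoc)

lemma lmul_sum [simp]: "lmul (sum f A) = (\<Sum>a\<in>A. lmul (f a))"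
  by (induction A rule: infinite_finite_induct) auto

lemma lmul_eq_iff [simp]: "lmul f = lmul g \<longleftrightarrow> f = g"
proof
  assume "lmul f = lmul g"
  then have "app (lmul f) 1 = app (lmul g) 1" by (rule arg_cong)
  then show "f = g" by simp
qed simp

text \<open>Operators that raise the degree by at least \<open>m\<close>.\<close>

definition raises :: "nat \<Rightarrow> ('a, 'k::field_char_0) nc_op \<Rightarrow> bool" where
  "raises m P \<longleftrightarrow> (\<forall>n f. ord_ge n f \<longrightarrow> ord_ge (m + n) (app P f))"

lemma raisesD: "raises m P \<Longrightarrow> ord_ge n f \<Longrightarrow> ord_ge (m + n) (app P f)"
  by (simp add: raises_def)

lemma raises_0 [simp]: "raises 0 P"
  by (simp add: raises_def lin_filt_ord[OF lin_filt_app])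

lemma raises_zero [simp]: "raises m 0"
  by (simp add: raises_def)

lemma raises_add: "raises m P \<Longrightarrow> raises m Q \<Longrightarrow> raises m (P + Q)"
  by (simp add: raises_def ord_ge_add)

lemma raises_diff: "raises m P \<Longrightarrow> raises m Q \<Longrightarrow> raises m (P - Q)"
  by (simp add: raises_def ord_ge_diff)

lemma raises_uminus: "raises m P \<Longrightarrow> raises m (- P)"
  by (simp add: raises_def)

lemma raises_smult: "raises m P \<Longrightarrow> raises m (op_smult c P)"
  by (simp add: raises_def ord_ge_smult)

lemma raises_sum: "(\<And>a. a \<in> A \<Longrightarrow> raises m (P a)) \<Longrightarrow> raises m (sum P A)"
  by (simp add: raises_def ord_ge_sum)

lemma raises_mono: "raises m P \<Longrightarrow> l \<le> m \<Longrightarrow> raises l P"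
  unfolding raises_def by (meson add_le_mono1 ord_ge_mono)

lemma raises_mult: "raises m P \<Longrightarrow> raises n Q \<Longrightarrow> raises (m + n) (P * Q)"
  by (simp add: raises_def add.assoc)

lemma raises_mult_left: "raises m Q \<Longrightarrow> raises m (P * Q)"
  and raises_mult_right: "raises m P \<Longrightarrow> raises m (P * Q)"
  using raises_mult[of 0 P m Q] raises_mult[of m P 0 Q] by auto

lemma raises_power: "raises 1 P \<Longrightarrow> raises n (P ^ n)"
proof (induction n)
  case (Suc n)
  then show ?case using raises_mult[of 1 P n "P ^ n"] by simp
qed simp

lemma raises_all: "(\<And>n. raises n P) \<Longrightarrow> P = 0"
  using raisesD[of _ P 0] by (intro op_eqI ord_ge_all) (simp add: ord_ge_all)

lemma raises_eqI: "(\<And>n. raises n (P - Q)) \<Longrightarrow> P = Q"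
  using raises_all[of "P - Q"] by simp

lemma raises_trans: "raises n (P - Q) \<Longrightarrow> raises n (Q - R) \<Longrightarrow> raises n (P - R)"
  using raises_add[of n "P - Q" "Q - R"] by simp

lemma raises_sym: "raises n (P - Q) \<Longrightarrow> raises n (Q - P)"
  using raises_uminus[of n "P - Q"] by simp

lemma raises_cong_mult:
  assumes "raises n (P - P')" "raises n (Q - Q')"
  shows "raises n (P * Q - P' * Q')"
proof -
  have "P * Q - P' * Q' = (P - P') * Q + P' * (Q - Q')" by (simp add: algebra_simps)
  then show ?thesis
    using raises_add[OF raises_mult_right[OF assms(1)] raises_mult_left[OF assms(2)]] by metis
qed

lemma raises_lmul: "ord_ge n f \<Longrightarrow> raises n (lmul f)"
  by (auto simp: raises_def ord_ge_mult)

lemma raises_lmul_iff: "raises n (lmul f) \<longleftrightarrow> ord_ge n f"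
  using raises_lmul[of n f] raisesD[of n "lmul f" 0 1] by auto

text \<open>
  \<open>act \<delta> a\<close> is the value of the series \<open>a\<close> when the operators \<open>\<delta> c\<close> are put in place of the
  letters \<open>c\<close>. It is a ring morphism in \<open>a\<close> if all \<open>\<delta> c\<close> raise the degree.
\<close>

definition act :: "('c::finite \<Rightarrow> ('a, 'k::field_char_0) nc_op) \<Rightarrow> ('c, 'k) ncs \<Rightarrow> ('a, 'k) nc_op" where
  "act \<delta> a = Abs_op (\<lambda>f. nc_lin (\<lambda>u. app (prod_list (map \<delta> u)) f) a)"

lemma app_act:
  fixes \<delta> :: "'c::finite \<Rightarrow> ('a, 'k::field_char_0) nc_op"
  shows "app (act \<delta> a) f = nc_lin (\<lambda>u. app (prod_list (map \<delta> u)) f) a"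
proof -
  have "lin_filt (\<lambda>f. nc_lin (\<lambda>u. app (prod_list (map \<delta> u)) f) a)"
  proof (rule lin_filtI)
    fix n and f :: "('a, 'k) ncs" assume *: "ord_ge n f"
    have "ord_ge n (app (prod_list (map \<delta> u)) f)" for u
      by (rule lin_filt_ord[OF lin_filt_app *])
    then show "ord_ge n (nc_lin (\<lambda>u. app (prod_list (map \<delta> u)) f) a)"
      by (auto simp: ord_ge_def nc_lin_def intro!: sum.neutral)
  qed (auto intro!: ncs_eqI simp: nc_lin_def algebra_simps sum.distrib sum_distrib_left)
  then show ?thesis by (simp add: act_def app_Abs)
qed

lemma lin_filt_app_act: "lin_filt (\<lambda>a. app (act \<delta> a) f)"
  by (simp add: app_act lin_filt_nc_lin)

lemma act_simps [simp]:
  "act \<delta> (a + b) = act \<delta> a + act \<delta> b" "act \<delta> (a - b) = act \<delta> a - act \<delta> b"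
  "act \<delta> (- a) = - act \<delta> a" "act \<delta> (nc_smult c a) = op_smult c (act \<delta> a)" "act \<delta> 0 = 0"
  by (auto intro!: op_eqI simp: lin_filt_add[OF lin_filt_app_act] lin_filt_diff[OF lin_filt_app_act]
      lin_filt_uminus[OF lin_filt_app_act] lin_filt_smult[OF lin_filt_app_act]
      lin_filt_0[OF lin_filt_app_act])

lemma act_sum [simp]: "act \<delta> (sum a A) = (\<Sum>i\<in>A. act \<delta> (a i))"
  by (induction A rule: infinite_finite_induct) auto

lemma raises_prod_list: "(\<And>c. raises 1 (\<delta> c)) \<Longrightarrow> raises (length u) (prod_list (map \<delta> u))"
proof (induction u)
  case (Cons c u)
  then show ?case using raises_mult[of 1 "\<delta> c" "length u"] by simp
qed simp

lemma act_mono: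
  assumes "\<And>c. raises 1 (\<delta> c)"
  shows "act \<delta> (nc_mono u) = prod_list (map \<delta> u)"
proof (rule op_eqI)
  fix f
  have "ord_ge (length u) (app (prod_list (map \<delta> u)) f)"
    using raisesD[OF raises_prod_list[of \<delta> u], of 0 f] assms by simp
  then show "app (act \<delta> (nc_mono u)) f = app (prod_list (map \<delta> u)) f"
    by (simp add: app_act nc_lin_mono)
qed

lemma act_var: "(\<And>c. raises 1 (\<delta> c)) \<Longrightarrow> act \<delta> (nc_var c) = \<delta> c"
  by (simp add: nc_var_def act_mono)

lemma act_one: "act \<delta> 1 = 1"
proof (rule op_eqI)
  fix f
  show "app (act \<delta> 1) f = app 1 f"
    using nc_lin_mono[of "[]" "\<lambda>u. app (prod_list (map \<delta> u)) f"]
    by (simp add: app_act nc_mono_Nil)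
qed

lemma act_mult:
  assumes "\<And>c. raises 1 (\<delta> c)"
  shows "act \<delta> (a * b) = act \<delta> a * act \<delta> b"
proof (rule op_eqI)
  fix f
  have "app (act \<delta> (nc_mono u * b)) f = app (act \<delta> (nc_mono u)) (app (act \<delta> b) f)" for u
  proof -
    have "app (act \<delta> (nc_mono u * b)) f = app (prod_list (map \<delta> u)) (app (act \<delta> b) f)"
    proof (rule lin_filt_eqI)
      show "lin_filt (\<lambda>b. app (act \<delta> (nc_mono u * b)) f)"
        by (rule lin_filt_comp[OF lin_filt_app_act lin_filt_mult_left[OF lin_filt_id]])
      show "lin_filt (\<lambda>b. app (prod_list (map \<delta> u)) (app (act \<delta> b) f))"
        by (rule lin_filt_comp[OF lin_filt_app lin_filt_app_act])
    qed (simp add: act_mono[OF assms] flip: nc_mono_append)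
    then show ?thesis by (simp add: act_mono[OF assms])
  qed
  then have "app (act \<delta> (a * b)) f = app (act \<delta> a) (app (act \<delta> b) f)"
    by (rule lin_filt_eqI[OF lin_filt_comp[OF lin_filt_app_act lin_filt_mult_right[OF lin_filt_id]]
          lin_filt_app_act])
  then show "app (act \<delta> (a * b)) f = app (act \<delta> a * act \<delta> b) f" by simp
qed

lemma raises_act:
  fixes \<delta> :: "'c::finite \<Rightarrow> ('a, 'k::field_char_0) nc_op"
  assumes "\<And>c. raises 1 (\<delta> c)" "ord_ge n a"
  shows "raises n (act \<delta> a)"
  unfolding raises_def
proof (intro allI impI)
  fix m and f :: "('a, 'k) ncs" assume f: "ord_ge m f"
  show "ord_ge (n + m) (app (act \<delta> a) f)"
    unfolding ord_ge_def app_act nc_lin_def nc_coeff_Abs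
  proof (intro allI impI sum.neutral ballI)
    fix w :: "'a list" and u :: "'c list"
    assume w: "length w < n + m"
    show "nc_coeff a u * nc_coeff (app (prod_list (map \<delta> u)) f) w = 0"
    proof (cases "length u < n")
      case True
      then show ?thesis using assms(2) by (simp add: ord_ge_def)
    next
      case False
      then have "ord_ge (n + m) (app (prod_list (map \<delta> u)) f)"
        using raisesD[OF raises_prod_list[of \<delta> u] f] assms(1) by (auto intro: ord_ge_mono)
      then show ?thesis using w by (simp add: ord_ge_def)
    qed
  qed
qed

lemma act_eqI:
  assumes "\<And>f. lin_filt (\<lambda>a. app (T a) f)" "\<And>f. lin_filt (\<lambda>a. app (S a) f)"
    and "\<And>u. T (nc_mono u) = S (nc_mono u)"
  shows "T a = S (a :: ('c::finite, 'k::field_char_0) ncs)"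
  by (rule op_eqI, rule lin_filt_eqI[OF assms(1,2)]) (simp add: assms(3))

text \<open>Intertwining passes from the letters to all series.\<close>

lemma act_intertwine:
  assumes "\<And>c. raises 1 (\<delta> c)" "\<And>c. raises 1 (\<epsilon> c)" "\<And>c. P * \<delta> c = \<epsilon> c * P"
  shows "P * act \<delta> a = act \<epsilon> a * P"
proof (rule act_eqI)
  fix u
  have "P * prod_list (map \<delta> u) = prod_list (map \<epsilon> u) * P"
  proof (induction u)
    case (Cons c u)
    then show ?case by (metis (no_types) assms(3) list.simps(9) mult.assoc prod_list.Cons)
  qed simp
  then show "P * act \<delta> (nc_mono u) = act \<epsilon> (nc_mono u) * P"
    by (simp add: act_mono assms)
qed (simp_all add: lin_filt_comp[OF lin_filt_app lin_filt_app_act] lin_filt_app_act)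

lemma nc_subst_nc_lin: "nc_subst \<sigma> = nc_lin (\<lambda>v. prod_list (map \<sigma> v))"
  by (intro ext) (simp add: nc_subst_def nc_lin_def)

lemma lin_filt_subst: "lin_filt (nc_subst \<sigma>)"
  by (simp add: nc_subst_nc_lin lin_filt_nc_lin)

lemma lmul_prod_list: "lmul (prod_list fs) = prod_list (map lmul fs)"
  by (induction fs) auto

lemma nc_subst_mono:
  assumes "\<And>a. ord_ge 1 (\<sigma> a)"
  shows "nc_subst \<sigma> (nc_mono v) = prod_list (map \<sigma> v)"
  unfolding nc_subst_nc_lin
proof (rule nc_lin_mono)
  have "raises (length v) (prod_list (map (\<lambda>a. lmul (\<sigma> a)) v))"
    by (rule raises_prod_list) (simp add: raises_lmul assms)
  then show "ord_ge (length v) (prod_list (map \<sigma> v))"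
    by (simp flip: raises_lmul_iff add: lmul_prod_list comp_def)
qed

text \<open>Substitution is an instance of \<open>act\<close>, with left multiplications as operators.\<close>

lemma lmul_subst:
  assumes "\<And>a. ord_ge 1 (\<sigma> a)"
  shows "lmul (nc_subst \<sigma> f) = act (\<lambda>a. lmul (\<sigma> a)) f"
proof (rule act_eqI)
  fix h show "lin_filt (\<lambda>f. app (lmul (nc_subst \<sigma> f)) h)"
    by (simp add: lin_filt_mult_right lin_filt_subst)
qed (simp_all add: lin_filt_app_act nc_subst_mono assms act_mono raises_lmul lmul_prod_list comp_def)

lemma act_subst:
  assumes "\<And>a. ord_ge 1 (\<sigma> a)" "\<And>c. raises 1 (\<delta> c)"
  shows "act \<delta> (nc_subst \<sigma> f) = act (\<lambda>a. act \<delta> (\<sigma> a)) f"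
proof (rule act_eqI)
  have r: "\<And>a. raises 1 (act \<delta> (\<sigma> a))" using assms by (intro raises_act) auto
  fix u
  have "act \<delta> (prod_list (map \<sigma> u)) = prod_list (map (\<lambda>a. act \<delta> (\<sigma> a)) u)"
    by (induction u) (simp_all add: act_one act_mult assms)
  then show "act \<delta> (nc_subst \<sigma> (nc_mono u)) = act (\<lambda>a. act \<delta> (\<sigma> a)) (nc_mono u)"
    using r by (simp add: nc_subst_mono assms act_mono)
qed (simp_all add: lin_filt_comp[OF lin_filt_app_act lin_filt_subst] lin_filt_app_act)

lemma nc_subst_mult:
  assumes "\<And>a. ord_ge 1 (\<sigma> a)"
  shows "nc_subst \<sigma> (f * g) = nc_subst \<sigma> f * nc_subst \<sigma> g"
  by (subst lmul_eq_iff[symmetric]) (simp add: lmul_subst assms act_mult raises_lmul del: lmul_eq_iff)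

lemma nc_subst_one:
  assumes "\<And>a. ord_ge 1 (\<sigma> a)"
  shows "nc_subst \<sigma> 1 = 1"
  by (subst lmul_eq_iff[symmetric]) (simp add: lmul_subst assms act_one raises_lmul del: lmul_eq_iff)

lemma nc_subst_var:
  assumes "\<And>a. ord_ge 1 (\<sigma> a)"
  shows "nc_subst \<sigma> (nc_var a) = \<sigma> a"
  by (simp add: nc_var_def nc_subst_mono assms)

lemma nc_subst_subst:
  assumes "\<And>a. ord_ge 1 (\<sigma> a)" "\<And>a. ord_ge 1 (\<tau> a)"
  shows "nc_subst \<tau> (nc_subst \<sigma> f) = nc_subst (\<lambda>a. nc_subst \<tau> (\<sigma> a)) f"
proof (subst lmul_eq_iff[symmetric])
  have "ord_ge 1 (nc_subst \<tau> (\<sigma> a))" for a by (simp add: lin_filt_ord[OF lin_filt_subst] assms)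
  then show "lmul (nc_subst \<tau> (nc_subst \<sigma> f)) = lmul (nc_subst (\<lambda>a. nc_subst \<tau> (\<sigma> a)) f)"
    by (simp add: lmul_subst assms act_subst raises_lmul del: lmul_eq_iff)
qed

lemmas nc_subst_linear [simp] =
  lin_filt_add[OF lin_filt_subst] lin_filt_diff[OF lin_filt_subst]
  lin_filt_uminus[OF lin_filt_subst] lin_filt_0[OF lin_filt_subst]
  lin_filt_smult[OF lin_filt_subst] lin_filt_sum[OF lin_filt_subst]

lemmas nc_subst_ord = lin_filt_ord[OF lin_filt_subst]

section \<open>Exponential and logarithm\<close>

text \<open>
  Power series in one letter: they turn \<open>nc_exp\<close> and \<open>nc_log\<close> into substitutions, so that
  compatibility with morphisms becomes compatibility of substitutions.
\<close>

lemma unit_list: "v = replicate (length v) ()"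
  by (induction v) auto

lemma unit_words: "{v :: unit list. length v < N} = (\<lambda>n. replicate n ()) ` {..<N}"
  using unit_list by (auto simp: image_iff) 

lemma unit_words': "{v :: unit list. length v \<le> N} = (\<lambda>n. replicate n ()) ` {..N}"
  using unit_list by (auto simp: image_iff)

lemma inj_replicate_unit: "inj_on (\<lambda>n. replicate n ()) A"
  by (rule inj_onI) (metis length_replicate)

lemma prod_list_const: "prod_list (map (\<lambda>_. a) v) = a ^ length v"
  by (induction v) auto

text \<open>The exponential series and the series of \<open>ln (1 + t)\<close> in one letter \<open>t\<close>.\<close>

definition exp_series :: "(unit, 'k::field_char_0) ncs" where
  "exp_series = nc_exp (nc_var ())"

definition log_series :: "(unit, 'k::field_char_0) ncs" where
  "log_series = nc_log (1 + nc_var ())"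

lemma nc_var_power: "nc_var a ^ n = nc_mono (replicate n a)"
  by (induction n) (simp_all add: nc_mono_Nil nc_mono_Cons)

lemma coeff_subst_unit:
  "nc_coeff (nc_subst (\<lambda>_. a) F) w
     = (\<Sum>n\<le>length w. nc_coeff F (replicate n ()) * nc_coeff (a ^ n) w)"
  unfolding nc_subst_def nc_coeff_Abs
  by (subst unit_words', subst sum.reindex[OF inj_replicate_unit])
    (simp add: prod_list_const)

lemma coeff_exp_series: "nc_coeff exp_series w = 1 / fact (length w)"
proof -
  have "(\<Sum>n\<le>length w. nc_coeff (nc_mono (replicate n ()) :: (unit, 'a) ncs) w / fact n)
      = (\<Sum>n\<le>length w. if n = length w then 1 / fact n else 0)"
    using unit_list[of w] by (intro sum.cong) (auto simp: coeff_mono)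
  then show ?thesis by (simp add: exp_series_def nc_exp_def nc_var_power)
qed

lemma coeff_log_series:
  "nc_coeff log_series w = (if w = [] then 0 else (-1) ^ (length w + 1) / of_nat (length w))"
proof -
  have "(\<Sum>n = 1..length w. (-1) ^ (n + 1) / of_nat n
        * nc_coeff (nc_mono (replicate n ()) :: (unit, 'a) ncs) w)
      = (\<Sum>n = 1..length w. if n = length w then (-1) ^ (n + 1) / of_nat n else 0)"
    using unit_list[of w] by (intro sum.cong) (auto simp: coeff_mono)
  then show ?thesis by (simp add: log_series_def nc_log_def nc_var_power One_nat_def Suc_le_eq)
qed

lemma nc_exp_eq_subst: "nc_exp a = nc_subst (\<lambda>_. a) exp_series"
  by (rule ncs_eqI) (simp add: coeff_subst_unit coeff_exp_series nc_exp_def)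

lemma nc_log_eq_subst: "nc_log g = nc_subst (\<lambda>_. g - 1) log_series"
proof (rule ncs_eqI)
  fix w
  show "nc_coeff (nc_log g) w = nc_coeff (nc_subst (\<lambda>_. g - 1) log_series) w"
    unfolding coeff_subst_unit nc_log_def nc_coeff_Abs
    by (rule sum.mono_neutral_cong_left) (auto simp: coeff_log_series Suc_le_eq Suc_leI One_nat_def)
qed

lemma ord_ge_log_series: "ord_ge 1 log_series"
  by (simp add: ord_ge_1_iff coeff_log_series)

lemma ord_ge_nc_log: "nc_coeff g [] = 1 \<Longrightarrow> ord_ge 1 (nc_log g)"
  by (simp add: nc_log_eq_subst nc_subst_ord ord_ge_log_series)

lemma nc_exp_subst:
  assumes "\<And>c. ord_ge 1 (\<sigma> c)" "ord_ge 1 a"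
  shows "nc_subst \<sigma> (nc_exp a) = nc_exp (nc_subst \<sigma> a)"
  by (simp add: nc_exp_eq_subst nc_subst_subst assms)

text \<open>The exponential of an operator; it is meaningful if the operator raises the degree.\<close>

definition op_exp :: "('a, 'k::field_char_0) nc_op \<Rightarrow> ('a, 'k) nc_op" where
  "op_exp P = act (\<lambda>_. P) exp_series"

lemma act_exp:
  assumes "\<And>c. raises 1 (\<delta> c)" "ord_ge 1 a"
  shows "act \<delta> (nc_exp a) = op_exp (act \<delta> a)"
  by (simp add: nc_exp_eq_subst act_subst assms op_exp_def)

lemma lmul_exp: "ord_ge 1 a \<Longrightarrow> lmul (nc_exp a) = op_exp (lmul a)"
  by (simp add: nc_exp_eq_subst lmul_subst op_exp_def)

lemma op_exp_trunc:
  assumes "raises 1 P"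
  shows "raises N (op_exp P - (\<Sum>n<N. op_smult (1 / fact n) (P ^ n)))"
proof -
  let ?p = "\<Sum>v\<in>{v. length v < N}. nc_smult (nc_coeff exp_series v) (nc_mono v)"
  have "act (\<lambda>_. P) ?p = (\<Sum>v\<in>{v :: unit list. length v < N}. op_smult (1 / fact (length v)) (P ^ length v))"
    using assms by (simp add: act_mono coeff_exp_series prod_list_const)
  also have "\<dots> = (\<Sum>n<N. op_smult (1 / fact n) (P ^ n))"
    unfolding unit_words by (subst sum.reindex[OF inj_replicate_unit]) simp
  finally show ?thesis
    using raises_act[of "\<lambda>_. P", OF assms ord_ge_trunc[of N exp_series]]
    unfolding act_simps by (simp add: op_exp_def)
qed

text \<open>
  \<open>exp_conv P X Q n\<close> is the component of total degree \<open>n\<close> in \<open>P, Q\<close> of \<open>e\<^sup>P X e\<^sup>Q\<close>. For \<open>Q = - P\<close>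
  it is \<open>1 / n!\<close> times an iterated commutator, for commuting \<open>P, Q\<close> and \<open>X = 1\<close> it is \<open>(P + Q)\<^sup>n / n!\<close>.
\<close>

primrec exp_conv ::
    "('a, 'k::field_char_0) nc_op \<Rightarrow> ('a, 'k) nc_op \<Rightarrow> ('a, 'k) nc_op \<Rightarrow> nat \<Rightarrow> ('a, 'k) nc_op" where
  "exp_conv P X Q 0 = X"
| "exp_conv P X Q (Suc n)
     = op_smult (1 / of_nat (Suc n)) (P * exp_conv P X Q n + exp_conv P X Q n * Q)"

lemma exp_conv_sum:
  "exp_conv P X Q n
     = (\<Sum>i\<le>n. op_smult (1 / fact i) (P ^ i) * X * op_smult (1 / fact (n - i)) (Q ^ (n - i)))"
proof (induction n)
  case (Suc n)
  define p where "p i = op_smult (1 / fact i) (P ^ i)" for i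
  define q where "q i = op_smult (1 / fact i) (Q ^ i)" for i
  have p: "op_smult (of_nat (Suc i)) (p (Suc i)) = P * p i" for i
    by (simp add: p_def del: of_nat_Suc)
  have q: "op_smult (of_nat (Suc i)) (q (Suc i)) = q i * Q" for i
    by (simp add: q_def power_Suc2 del: power_Suc of_nat_Suc)
  have "op_smult (of_nat (Suc n)) (\<Sum>i\<le>Suc n. p i * X * q (Suc n - i))
      = (\<Sum>i\<le>Suc n. op_smult (of_nat i) (p i) * X * q (Suc n - i))
      + (\<Sum>i\<le>Suc n. p i * X * op_smult (of_nat (Suc n - i)) (q (Suc n - i)))"
    unfolding op.scale_sum_right sum.distrib[symmetric]
    by (rule sum.cong) (simp_all flip: op.scale_left_distrib of_nat_add add: of_nat_diff)
  also have "(\<Sum>i\<le>Suc n. op_smult (of_nat i) (p i) * X * q (Suc n - i))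
      = (\<Sum>i\<le>n. P * p i * X * q (n - i))"
    by (subst sum.atMost_Suc_shift) (simp only: p, simp)
  also have "(\<Sum>i\<le>Suc n. p i * X * op_smult (of_nat (Suc n - i)) (q (Suc n - i)))
      = (\<Sum>i\<le>n. p i * X * (q (n - i) * Q))"
    by (subst sum.atMost_Suc, simp only: diff_self_eq_0 of_nat_0 op.scale_zero_left mult_zero_right
        add_0_right, rule sum.cong[OF refl], simp only: atMost_iff Suc_diff_le q)
  also have "(\<Sum>i\<le>n. P * p i * X * q (n - i)) + (\<Sum>i\<le>n. p i * X * (q (n - i) * Q))
      = P * exp_conv P X Q n + exp_conv P X Q n * Q"
    unfolding Suc.IH by (simp only: p_def q_def sum_distrib_left sum_distrib_right mult.assoc)
  finally have "exp_conv P X Q (Suc n) = op_smult (1 / of_nat (Suc n)) 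
      (op_smult (of_nat (Suc n)) (\<Sum>i\<le>Suc n. p i * X * q (Suc n - i)))"
    by simp
  also have "\<dots> = (\<Sum>i\<le>Suc n. p i * X * q (Suc n - i))"
    by (subst op.scale_scale) (simp del: of_nat_Suc)
  finally show ?case by (simp only: p_def q_def)
qed simp

lemma op_exp_conv:
  assumes P: "raises 1 P" and Q: "raises 1 Q"
  shows "raises N (op_exp P * X * op_exp Q - (\<Sum>n<N. exp_conv P X Q n))"
proof -
  define p where "p i = op_smult (1 / fact i) (P ^ i)" for i
  define q where "q i = op_smult (1 / fact i) (Q ^ i)" for i
  let ?S = "{(i, j). i < N \<and> j < N}" and ?T = "{(i, j). i + j < N}"
  have fin: "finite ?S" by (rule finite_subset[of _ "{..<N} \<times> {..<N}"]) auto
  have "raises N (op_exp P * X * op_exp Q - (\<Sum>i<N. p i) * X * (\<Sum>j<N. q j))"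
    unfolding p_def q_def
    by (intro raises_cong_mult op_exp_trunc P Q) simp
  moreover have "(\<Sum>i<N. p i) * X * (\<Sum>j<N. q j) = (\<Sum>(i, j)\<in>?S. p i * X * q j)"
    by (simp only: sum_distrib_right, simp only: sum_distrib_left sum.cartesian_product)
      (rule sum.cong, auto)
  moreover have "(\<Sum>n<N. exp_conv P X Q n) = (\<Sum>(i, j)\<in>?T. p i * X * q j)"
    by (simp only: sum.triangle_reindex exp_conv_sum p_def q_def)
  moreover have "(\<Sum>(i, j)\<in>?S. p i * X * q j) - (\<Sum>(i, j)\<in>?T. p i * X * q j)
      = (\<Sum>(i, j)\<in>?S - ?T. p i * X * q j)"
    by (rule sum_diff[symmetric, OF fin]) auto
  moreover have "raises N (\<Sum>(i, j)\<in>?S - ?T. p i * X * q j)"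
  proof (rule raises_sum)
    fix z assume "z \<in> ?S - ?T"
    then obtain i j where z: "z = (i, j)" "\<not> i + j < N" by auto
    have "raises (i + j) (p i * X * q j)"
      unfolding p_def q_def
      by (intro raises_mult raises_mult_right raises_smult raises_power P Q)
    then show "raises N (case z of (i, j) \<Rightarrow> p i * X * q j)"
      using z by (auto intro: raises_mono)
  qed
  ultimately show ?thesis by (simp only:) (erule raises_trans, simp only:)
qed

lemma op_exp_add:
  assumes "raises 1 P" "raises 1 Q" "P * Q = Q * P"
  shows "op_exp (P + Q) = op_exp P * op_exp Q"
proof -
  have c: "(P + Q) ^ n * Q = Q * (P + Q) ^ n" for n
  proof (induction n)
    case (Suc n)
    have "(P + Q) * Q = Q * (P + Q)"
      by (simp only: distrib_left distrib_right assms(3))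
    then show ?case by (simp only: power_Suc mult.assoc Suc.IH) (simp only: mult.assoc[symmetric])
  qed simp
  have "exp_conv P 1 Q n = op_smult (1 / fact n) ((P + Q) ^ n)" for n
  proof (induction n)
    case (Suc n)
    have "P * (P + Q) ^ n + (P + Q) ^ n * Q = (P + Q) ^ Suc n"
      by (simp only: c power_Suc distrib_right)
    then have "exp_conv P 1 Q (Suc n)
        = op_smult (1 / of_nat (Suc n)) (op_smult (1 / fact n) ((P + Q) ^ Suc n))"
      by (simp only: exp_conv.simps Suc.IH op_smult_mult_left op_smult_mult_right
          op.scale_right_distrib[symmetric])
    then show ?case by (simp only: op.scale_scale fact_Suc) simp
  qed simp
  then have "raises N ((\<Sum>n<N. op_smult (1 / fact n) ((P + Q) ^ n)) - op_exp P * op_exp Q)" for N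
    using raises_sym[OF op_exp_conv[OF assms(1,2), of N 1]] by simp
  then show ?thesis
    by (intro raises_eqI raises_trans[OF op_exp_trunc[OF raises_add[OF assms(1,2)]]])
qed

lemma op_exp_0 [simp]: "op_exp 0 = 1"
proof (rule raises_eqI, rule raises_trans, rule op_exp_trunc)
  fix N
  have "(\<Sum>n<N. op_smult (1 / fact n) ((0 :: ('a, 'b) nc_op) ^ n)) = (if N = 0 then 0 else 1)"
    by (induction N) (auto simp: power_0_left)
  then show "raises N ((\<Sum>n<N. op_smult (1 / fact n) ((0 :: ('a, 'b) nc_op) ^ n)) - 1)"
    by simp
qed simp

lemma op_exp_minus:
  assumes "raises 1 P"
  shows "op_exp P * op_exp (- P) = 1" "op_exp (- P) * op_exp P = 1"
  using op_exp_add[of P "- P"] op_exp_add[of "- P" P] assms raises_uminus[OF assms] by auto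

lemma op_exp_intertwine:
  assumes "raises 1 P" "raises 1 Q" "X * P = Q * X"
  shows "X * op_exp P = op_exp Q * X"
  unfolding op_exp_def by (rule act_intertwine) (use assms in auto)

lemma nc_exp_minus:
  assumes "ord_ge 1 a"
  shows "nc_exp a * nc_exp (- a) = 1" "nc_exp (- a) * nc_exp a = 1"
  unfolding lmul_eq_iff[symmetric]
  using op_exp_minus[OF raises_lmul[OF assms]] assms by (simp_all add: lmul_exp del: lmul_eq_iff)

lemma nc_exp_0 [simp]: "nc_exp 0 = 1"
  by (subst lmul_eq_iff[symmetric]) (simp add: lmul_exp del: lmul_eq_iff)

lemma coeff_exp_Nil [simp]: "nc_coeff (nc_exp a) [] = 1"
  by (simp add: nc_exp_def coeff_one)

text \<open>The degree derivation, which multiplies each word with its length.\<close>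

definition euler :: "('a, 'k::field_char_0) nc_op" where
  "euler = Abs_op (\<lambda>f. Abs_ncs (\<lambda>w. of_nat (length w) * nc_coeff f w))"

lemma coeff_euler [simp]:
  fixes f :: "('a, 'k::field_char_0) ncs"
  shows "nc_coeff (app euler f) w = of_nat (length w) * nc_coeff f w"
proof -
  have "lin_filt (\<lambda>f :: ('a, 'k) ncs. Abs_ncs (\<lambda>w. of_nat (length w) * nc_coeff f w))"
    by (rule lin_filtI) (auto intro!: ncs_eqI simp: algebra_simps ord_ge_def)
  then show ?thesis by (simp add: euler_def app_Abs)
qed

lemma euler_mult: "app euler (f * g) = app euler f * g + f * app euler g"
  by (rule ncs_eqI)
    (auto simp: coeff_times sum_distrib_left sum.distrib[symmetric] algebra_simps of_nat_diff
      intro!: sum.cong)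

lemma euler_one [simp]: "app euler 1 = 0"
  by (rule ncs_eqI) (simp add: coeff_one)

lemma euler_lmul: "euler * lmul f = lmul (app euler f) + lmul f * euler"
  by (rule op_eqI) (simp add: euler_mult)

lemma ord_ge_euler: "ord_ge n f \<Longrightarrow> ord_ge n (app euler f)"
  by (rule lin_filt_ord[OF lin_filt_app])

text \<open>
  The terms of \<open>e\<^sup>-\<^sup>a E(e\<^sup>a)\<close>, where \<open>E\<close> is the degree derivation: iterated brackets of \<open>a\<close> with
  \<open>E(a)\<close>.
\<close>

primrec dexp_term :: "('a, 'k::field_char_0) ncs \<Rightarrow> nat \<Rightarrow> ('a, 'k) ncs" where
  "dexp_term a 0 = app euler a"
| "dexp_term a (Suc n) = nc_smult (- 1 / of_nat (Suc (Suc n))) (nc_bracket a (dexp_term a n))"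

text \<open>
  As operators, \<open>e\<^sup>-\<^sup>a E e\<^sup>a = E + u\<close> with the multiplication by \<open>u = e\<^sup>-\<^sup>a E(e\<^sup>a)\<close>; the left hand side
  is expanded in iterated commutators by \<open>op_exp_conv\<close>.
\<close>

lemma log_deriv_exp:
  assumes a: "ord_ge 1 a"
  shows "ord_ge N (nc_exp (- a) * app euler (nc_exp a) - (\<Sum>n<N. dexp_term a n))"
proof -
  have conv: "exp_conv (lmul (- a)) euler (lmul a) (Suc n) = lmul (dexp_term a n)" for n
  proof (induction n)
    case 0
    show ?case by (simp add: euler_lmul)
  next
    case (Suc n)
    show ?case
      unfolding exp_conv.simps(2)[of _ _ _ "Suc n"] Suc.IH
      by (rule op_eqI, simp add: nc_bracket_def nc.scale_right_diff_distrib
           nc.scale_left_diff_distrib algebra_simps del: of_nat_Suc)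
  qed
  have "raises (Suc N) (op_exp (lmul (- a)) * euler * op_exp (lmul a)
      - (\<Sum>n<Suc N. exp_conv (lmul (- a)) euler (lmul a) n))"
    using raises_lmul[OF a] by (intro op_exp_conv) (simp_all add: raises_uminus)
  also have "op_exp (lmul (- a)) * euler * op_exp (lmul a)
      = lmul (nc_exp (- a)) * euler * lmul (nc_exp a)"
    using a by (simp only: lmul_exp ord_ge_uminus)
  also have "(\<Sum>n<Suc N. exp_conv (lmul (- a)) euler (lmul a) n)
      = euler + (\<Sum>n<N. lmul (dexp_term a n))"
    by (subst sum.lessThan_Suc_shift) (simp only: conv exp_conv.simps(1))
  finally have "ord_ge (Suc N) (app (lmul (nc_exp (- a)) * euler * lmul (nc_exp a)
      - (euler + (\<Sum>n<N. lmul (dexp_term a n)))) 1)"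
    by (metis add.right_neutral ord_ge_0 raisesD)
  then show ?thesis by (auto intro: ord_ge_mono[of "Suc N"])
qed

lemma log_deriv_exp_comm:
  assumes a: "ord_ge 1 a" and c: "nc_bracket a (app euler a) = 0"
  shows "app euler (nc_exp a) = nc_exp a * app euler a"
proof -
  have "nc_bracket a 0 = 0" by (simp add: nc_bracket_def)
  then have z: "dexp_term a (Suc n) = 0" for n
    by (induction n) (simp_all only: dexp_term.simps c nc.scale_zero_right)
  have *: "nc_exp (- a) * app euler (nc_exp a) = app euler a"
  proof (rule ord_ge_eqI)
    fix N
    have "(\<Sum>n<Suc N. dexp_term a n) = app euler a"
      by (subst sum.lessThan_Suc_shift) (simp only: z dexp_term.simps(1), simp)
    then show "ord_ge N (nc_exp (- a) * app euler (nc_exp a) - app euler a)"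
      using log_deriv_exp[OF a, of "Suc N"] by (metis ord_ge_mono le_add2 plus_1_eq_Suc)
  qed
  have "app euler (nc_exp a) = (nc_exp a * nc_exp (- a)) * app euler (nc_exp a)"
    by (simp add: nc_exp_minus a)
  also have "\<dots> = nc_exp a * app euler a"
    by (simp only: mult.assoc *)
  finally show ?thesis .
qed

lemma unit_ncs_commute: "f * g = g * (f :: (unit, 'k::field_char_0) ncs)"
proof (rule lin_filt_eqI[of "\<lambda>f. f * g" "\<lambda>f. g * f"])
  fix v
  show "nc_mono v * g = g * nc_mono v"
  proof (rule lin_filt_eqI[of "\<lambda>g. nc_mono v * g" "\<lambda>g. g * nc_mono v"])
    fix u
    have "v @ u = u @ v" by (metis add.commute length_append unit_list)
    then show "nc_mono v * nc_mono u = nc_mono u * (nc_mono v :: (unit, 'k) ncs)"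
      by (metis nc_mono_append)
  qed (intro lin_filt_mult_left lin_filt_mult_right lin_filt_id)+
qed (intro lin_filt_mult_left lin_filt_mult_right lin_filt_id)+

text \<open>
  Both sides of the next identity have constant term 1 and solve \<open>(1 + t) E(h) = t h\<close>, which
  determines the coefficients recursively.
\<close>

lemma exp_log_series: "nc_exp log_series = 1 + (nc_var () :: (unit, 'k::field_char_0) ncs)"
proof -
  let ?x = "nc_var () :: (unit, 'k) ncs" and ?l = "log_series :: (unit, 'k) ncs"
  let ?h = "nc_exp ?l"
  have 1: "(1 + ?x) * app euler ?l = ?x"
  proof (rule ncs_eqI)
    fix w
    show "nc_coeff ((1 + ?x) * app euler ?l) w = nc_coeff ?x w"
      by (cases w; cases "tl w")
        (auto simp: distrib_right coeff_var_times coeff_log_series coeff_var simp del: of_nat_Suc)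
  qed
  have *: "app euler ?h = app euler ?l * ?h"
    unfolding unit_ncs_commute[of "app euler ?l"]
    by (rule log_deriv_exp_comm[OF ord_ge_log_series]) (simp add: nc_bracket_def unit_ncs_commute)
  have 2: "(1 + ?x) * app euler ?h = ?x * ?h"
    unfolding * by (simp only: 1 mult.assoc[symmetric])
  have "nc_coeff ?h w = nc_coeff (1 + ?x) w" for w
  proof (induction w)
    case Nil
    show ?case by (simp add: coeff_one coeff_var)
  next
    case (Cons u w)
    have "nc_coeff ((1 + ?x) * app euler ?h) (u # w) = nc_coeff (?x * ?h) (u # w)"
      by (simp only: 2)
    then have "of_nat (Suc (length w)) * nc_coeff ?h (u # w)
        = (1 - of_nat (length w)) * nc_coeff ?h w"
      by (simp add: distrib_right coeff_var_times algebra_simps)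
    also have "\<dots> = (if w = [] then 1 else 0)"
      unfolding Cons.IH by (cases w; cases "tl w") (auto simp: coeff_one coeff_var)
    finally have "nc_coeff ?h (u # w) = (if w = [] then 1 else 0)"
      by (cases "w = []") (simp, simp del: of_nat_Suc)
    then show ?case by (simp add: coeff_one coeff_var)
  qed
  then show ?thesis by (rule ncs_eqI)
qed

lemma exp_log:
  assumes "nc_coeff g [] = 1"
  shows "nc_exp (nc_log g) = g"
proof -
  have g: "ord_ge 1 (g - 1)" by (simp add: ord_ge_1_iff assms coeff_one)
  have "nc_exp (nc_log g) = nc_subst (\<lambda>_::unit. g - 1) (nc_exp log_series)"
    using g by (simp add: nc_log_eq_subst nc_exp_subst ord_ge_log_series)
  also have "\<dots> = g" using g by (simp add: exp_log_series nc_subst_one nc_subst_var)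
  finally show ?thesis .
qed

section \<open>Lie series and their exponentials\<close>

lemma free_lie_const: "f \<in> free_lie A \<Longrightarrow> nc_coeff f [] = 0"
  by (induction rule: free_lie.induct) (auto simp: coeff_var nc_bracket_def)

lemma free_lie_sum: "(\<And>i. i \<in> I \<Longrightarrow> f i \<in> free_lie A) \<Longrightarrow> sum f I \<in> free_lie A"
  by (induction I rule: infinite_finite_induct) (auto intro: free_lie.zero free_lie.add)

lemma free_lie_uminus: "f \<in> free_lie A \<Longrightarrow> - f \<in> free_lie A"
  using free_lie.smult[of f A "-1"] by simp

lemma free_lie_diff: "f \<in> free_lie A \<Longrightarrow> g \<in> free_lie A \<Longrightarrow> f - g \<in> free_lie A"
  using free_lie.add[OF _ free_lie_uminus, of f A g] by simp

lemma homog_simps [simp]: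
  fixes f g :: "('a, 'k::field_char_0) ncs"
  shows "nc_homog_part d (f + g) = nc_homog_part d f + nc_homog_part d g"
    "nc_homog_part d (f - g) = nc_homog_part d f - nc_homog_part d g"
    "nc_homog_part d (nc_smult c f) = nc_smult c (nc_homog_part d f)"
    "nc_homog_part d (0 :: ('a, 'k) ncs) = 0"
  by (auto intro!: ncs_eqI)

lemma homog_sum [simp]:
  fixes f :: "'i \<Rightarrow> ('a, 'k::field_char_0) ncs"
  shows "nc_homog_part d (sum f I) = (\<Sum>i\<in>I. nc_homog_part d (f i))"
  by (induction I rule: infinite_finite_induct) auto

lemma homog_homog:
  "nc_homog_part d (nc_homog_part e f) = (if d = e then nc_homog_part d f else 0)"
  by (auto intro!: ncs_eqI)

lemma homog_eq_0: "ord_ge n f \<Longrightarrow> d < n \<Longrightarrow> nc_homog_part d f = 0"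
  by (auto intro!: ncs_eqI simp: ord_ge_def)

lemma homog_eq: "ord_ge n (f - g) \<Longrightarrow> d < n \<Longrightarrow> nc_homog_part d f = nc_homog_part d g"
  using homog_eq_0[of n "f - g" d] by simp

lemma homog_mult:
  "nc_homog_part d (f * g) = (\<Sum>i\<le>d. nc_homog_part i f * nc_homog_part (d - i) g)"
proof (rule ncs_eqI)
  fix w
  have "(\<Sum>i\<le>d. nc_coeff (nc_homog_part i f * nc_homog_part (d - i) g) w)
      = (\<Sum>i\<le>d. \<Sum>j\<le>length w. if j = i then (if length w = d
           then nc_coeff f (take j w) * nc_coeff g (drop j w) else 0) else 0)"
    unfolding coeff_times
  proof (intro sum.cong refl)
    fix i j assume "i \<in> {..d}" "j \<in> {..length w}"
    then show "nc_coeff (nc_homog_part i f) (take j w) * nc_coeff (nc_homog_part (d - i) g) (drop j w)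
        = (if j = i then (if length w = d
           then nc_coeff f (take j w) * nc_coeff g (drop j w) else 0) else 0)"
      by (cases "j = i"; cases "length w = d") (simp_all, linarith)
  qed
  also have "\<dots> = nc_coeff (nc_homog_part d (f * g)) w"
    by (subst sum.swap, cases "length w = d") (auto simp: coeff_times sum.delta intro!: sum.neutral)
  finally show "nc_coeff (nc_homog_part d (f * g)) w
      = nc_coeff (\<Sum>i\<le>d. nc_homog_part i f * nc_homog_part (d - i) g) w" by simp
qed

lemma homog_bracket:
  fixes f g :: "('a, 'k::field_char_0) ncs"
  shows "nc_homog_part d (nc_bracket f g)
     = (\<Sum>i\<le>d. nc_bracket (nc_homog_part i f) (nc_homog_part (d - i) g))"
proof -
  have "nc_homog_part d (g * f) = (\<Sum>i\<le>d. nc_homog_part (d - i) g * nc_homog_part i f)"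
    unfolding homog_mult
    by (rule sum.reindex_bij_witness[where i = "\<lambda>i. d - i" and j = "\<lambda>i. d - i"]) auto
  then show ?thesis by (simp add: nc_bracket_def homog_mult sum_subtractf)
qed

lemma homog_free_lie: "f \<in> free_lie A \<Longrightarrow> nc_homog_part d f \<in> free_lie A"
proof (induction arbitrary: d rule: free_lie.induct)
  case (gen a)
  have "nc_homog_part d (nc_var a) = (if d = 1 then nc_var a else (0 :: ('a, 'b) ncs))"
    by (auto intro!: ncs_eqI simp: coeff_var)
  then show ?case using gen by (auto intro: free_lie.intros)
qed (auto simp: homog_bracket intro!: free_lie.intros free_lie_sum)

lemma ord_ge_homog_trunc: "ord_ge N (f - (\<Sum>d<N. nc_homog_part d f))"
  by (auto simp: ord_ge_def sum.delta' if_distrib cong: if_cong)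

lemma hat_iff: "f \<in> free_lie_hat A \<longleftrightarrow> (\<forall>d. nc_homog_part d f \<in> free_lie A)"
  by (simp add: free_lie_hat_def degree_completion_def)

lemma free_lie_imp_hat: "f \<in> free_lie A \<Longrightarrow> f \<in> free_lie_hat A"
  by (simp add: hat_iff homog_free_lie)

lemma hat_trunc_mem: "f \<in> free_lie_hat A \<Longrightarrow> (\<Sum>d<N. nc_homog_part d f) \<in> free_lie A"
  by (auto simp: hat_iff intro: free_lie_sum)

lemma
  shows hat_zero [intro]: "0 \<in> free_lie_hat A"
    and hat_add: "f \<in> free_lie_hat A \<Longrightarrow> g \<in> free_lie_hat A \<Longrightarrow> f + g \<in> free_lie_hat A"
    and hat_smult: "f \<in> free_lie_hat A \<Longrightarrow> nc_smult c f \<in> free_lie_hat A"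
    and hat_diff: "f \<in> free_lie_hat A \<Longrightarrow> g \<in> free_lie_hat A \<Longrightarrow> f - g \<in> free_lie_hat A"
    and hat_bracket: "f \<in> free_lie_hat A \<Longrightarrow> g \<in> free_lie_hat A \<Longrightarrow> nc_bracket f g \<in> free_lie_hat A"
    and hat_var: "a \<in> A \<Longrightarrow> nc_var a \<in> free_lie_hat A"
  by (auto simp: hat_iff homog_bracket intro: free_lie.intros free_lie_sum free_lie_diff homog_free_lie)

lemma hat_uminus: "f \<in> free_lie_hat A \<Longrightarrow> - f \<in> free_lie_hat A"
  using hat_diff[OF hat_zero, of f A] by simp

lemma hat_sum: "(\<And>i. i \<in> I \<Longrightarrow> f i \<in> free_lie_hat A) \<Longrightarrow> sum f I \<in> free_lie_hat A"
  by (induction I rule: infinite_finite_induct) (auto intro: hat_add)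

lemma hat_ord: "f \<in> free_lie_hat A \<Longrightarrow> ord_ge 1 f"
proof -
  assume "f \<in> free_lie_hat A"
  then have "nc_coeff (nc_homog_part 0 f) [] = 0" by (intro free_lie_const[of _ A]) (simp add: hat_iff)
  then show ?thesis by (simp add: ord_ge_1_iff)
qed

lemma hat_limit:
  assumes "\<And>N. \<exists>g\<in>free_lie_hat A. ord_ge N (f - g)"
  shows "f \<in> free_lie_hat A"
  unfolding hat_iff
proof
  fix d
  obtain g where "g \<in> free_lie_hat A" "ord_ge (Suc d) (f - g)" using assms by blast
  then show "nc_homog_part d f \<in> free_lie A"
    using homog_eq[of "Suc d" f g d] by (auto simp: hat_iff)
qed

lemma homog_euler: "nc_homog_part d (app euler f) = nc_smult (of_nat d) (nc_homog_part d f)"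
  by (rule ncs_eqI) auto

lemma hat_euler: "f \<in> free_lie_hat A \<Longrightarrow> app euler f \<in> free_lie_hat A"
  by (auto simp: hat_iff homog_euler intro: free_lie.smult)

lemma hat_exp_conj:
  assumes a: "a \<in> free_lie_hat A" and x: "x \<in> free_lie_hat A"
  shows "nc_exp a * x * nc_exp (- a) \<in> free_lie_hat A"
proof (rule hat_limit)
  fix N
  note o = hat_ord[OF a]
  have "\<exists>h\<in>free_lie_hat A. exp_conv (lmul a) (lmul x) (lmul (- a)) n = lmul h" for n
  proof (induction n)
    case 0
    then show ?case using x by auto
  next
    case (Suc n)
    then obtain h where h: "h \<in> free_lie_hat A"
      "exp_conv (lmul a) (lmul x) (lmul (- a)) n = lmul h" by blast
    have "exp_conv (lmul a) (lmul x) (lmul (- a)) (Suc n)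
        = lmul (nc_smult (1 / of_nat (Suc n)) (nc_bracket a h))"
      unfolding exp_conv.simps h(2) by (simp add: nc_bracket_def)
    then show ?case using h a by (blast intro: hat_smult hat_bracket)
  qed
  then obtain h where h: "\<And>n. h n \<in> free_lie_hat A"
    "\<And>n. exp_conv (lmul a) (lmul x) (lmul (- a)) n = lmul (h n)" by metis
  have "raises N (op_exp (lmul a) * lmul x * op_exp (lmul (- a)) - (\<Sum>n<N. lmul (h n)))"
    unfolding h(2)[symmetric]
    by (rule op_exp_conv) (use raises_lmul[OF o] in \<open>simp_all add: raises_uminus\<close>)
  also have "op_exp (lmul a) * lmul x * op_exp (lmul (- a)) = lmul (nc_exp a * x * nc_exp (- a))"
    using o by (simp only: lmul_simps lmul_exp ord_ge_uminus)
  finally have "ord_ge N (nc_exp a * x * nc_exp (- a) - (\<Sum>n<N. h n))"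
    by (simp only: lmul_sum[symmetric] lmul_simps(2)[symmetric] raises_lmul_iff)
  then show "\<exists>g\<in>free_lie_hat A. ord_ge N (nc_exp a * x * nc_exp (- a) - g)"
    by (blast intro: hat_sum h)
qed

lemma hat_log_deriv:
  assumes a: "a \<in> free_lie_hat A"
  shows "nc_exp (- a) * app euler (nc_exp a) \<in> free_lie_hat A"
proof (rule hat_limit)
  fix N
  have "dexp_term a n \<in> free_lie_hat A" for n
    using a by (induction n) (auto intro: hat_euler hat_smult hat_bracket simp del: nc.scale_minus_left)
  then show "\<exists>g\<in>free_lie_hat A. ord_ge N (nc_exp (- a) * app euler (nc_exp a) - g)"
    using log_deriv_exp[OF hat_ord[OF a]] by (blast intro: hat_sum)
qed

lemma exp_first_order:
  assumes a: "ord_ge 1 a" and b: "ord_ge 1 b" and d: "ord_ge d (a - b)"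
  shows "ord_ge (Suc d) (nc_exp a - nc_exp b - (a - b))"
proof -
  have p: "ord_ge (d + n) (a ^ Suc n - b ^ Suc n)" for n
  proof (induction n)
    case (Suc n)
    have "a ^ Suc (Suc n) - b ^ Suc (Suc n) = a * (a ^ Suc n - b ^ Suc n) + (a - b) * b ^ Suc n"
      by (simp add: algebra_simps)
    moreover have "ord_ge (d + Suc n) (a * (a ^ Suc n - b ^ Suc n))"
      using ord_ge_mult[OF a Suc.IH] by simp
    moreover have "ord_ge (d + Suc n) ((a - b) * b ^ Suc n)"
      by (rule ord_ge_mult[OF d ord_ge_power[OF b]])
    ultimately show ?case by (simp only: ord_ge_add)
  qed (use d in simp)
  show ?thesis unfolding ord_ge_def
  proof (intro allI impI)
    fix w :: "'a list" assume w: "length w < Suc d"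
    have "nc_coeff (nc_exp a - nc_exp b) w
        = (\<Sum>n\<le>length w. nc_coeff (a ^ n - b ^ n) w / fact n)"
      by (simp add: nc_exp_def sum_subtractf diff_divide_distrib)
    also have "\<dots> = (\<Sum>n\<le>length w. if n = 1 then nc_coeff (a - b) w else 0)"
    proof (rule sum.cong[OF refl])
      fix n
      consider "n = 0" | "n = 1" | m where "n = Suc (Suc m)"
        by (metis One_nat_def not0_implies_Suc)
      then show "nc_coeff (a ^ n - b ^ n) w / fact n = (if n = 1 then nc_coeff (a - b) w else 0)"
      proof cases
        case 3
        then have "nc_coeff (a ^ n - b ^ n) w = 0"
          using p[of "Suc m"] w by (simp add: ord_ge_def)
        then show ?thesis using 3 by simp
      qed simp_all
    qed
    also have "\<dots> = nc_coeff (a - b) w"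
      using a[unfolded ord_ge_1_iff] b[unfolded ord_ge_1_iff]
      by (cases w) (simp_all add: sum.delta One_nat_def Suc_le_eq)
    finally show "nc_coeff (nc_exp a - nc_exp b - (a - b)) w = 0" by simp
  qed
qed

lemma nc_exp_inj:
  assumes "ord_ge 1 a" "ord_ge 1 b" "nc_exp a = nc_exp b"
  shows "a = b"
proof (rule ord_ge_eqI)
  fix n show "ord_ge n (a - b)"
  proof (induction n)
    case (Suc n)
    then show ?case using exp_first_order[OF assms(1,2) Suc] assms(3) by (simp add: ord_ge_sym)
  qed simp
qed

lemma log_exp: "ord_ge 1 a \<Longrightarrow> nc_log (nc_exp a) = a"
  by (rule nc_exp_inj) (simp_all add: ord_ge_nc_log exp_log)

text \<open>
  If \<open>a\<close> and \<open>b\<close> agree below degree \<open>d\<close>, the logarithmic derivatives of their exponentials differ in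
  degree \<open>d\<close> by \<open>E(a - b)\<close>.
\<close>

lemma homog_log_deriv:
  assumes a: "ord_ge 1 a" and b: "ord_ge 1 b" and d: "ord_ge d (a - b)"
    and u: "app euler (nc_exp a) = nc_exp a * u" and v: "app euler (nc_exp b) = nc_exp b * v"
    and v1: "ord_ge 1 v"
  shows "nc_homog_part d (u - v) = nc_smult (of_nat d) (nc_homog_part d (a - b))"
proof -
  let ?g = "nc_exp a" and ?h = "nc_exp b" and ?g' = "nc_exp (- a)"
  have gh: "ord_ge (Suc d) (?g - ?h - (a - b))" by (rule exp_first_order[OF a b d])
  have "ord_ge d (?g - ?h)" 
    using ord_ge_add[OF ord_ge_mono[OF gh, of d] d] by simp
  then have "ord_ge (Suc d) ((?g - ?h) * v)"
    using ord_ge_mult[OF _ v1, of d] by (simp add: One_nat_def)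
  moreover have "ord_ge (Suc d) (app euler (?g - ?h - (a - b)))" by (rule ord_ge_euler[OF gh])
  ultimately have "ord_ge (Suc d) (app euler (?g - ?h - (a - b)) - (?g - ?h) * v)"
    by (rule ord_ge_diff[rotated])
  then have *: "ord_ge (Suc d) (?g * (u - v) - app euler (a - b))"
    by (simp add: u v algebra_simps)
  have "ord_ge (Suc d) (?g' * (?g * (u - v) - app euler (a - b)))"
    by (rule ord_ge_mult_left[OF *])
  then have "ord_ge (Suc d) ((u - v) - ?g' * app euler (a - b))"
    by (simp only: right_diff_distrib mult.assoc[symmetric] nc_exp_minus[OF a] mult_1)
  moreover have "ord_ge (Suc d) ((?g' - 1) * app euler (a - b))"
  proof -
    have "ord_ge 1 (?g' - 1)" by (simp add: ord_ge_1_iff coeff_one)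
    then show ?thesis using ord_ge_mult[OF _ ord_ge_euler[OF d], of 1] by simp
  qed
  ultimately have "ord_ge (Suc d) ((u - v) - app euler (a - b))"
    using ord_ge_add by (fastforce simp: algebra_simps)
  then have "nc_homog_part d (u - v) = nc_homog_part d (app euler (a - b))"
    by (rule homog_eq) simp
  then show ?thesis by (simp only: homog_euler)
qed

text \<open>
  An exponential with Lie logarithmic derivative has a Lie logarithm: in each degree the
  logarithm and the logarithmic derivative differ by a Lie polynomial in the lower terms.
\<close>

lemma hat_of_log_deriv:
  assumes a: "ord_ge 1 a" and u: "app euler (nc_exp a) = nc_exp a * u" "u \<in> free_lie_hat A"
  shows "a \<in> free_lie_hat A"
  unfolding hat_iff
proof
  fix d
  show "nc_homog_part d a \<in> free_lie A"
  proof (induction d rule: less_induct)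
    case (less d)
    define b where "b = (\<Sum>i<d. nc_homog_part i a)"
    have b: "b \<in> free_lie_hat A"
      unfolding b_def using less by (intro free_lie_imp_hat free_lie_sum) auto
    define v where "v = nc_exp (- b) * app euler (nc_exp b)"
    have v: "v \<in> free_lie_hat A" unfolding v_def by (rule hat_log_deriv[OF b])
    have "app euler (nc_exp b) = nc_exp b * v"
      unfolding v_def by (simp only: mult.assoc[symmetric] nc_exp_minus[OF hat_ord[OF b]] mult_1)
    then have "nc_homog_part d (u - v) = nc_smult (of_nat d) (nc_homog_part d (a - b))"
      using ord_ge_homog_trunc[of d a] hat_ord[OF b] hat_ord[OF v]
      by (intro homog_log_deriv[OF a _ _ u(1)]) (auto simp: b_def)
    moreover have "nc_homog_part d (u - v) \<in> free_lie A"
      using hat_diff[OF u(2) v] by (simp add: hat_iff)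
    moreover have "nc_homog_part d b = 0" by (simp add: b_def homog_homog)
    ultimately have *: "nc_smult (of_nat d) (nc_homog_part d a) \<in> free_lie A" by simp
    show ?case
    proof (cases "d = 0")
      case True
      then show ?thesis using homog_eq_0[OF a, of 0] by (simp add: free_lie.zero)
    next
      case False
      then show ?thesis using free_lie.smult[OF *, of "1 / of_nat d"] by simp
    qed
  qed
qed

lemma exp_free_lieI: "a \<in> free_lie_hat A \<Longrightarrow> nc_exp a \<in> exp_free_lie A"
  by (simp add: exp_free_lie_def)

lemma exp_free_lie_one: "1 \<in> exp_free_lie A"
  using exp_free_lieI[OF hat_zero, of A] by simp

text \<open>A weak form of the Baker-Campbell-Hausdorff theorem.\<close>

lemma exp_free_lie_mult:
  assumes "g \<in> exp_free_lie A" "h \<in> exp_free_lie A"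
  shows "g * h \<in> exp_free_lie A"
proof -
  obtain a b where a: "a \<in> free_lie_hat A" "g = nc_exp a" and b: "b \<in> free_lie_hat A" "h = nc_exp b"
    using assms by (auto simp: exp_free_lie_def)
  note o = hat_ord[OF a(1)] hat_ord[OF b(1)]
  define u where "u = nc_exp (- a) * app euler (nc_exp a)"
  define v where "v = nc_exp (- b) * app euler (nc_exp b)"
  have u: "app euler g = g * u"
    unfolding u_def a by (simp only: mult.assoc[symmetric] nc_exp_minus[OF o(1)] mult_1)
  have v: "app euler h = h * v"
    unfolding v_def b by (simp only: mult.assoc[symmetric] nc_exp_minus[OF o(2)] mult_1)
  let ?w = "nc_exp (- b) * u * nc_exp b + v"
  have "h * nc_exp (- b) = 1" using b o by (simp add: nc_exp_minus)
  then have "g * u * h = g * (h * nc_exp (- b)) * u * h" by simp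
  then have w: "app euler (g * h) = (g * h) * ?w"
    unfolding euler_mult u v using b by (simp add: distrib_left mult.assoc)
  have hat: "?w \<in> free_lie_hat A"
    using hat_exp_conj[OF hat_uminus[OF b(1)] hat_log_deriv[OF a(1)]] hat_log_deriv[OF b(1)]
    unfolding u_def v_def by (intro hat_add) simp_all
  have c: "nc_coeff (g * h) [] = 1" by (simp add: a b)
  note gh = exp_log[OF c]
  have "nc_log (g * h) \<in> free_lie_hat A"
  proof (rule hat_of_log_deriv[OF ord_ge_nc_log[OF c] _ hat])
    show "app euler (nc_exp (nc_log (g * h))) = nc_exp (nc_log (g * h)) * ?w"
      unfolding gh by (rule w)
  qed
  then have "nc_exp (nc_log (g * h)) \<in> exp_free_lie A" by (rule exp_free_lieI)
  then show ?thesis unfolding gh .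
qed

lemma exp_free_lie_minus:
  "g \<in> exp_free_lie A \<Longrightarrow> \<exists>h\<in>exp_free_lie A. g * h = 1 \<and> h * g = 1"
  unfolding exp_free_lie_def using nc_exp_minus hat_uminus hat_ord by blast

lemma nc_inverse_eq:
  assumes "g * h = 1" "h * g = 1"
  shows "nc_inverse g = h"
  unfolding nc_inverse_def
proof (rule the_equality)
  fix h' assume "g * h' = 1 \<and> h' * g = 1"
  then have "h' = (h * g) * h'" using assms by simp
  also have "\<dots> = h" unfolding mult.assoc using \<open>g * h' = 1 \<and> _\<close> by simp
  finally show "h' = h" .
qed (use assms in simp)

lemma exp_free_lie_inverse:
  assumes "g \<in> exp_free_lie A"
  shows "g * nc_inverse g = 1" "nc_inverse g * g = 1" "nc_inverse g \<in> exp_free_lie A"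
proof -
  obtain h where h: "h \<in> exp_free_lie A" "g * h = 1" "h * g = 1"
    using exp_free_lie_minus[OF assms] by blast
  then have "nc_inverse g = h" by (intro nc_inverse_eq)
  with h show "g * nc_inverse g = 1" "nc_inverse g * g = 1" "nc_inverse g \<in> exp_free_lie A"
    by simp_all
qed

lemma hat_conj:
  assumes "g \<in> exp_free_lie A" "x \<in> free_lie_hat A"
  shows "g * x * nc_inverse g \<in> free_lie_hat A"
  using assms hat_exp_conj[of _ A x] nc_inverse_eq[OF nc_exp_minus] hat_ord
  unfolding exp_free_lie_def by fastforce

lemma exp_free_lie_const: "g \<in> exp_free_lie A \<Longrightarrow> nc_coeff g [] = 1"
  by (auto simp: exp_free_lie_def)

lemma exp_free_lie_log:
  assumes "g \<in> exp_free_lie A"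
  shows "nc_log g \<in> free_lie_hat A" "nc_exp (nc_log g) = g"
  using assms log_exp hat_ord unfolding exp_free_lie_def by fastforce+

lemma hat_subst:
  assumes \<sigma>: "\<And>a. ord_ge 1 (\<sigma> a)" "\<And>a. a \<in> A \<Longrightarrow> \<sigma> a \<in> free_lie_hat B"
    and f: "f \<in> free_lie_hat A"
  shows "nc_subst \<sigma> f \<in> free_lie_hat B"
proof -
  have *: "nc_subst \<sigma> f \<in> free_lie_hat B" if "f \<in> free_lie A" for f
    using that
    by induction (auto simp: nc_subst_var nc_subst_mult nc_bracket_def \<sigma>
        intro: hat_add hat_smult hat_bracket[unfolded nc_bracket_def])
  show ?thesis
  proof (rule hat_limit)
    fix N
    have "ord_ge N (nc_subst \<sigma> f - nc_subst \<sigma> (\<Sum>d<N. nc_homog_part d f))"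
      using nc_subst_ord[OF ord_ge_homog_trunc[of N f], of \<sigma>] by simp
    then show "\<exists>g\<in>free_lie_hat B. ord_ge N (nc_subst \<sigma> f - g)"
      using *[OF hat_trunc_mem[OF f]] by blast
  qed
qed

lemma exp_free_lie_subst:
  assumes \<sigma>: "\<And>a. ord_ge 1 (\<sigma> a)" "\<And>a. a \<in> A \<Longrightarrow> \<sigma> a \<in> free_lie_hat B"
    and g: "g \<in> exp_free_lie A"
  shows "nc_subst \<sigma> g \<in> exp_free_lie B"
proof -
  obtain a where a: "a \<in> free_lie_hat A" "g = nc_exp a" using g by (auto simp: exp_free_lie_def)
  then show ?thesis
    using hat_subst[OF \<sigma> a(1)] nc_exp_subst[of \<sigma> a] hat_ord[OF a(1)] \<sigma>(1) by (simp add: exp_free_lieI)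
qed

section \<open>Normalized components\<close>

lemma exhaust_2: "k = 1 \<or> k = (2 :: 2)"
proof (induct k)
  case (of_int z)
  then have "z = 0 \<or> z = 1" by simp arith
  then show ?case by auto
qed

lemma exhaust_3: "k = 1 \<or> k = 2 \<or> k = (3 :: 3)"
proof (induct k)
  case (of_int z)
  then have "z = 0 \<or> z = 1 \<or> z = 2" by simp arith
  then show ?case by auto
qed

lemma exhaust_4: "k = 1 \<or> k = 2 \<or> k = 3 \<or> k = (4 :: 4)"
proof (induct k)
  case (of_int z)
  then have "z = 0 \<or> z = 1 \<or> z = 2 \<or> z = 3" by simp arith
  then show ?case by auto
qed

lemma coeff_single_times:
  "nc_coeff (f * g) [k] = nc_coeff f [] * nc_coeff g [k] + nc_coeff f [k] * nc_coeff g []"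
  by (simp add: coeff_times One_nat_def)

lemma coeff_exp_single: "nc_coeff (nc_exp a) [k] = nc_coeff a [k]"
  by (simp add: nc_exp_def coeff_one One_nat_def)

lemma coeff_log_single: "nc_coeff (nc_log g) [k] = nc_coeff g [k]"
  by (simp add: nc_log_def coeff_one One_nat_def)

text \<open>
  A Lie series has no words \<open>k\<^sup>n\<close> with \<open>n \<noteq> 1\<close>: under abelianization all brackets vanish.
\<close>

lemma coeff_times_replicate:
  "nc_coeff (f * g) (replicate n k)
     = (\<Sum>i\<le>n. nc_coeff f (replicate i k) * nc_coeff g (replicate (n - i) k))"
  unfolding coeff_times by (simp add: min_def cong: sum.cong_simp)

lemma free_lie_pure: "f \<in> free_lie A \<Longrightarrow> n \<noteq> 1 \<Longrightarrow> nc_coeff f (replicate n k) = 0"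
proof (induction rule: free_lie.induct)
  case (gen a)
  have "length (replicate n k) \<noteq> length [a]" using gen by (simp add: One_nat_def)
  then show ?case by (auto simp: coeff_var simp del: length_replicate)
next
  case (bracket f g)
  have "nc_coeff (g * f) (replicate n k)
      = (\<Sum>i\<le>n. nc_coeff g (replicate (n - i) k) * nc_coeff f (replicate i k))"
    unfolding coeff_times_replicate
    by (rule sum.reindex_bij_witness[where i = "\<lambda>i. n - i" and j = "\<lambda>i. n - i"]) auto
  then show ?case by (simp add: nc_bracket_def coeff_times_replicate mult.commute)
qed auto

lemma exp_free_lie_pure:
  assumes g: "g \<in> exp_free_lie A" and k: "nc_coeff g [k] = 0" and n: "n > 0"
  shows "nc_coeff g (replicate n k) = 0"
proof -
  obtain a where a: "a \<in> free_lie_hat A" "g = nc_exp a" using g by (auto simp: exp_free_lie_def)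
  have a0: "nc_coeff a (replicate n k) = 0" for n
  proof (cases "n = 1")
    case True
    then show ?thesis using k by (simp add: a coeff_exp_single One_nat_def)
  next
    case False
    have "nc_homog_part n a \<in> free_lie A" using a by (simp add: hat_iff)
    from free_lie_pure[OF this False, of k] show ?thesis by simp
  qed
  have "nc_coeff (a ^ Suc m) (replicate n k) = 0" for m n
    by (simp add: coeff_times_replicate a0)
  then have z: "nc_coeff (a ^ m) (replicate n k) = 0" if "m > 0" for m n
    using that gr0_implies_Suc by blast
  have "nc_coeff (a ^ m) (replicate n k) = 0" for m
    using z[of m n] n by (cases m) (simp_all add: coeff_one)
  then show ?thesis by (simp add: a nc_exp_def)
qed

text \<open>
  A series that commutes with \<open>x\<^sub>k\<close> is a series in \<open>x\<^sub>k\<close>: letters \<open>k\<close> at the end of a word can be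
  moved to the front, until another letter is at the end.
\<close>

lemma centralizer_var:
  assumes p: "nc_var k * p = p * nc_var k" and l: "l \<in> set w" "l \<noteq> k"
  shows "nc_coeff p w = 0"
proof -
  have rot: "nc_coeff p (v @ [c]) = (if c = k then nc_coeff p (k # v) else 0)" for v c
    using arg_cong[OF p, of "\<lambda>f. nc_coeff f (k # v @ [c])"]
    by (simp add: coeff_var_times coeff_times_var)
  have *: "nc_coeff p (v @ [c] @ replicate m k) = 0" if "c \<noteq> k" for v c m
  proof (induction m arbitrary: v)
    case 0
    then show ?case using rot[of v c] that by simp
  next
    case (Suc m)
    have "v @ [c] @ replicate (Suc m) k = (v @ [c] @ replicate m k) @ [k]"
      by (simp add: replicate_append_same)
    then show ?case using rot[of "v @ [c] @ replicate m k" k] Suc[of "k # v"] by simp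
  qed
  obtain v c u where "w = v @ c # u" "c \<noteq> k" "\<forall>z\<in>set u. \<not> z \<noteq> k"
    using split_list_last_prop[of w "\<lambda>z. z \<noteq> k"] l by blast
  moreover from this have "u = replicate (length u) k"
    by (metis replicate_length_same)
  ultimately show ?thesis using *[of c v "length u"] by simp
qed

lemma tang_ord:
  assumes "\<And>k. U k \<in> exp_free_lie UNIV"
  shows "ord_ge 1 (U k * nc_var k * nc_inverse (U k))"
  using hat_ord hat_conj[OF assms hat_var] by blast

lemma tang_apply:
  "f \<in> free_lie_hat UNIV \<Longrightarrow> tang U f = nc_subst (\<lambda>k. U k * nc_var k * nc_inverse (U k)) f"
  by (simp add: tang_def lie_endo_def)

lemma tang_hat:
  assumes "\<And>k. U k \<in> exp_free_lie UNIV" "f \<in> free_lie_hat UNIV"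
  shows "tang U f \<in> free_lie_hat UNIV"
  unfolding tang_apply[OF assms(2)]
  by (rule hat_subst[OF tang_ord[OF assms(1)] _ assms(2)]) (rule hat_conj[OF assms(1) hat_var], simp)

lemma tang_var:
  assumes "\<And>k. U k \<in> exp_free_lie UNIV"
  shows "tang U (nc_var k) = U k * nc_var k * nc_inverse (U k)"
proof -
  have "nc_subst (\<lambda>k. U k * nc_var k * nc_inverse (U k)) (nc_var k)
      = U k * nc_var k * nc_inverse (U k)"
    by (rule nc_subst_var) (rule tang_ord, rule assms)
  then show ?thesis by (simp add: tang_apply hat_var)
qed

lemma normalized_unique:
  assumes U: "\<And>k. U k \<in> exp_free_lie UNIV" "\<And>k. nc_coeff (U k) [k] = 0"
    and V: "\<And>k. V k \<in> exp_free_lie UNIV" "\<And>k. nc_coeff (V k) [k] = 0"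
    and eq: "tang U = tang V"
  shows "U = V"
proof
  fix k
  let ?x = "nc_var k :: ('a, 'b) ncs"
  note Ui = exp_free_lie_inverse[OF U(1)[of k]] and Vi = exp_free_lie_inverse[OF V(1)[of k]]
  define p where "p = nc_inverse (U k) * V k"
  have UV: "U k * p = V k"
    unfolding p_def mult.assoc[symmetric] by (simp add: Ui)
  have e: "U k * ?x * nc_inverse (U k) = V k * ?x * nc_inverse (V k)"
    using fun_cong[OF eq, of ?x] by (simp only: tang_var[OF U(1)] tang_var[OF V(1)])
  have "?x * p = (nc_inverse (U k) * U k) * ?x * p" by (simp add: Ui)
  also have "\<dots> = nc_inverse (U k) * (U k * ?x * nc_inverse (U k)) * V k"
    by (simp only: p_def mult.assoc)
  also have "\<dots> = nc_inverse (U k) * (V k * ?x * nc_inverse (V k)) * V k"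
    by (simp only: e)
  also have "\<dots> = p * ?x * (nc_inverse (V k) * V k)"
    by (simp only: p_def mult.assoc)
  finally have c: "?x * p = p * ?x" by (simp add: Vi)
  have "p = 1"
  proof (rule ncs_eqI)
    fix w
    show "nc_coeff p w = nc_coeff 1 w"
    proof (cases "\<exists>l\<in>set w. l \<noteq> k")
      case True
      then show ?thesis using centralizer_var[OF c] by (auto simp: coeff_one)
    next
      case False
      define n where "n = length w"
      have w: "w = replicate n k" unfolding n_def using False by (metis replicate_length_same)
      have "nc_coeff (V k) w = (\<Sum>i\<le>n. if i = 0 then nc_coeff p w else 0)"
        unfolding UV[symmetric] w coeff_times_replicate
        using exp_free_lie_pure[OF U(1) U(2)] exp_free_lie_const[OF U(1)]
        by (intro sum.cong) auto
      then have "nc_coeff p w = nc_coeff (V k) w" by simp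
      then show ?thesis
        using exp_free_lie_pure[OF V(1) V(2)] exp_free_lie_const[OF V(1)[of k]] w
        by (cases "n = 0") (auto simp: coeff_one)
    qed
  qed
  then show "U k = V k" using UV by simp
qed

lemma normalized_components_tang:
  assumes "\<And>k. U k \<in> exp_free_lie UNIV" "\<And>k. nc_coeff (U k) [k] = 0"
  shows "normalized_components (tang U) = U"
  unfolding normalized_components_def
proof (rule the_equality)
  fix V assume "(\<forall>k. V k \<in> exp_free_lie UNIV \<and> nc_coeff (nc_log (V k)) [k] = 0) \<and> tang V = tang U"
  then show "V = U" using assms by (intro normalized_unique) (auto simp: coeff_log_single)
qed (use assms in \<open>simp add: coeff_log_single\<close>)

lemma eval2_ord:
  "ord_ge 1 u \<Longrightarrow> ord_ge 1 v \<Longrightarrow> ord_ge 1 (if (k :: 2) = 1 then u else v)"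
  by simp

lemma eval2_mem:
  assumes "\<Phi> \<in> exp_free_lie UNIV" "u \<in> free_lie_hat A" "v \<in> free_lie_hat A"
  shows "nc_eval2 \<Phi> u v \<in> exp_free_lie A"
  unfolding nc_eval2_def
  by (rule exp_free_lie_subst[OF eval2_ord[OF hat_ord hat_ord] _ assms(1)]) (use assms in auto)

lemma eval2_linear_part:
  assumes "ord_ge 2 (\<Phi> - 1)" "ord_ge 1 u" "ord_ge 1 v"
  shows "nc_coeff (nc_eval2 \<Phi> u v) [k] = 0"
proof -
  have "nc_subst (\<lambda>k::2. if k = 1 then u else v) 1 = 1"
    by (rule nc_subst_one) (use assms in auto)
  then have "ord_ge 2 (nc_eval2 \<Phi> u v - 1)"
    using nc_subst_ord[OF assms(1), of "\<lambda>k. if k = 1 then u else v"] by (simp add: nc_eval2_def)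
  then show ?thesis by (auto simp: ord_ge_def coeff_one dest: spec[of _ "[k]"])
qed

text \<open>The normalized components of \<open>\<mu>\<^sub>\<Phi>\<close>.\<close>

definition mu_comp :: "(2, 'k::field_char_0) ncs \<Rightarrow> 2 \<Rightarrow> (2, 'k) ncs" where
  "mu_comp \<Phi> k = (if k = 1 then nc_eval2 \<Phi> (nc_var 1) (- nc_var 1 - nc_var 2)
     else nc_exp (nc_smult (-1/2) (nc_var 1 + nc_var 2)) * nc_eval2 \<Phi> (nc_var 2) (- nc_var 1 - nc_var 2)
       * nc_exp (nc_smult (1/2) (nc_var 2)))"

lemma mu_comp_mem:
  assumes "\<Phi> \<in> exp_free_lie UNIV"
  shows "mu_comp \<Phi> k \<in> exp_free_lie UNIV"
  unfolding mu_comp_def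
  by (auto intro!: exp_free_lie_mult exp_free_lieI eval2_mem assms hat_smult hat_add hat_diff hat_uminus hat_var)

lemma mu_eq_tang:
  fixes \<Phi> :: "(2, 'k::field_char_0) ncs"
  assumes \<Phi>: "\<Phi> \<in> exp_free_lie UNIV"
  shows "mu \<Phi> = tang (mu_comp \<Phi>)"
proof -
  let ?x = "nc_var 1 :: (2, 'k) ncs" and ?y = "nc_var 2 :: (2, 'k) ncs"
  let ?Q = "nc_eval2 \<Phi> ?y (- ?x - ?y)"
  define a where "a = nc_exp (nc_smult (-1/2) (?x + ?y))"
  define a' where "a' = nc_exp (nc_smult (1/2) (?x + ?y))"
  define b where "b = nc_exp (nc_smult (1/2) ?y)"
  define b' where "b' = nc_exp (nc_smult (-1/2) ?y)"
  have o: "ord_ge 1 (nc_smult (1/2) (?x + ?y))" "ord_ge 1 (nc_smult (1/2) ?y)"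
    by (intro ord_ge_smult ord_ge_add ord_ge_nc_var)+
  have a: "a * a' = 1" "a' * a = 1" and b: "b * b' = 1" "b' * b = 1"
    using nc_exp_minus[OF o(1)] nc_exp_minus[OF o(2)] by (simp_all add: a_def a'_def b_def b'_def)
  have "?Q \<in> exp_free_lie UNIV"
    by (intro eval2_mem \<Phi> hat_diff hat_uminus hat_var) auto
  note Q = exp_free_lie_inverse[OF this]
  have by': "b * ?y = ?y * b"
    using op_exp_intertwine[OF raises_lmul[OF o(2)] raises_lmul[OF o(2)], of "lmul ?y"]
    by (simp add: b_def lmul_eq_iff[symmetric] lmul_exp[OF o(2)] del: lmul_eq_iff)
  have "nc_inverse (a * ?Q * b) = b' * nc_inverse ?Q * a'"
  proof (rule nc_inverse_eq)
    have "a * ?Q * b * (b' * nc_inverse ?Q * a') = a * (?Q * (b * b') * nc_inverse ?Q) * a'"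
      by (simp only: mult.assoc)
    then show "a * ?Q * b * (b' * nc_inverse ?Q * a') = 1" by (simp add: a b Q)
    have "b' * nc_inverse ?Q * a' * (a * ?Q * b) = b' * (nc_inverse ?Q * (a' * a) * ?Q) * b"
      by (simp only: mult.assoc)
    then show "b' * nc_inverse ?Q * a' * (a * ?Q * b) = 1" by (simp add: a b Q)
  qed
  then have "(a * ?Q * b) * ?y * nc_inverse (a * ?Q * b)
      = a * ?Q * (b * ?y) * b' * nc_inverse ?Q * a'" by (simp only: mult.assoc)
  also have "\<dots> = a * ?Q * ?y * (b * b') * nc_inverse ?Q * a'" by (simp only: by' mult.assoc)
  finally have y: "(a * ?Q * b) * ?y * nc_inverse (a * ?Q * b) = a * ?Q * ?y * nc_inverse ?Q * a'"
    by (simp add: b)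
  show ?thesis
    unfolding mu_def tang_def Let_def mu_comp_def
  proof (rule arg_cong[where f = lie_endo], rule ext)
    fix k :: 2
    show "(if k = 1 then nc_eval2 \<Phi> ?x (- ?x - ?y) * ?x * nc_inverse (nc_eval2 \<Phi> ?x (- ?x - ?y))
        else nc_exp (nc_smult (-1/2) (?x + ?y)) * ?Q * ?y * nc_inverse ?Q
          * nc_exp (nc_smult (1/2) (?x + ?y)))
      = (if k = 1 then nc_eval2 \<Phi> ?x (- ?x - ?y)
          else nc_exp (nc_smult (-1/2) (?x + ?y)) * ?Q * nc_exp (nc_smult (1/2) ?y)) * nc_var k
        * nc_inverse (if k = 1 then nc_eval2 \<Phi> ?x (- ?x - ?y)
          else nc_exp (nc_smult (-1/2) (?x + ?y)) * ?Q * nc_exp (nc_smult (1/2) ?y))"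
      using exhaust_2[of k] y[symmetric] by (auto simp: a_def a'_def b_def)
  qed
qed

lemma normalized_components_mu:
  assumes \<Phi>: "\<Phi> \<in> exp_free_lie UNIV" "ord_ge 2 (\<Phi> - 1)"
  shows "normalized_components (mu \<Phi>) = mu_comp \<Phi>"
  unfolding mu_eq_tang[OF \<Phi>(1)]
proof (rule normalized_components_tang)
  fix k :: 2
  have o: "ord_ge 1 (- nc_var 1 - nc_var 2 :: (2, 'a) ncs)" by (simp add: ord_ge_diff)
  have *: "nc_coeff (nc_eval2 \<Phi> u v) [] = 1" if "u \<in> free_lie_hat UNIV" "v \<in> free_lie_hat UNIV" for u v :: "(2, 'a) ncs"
    using eval2_mem[OF \<Phi>(1) that] by (rule exp_free_lie_const)
  have h: "- nc_var 1 - nc_var 2 \<in> free_lie_hat (UNIV :: 2 set)" 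
    by (intro hat_diff hat_uminus hat_var) auto
  show "nc_coeff (mu_comp \<Phi> k) [k] = 0"
    using exhaust_2[of k]
    by (auto simp: mu_comp_def eval2_linear_part[OF \<Phi>(2) _ o] coeff_single_times coeff_exp_single coeff_var
        *[OF hat_var h])
qed (rule mu_comp_mem[OF \<Phi>(1)])

section \<open>The action of infinitesimal braids on series\<close>

text \<open>
  \<open>P\<close> is a derivation; the Leibniz rule is stated as the commutator of \<open>P\<close> with left
  multiplications.
\<close>

definition is_der :: "('a, 'k::field_char_0) nc_op \<Rightarrow> bool" where
  "is_der P \<longleftrightarrow> (\<forall>f. P * lmul f = lmul (app P f) + lmul f * P)"

lemma is_derD: "is_der P \<Longrightarrow> P * lmul f = lmul (app P f) + lmul f * P"
  by (simp add: is_der_def)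

lemma is_der_mult: "is_der P \<Longrightarrow> app P (f * h) = app P f * h + f * app P h"
  using arg_cong[OF is_derD, of P "\<lambda>T. app T h" f] by simp

lemma is_derI:
  assumes "\<And>f h. app P (f * h) = app P f * h + f * app P h"
  shows "is_der P"
  unfolding is_der_def by (intro allI op_eqI) (simp add: assms)

lemma is_der_one: "is_der P \<Longrightarrow> app P 1 = 0"
  using is_der_mult[of P 1 1] by simp

lemma is_der_0: "is_der 0"
  by (rule is_derI) simp

lemma is_der_add: "is_der P \<Longrightarrow> is_der Q \<Longrightarrow> is_der (P + Q)"
  by (rule is_derI) (simp add: is_der_mult algebra_simps)

lemma is_der_smult: "is_der P \<Longrightarrow> is_der (op_smult c P)"
  by (rule is_derI) (simp add: is_der_mult nc.scale_right_distrib)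

lemma is_der_commutator: "is_der P \<Longrightarrow> is_der Q \<Longrightarrow> is_der (P * Q - Q * P)"
  by (rule is_derI) (simp add: is_der_mult algebra_simps)

lemma is_der_eqI:
  fixes P Q :: "('a::finite, 'k::field_char_0) nc_op"
  assumes "is_der P" "is_der Q" "\<And>a. app P (nc_var a) = app Q (nc_var a)"
  shows "P = Q"
proof (rule op_eqI, rule lin_filt_eqI[OF lin_filt_app lin_filt_app])
  fix v
  show "app P (nc_mono v) = app Q (nc_mono v)"
    by (induction v) (simp_all add: nc_mono_Nil nc_mono_Cons is_der_one is_der_mult assms)
qed

text \<open>The continuous derivation with given values on the letters, and its value on a word.\<close>

definition der_op :: "('a::finite \<Rightarrow> ('a, 'k::field_char_0) ncs) \<Rightarrow> ('a, 'k) nc_op" where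
  "der_op \<delta> = Abs_op (nc_derivation \<delta>)"

definition der_word :: "('a \<Rightarrow> ('a, 'k::field_char_0) ncs) \<Rightarrow> 'a list \<Rightarrow> ('a, 'k) ncs" where
  "der_word \<delta> v = (\<Sum>i<length v. nc_mono (take i v) * \<delta> (v ! i) * nc_mono (drop (Suc i) v))"

lemma nc_derivation_nc_lin: "nc_derivation \<delta> = nc_lin (der_word \<delta>)"
  by (intro ext) (simp only: nc_derivation_def nc_lin_def der_word_def)

lemma app_der_op: "app (der_op \<delta>) = nc_derivation \<delta>"
  by (simp add: der_op_def app_Abs nc_derivation_nc_lin lin_filt_nc_lin)

lemma der_word_Nil [simp]: "der_word \<delta> [] = 0"
  by (simp add: der_word_def)

lemma der_word_Cons: "der_word \<delta> (a # v) = \<delta> a * nc_mono v + nc_var a * der_word \<delta> v"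
  by (simp add: der_word_def sum.lessThan_Suc_shift nc_mono_Nil nc_mono_Cons sum_distrib_left
      mult.assoc del: sum.lessThan_Suc)

lemma der_word_append: "der_word \<delta> (u @ v) = der_word \<delta> u * nc_mono v + nc_mono u * der_word \<delta> v"
  by (induction u) (simp_all add: der_word_Cons nc_mono_Nil nc_mono_Cons nc_mono_append algebra_simps)

context
  fixes \<delta> :: "'a::finite \<Rightarrow> ('a, 'k::field_char_0) ncs"
  assumes \<delta>: "\<And>a. ord_ge 2 (\<delta> a)"
begin

lemma ord_ge_der_word: "ord_ge (Suc (length v)) (der_word \<delta> v)"
proof (induction v)
  case (Cons a v)
  have "ord_ge (2 + length v) (\<delta> a * nc_mono v)" by (rule ord_ge_mult[OF \<delta>]) simp
  moreover have "ord_ge (1 + Suc (length v)) (nc_var a * der_word \<delta> v)"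
    by (rule ord_ge_mult[OF _ Cons]) simp
  ultimately show ?case by (simp add: der_word_Cons ord_ge_add)
qed simp

lemma app_der_op_mono: "app (der_op \<delta>) (nc_mono v) = der_word \<delta> v"
  unfolding app_der_op nc_derivation_nc_lin
  by (rule nc_lin_mono) (rule ord_ge_mono[OF ord_ge_der_word], simp)

lemma app_der_op_var: "app (der_op \<delta>) (nc_var a) = \<delta> a"
  by (simp add: nc_var_def app_der_op_mono der_word_Cons nc_mono_Nil)

lemma is_der_der_op: "is_der (der_op \<delta>)"
proof (rule is_derI)
  fix f h
  show "app (der_op \<delta>) (f * h) = app (der_op \<delta>) f * h + f * app (der_op \<delta>) h"
  proof (rule lin_filt_eqI[where f = f])
    fix v
    show "app (der_op \<delta>) (nc_mono v * h) = app (der_op \<delta>) (nc_mono v) * h + nc_mono v * app (der_op \<delta>) h"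
    proof (rule lin_filt_eqI[where f = h])
      fix u
      show "app (der_op \<delta>) (nc_mono v * nc_mono u)
          = app (der_op \<delta>) (nc_mono v) * nc_mono u + nc_mono v * app (der_op \<delta>) (nc_mono u)"
        by (simp add: app_der_op_mono der_word_append flip: nc_mono_append)
    qed (rule lin_filt_comp[OF lin_filt_app] lin_filt_plus lin_filt_mult_left lin_filt_mult_right
        lin_filt_id lin_filt_app)+
  qed (rule lin_filt_comp[OF lin_filt_app] lin_filt_plus lin_filt_mult_left lin_filt_mult_right
        lin_filt_id lin_filt_app)+
qed

lemma raises_der_op: "raises 1 (der_op \<delta>)"
  unfolding raises_def app_der_op nc_derivation_nc_lin
proof (intro allI impI)
  fix n and f :: "('a, 'k) ncs" assume f: "ord_ge n f"
  show "ord_ge (1 + n) (nc_lin (der_word \<delta>) f)"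
    unfolding ord_ge_def nc_lin_def nc_coeff_Abs
  proof (intro allI impI sum.neutral ballI)
    fix w v :: "'a list"
    assume w: "length w < 1 + n"
    show "nc_coeff f v * nc_coeff (der_word \<delta> v) w = 0"
    proof (cases "length v < n")
      case True
      then show ?thesis using f by (simp add: ord_ge_def)
    next
      case False
      then show ?thesis using ord_ge_der_word[of v] w by (simp add: ord_ge_def)
    qed
  qed
qed

end

text \<open>The derivation \<open>ad t\<^sub>i\<^sub>j\<close>, given by its values on the letters.\<close>

definition letter_der :: "'n::finite \<Rightarrow> 'n \<Rightarrow> 'n \<Rightarrow> ('n, 'k::field_char_0) ncs" where
  "letter_der i j l = (if l = i then nc_bracket (nc_var i) (nc_var j)
     else if l = j then nc_bracket (nc_var j) (nc_var i) else 0)"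

definition D_op :: "'n::finite \<Rightarrow> 'n \<Rightarrow> ('n, 'k::field_char_0) nc_op" where
  "D_op i j = der_op (letter_der i j)"

lemma ad_gen_eq: "ad_gen (i, j) = app (D_op i j)"
  by (simp add: ad_gen_def D_op_def app_der_op letter_der_def[abs_def])

lemma ord_ge_letter_der: "ord_ge 2 (letter_der i j l)"
proof -
  have "ord_ge (1 + 1) (nc_var a * nc_var b :: ('a, 'b) ncs)" for a b
    by (intro ord_ge_mult) auto
  then have "ord_ge 2 (nc_var a * nc_var b :: ('a, 'b) ncs)" for a b
    by (simp only: one_add_one)
  then show ?thesis by (auto simp: letter_der_def nc_bracket_def ord_ge_diff)
qed

lemma app_D_op_var: "app (D_op i j) (nc_var l) = letter_der i j l"
  unfolding D_op_def by (rule app_der_op_var, rule ord_ge_letter_der)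

lemma is_der_D_op: "is_der (D_op i j)"
  unfolding D_op_def by (rule is_der_der_op, rule ord_ge_letter_der)

lemma raises_D_op: "raises 1 (D_op i j)"
  unfolding D_op_def by (rule raises_der_op, rule ord_ge_letter_der)

text \<open>
  A family of degree-raising operators that satisfies the relations of the infinitesimal braid Lie
  algebra. The strands are the elements of the index type; the operators \<open>B i i\<close> play no role, but
  are required to raise the degree so that \<open>act\<close> applies to all pairs.
\<close>

definition braid_rel :: "('s \<Rightarrow> 's \<Rightarrow> ('a, 'k::field_char_0) nc_op) \<Rightarrow> bool" where
  "braid_rel B \<longleftrightarrow> (\<forall>i j. raises 1 (B i j)) \<and> (\<forall>i j. i \<noteq> j \<longrightarrow> B j i = B i j)
     \<and> (\<forall>i j k. distinct [i, j, k] \<longrightarrow> B i j * (B i k + B j k) = (B i k + B j k) * B i j)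
     \<and> (\<forall>i j k l. distinct [i, j, k, l] \<longrightarrow> B i j * B k l = B k l * B i j)"

text \<open>
  The action of the infinitesimal braids with one extra strand \<open>None\<close>, whose generators act by left
  multiplication with the letters.
\<close>

fun strand_op :: "'n::finite option \<Rightarrow> 'n option \<Rightarrow> ('n, 'k::field_char_0) nc_op" where
  "strand_op None None = 0"
| "strand_op None (Some j) = lmul (nc_var j)"
| "strand_op (Some i) None = lmul (nc_var i)"
| "strand_op (Some i) (Some j) = D_op i j"

lemma D_op_sym: "D_op i j = D_op j i"
  by (rule is_der_eqI[OF is_der_D_op is_der_D_op]) (simp add: app_D_op_var letter_der_def)

lemma D_op_lmul: "D_op i j * lmul (nc_var l) = lmul (letter_der i j l) + lmul (nc_var l) * D_op i j"
  using is_derD[OF is_der_D_op, of i j "nc_var l"] by (simp add: app_D_op_var)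

lemma braid_strand_op: "braid_rel (strand_op :: 'n::finite option \<Rightarrow> 'n option \<Rightarrow> ('n, 'k::field_char_0) nc_op)"
  unfolding braid_rel_def
proof (intro conjI allI impI)
  fix i j k l :: "'n option"
  let ?B = "strand_op :: 'n option \<Rightarrow> 'n option \<Rightarrow> ('n, 'k) nc_op"
  show "raises 1 (?B i j)"
    by (cases i; cases j) (simp_all add: raises_D_op raises_lmul)
  show "i \<noteq> j \<Longrightarrow> ?B j i = ?B i j"
    by (cases i; cases j) (auto simp: D_op_sym)
  show "?B i j * (?B i k + ?B j k) = (?B i k + ?B j k) * ?B i j" if "distinct [i, j, k]"
  proof -
    have D: "D_op a b * (D_op a c + D_op b c) = (D_op a c + D_op b c) * (D_op a b :: ('n, 'k) nc_op)"
      if "distinct [a, b, c]" for a b c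
    proof -
      have n: "a \<noteq> b" "b \<noteq> a" "a \<noteq> c" "c \<noteq> a" "b \<noteq> c" "c \<noteq> b" using that by auto
      have "D_op a b * (D_op a c + D_op b c) - (D_op a c + D_op b c) * (D_op a b :: ('n, 'k) nc_op) = 0"
      proof (rule is_der_eqI)
        fix l
        show "app (D_op a b * (D_op a c + D_op b c) - (D_op a c + D_op b c) * D_op a b) (nc_var l)
            = app 0 (nc_var l :: ('n, 'k) ncs)"
          by (cases "l = a"; cases "l = b"; cases "l = c")
            (simp_all add: n app_D_op_var letter_der_def nc_bracket_def is_der_mult[OF is_der_D_op] algebra_simps)
      qed (intro is_der_commutator is_der_add is_der_D_op is_der_0)+
      then show ?thesis by simp
    qed
    show ?thesis
      using that
      by (cases i; cases j; cases k)
        (simp_all add: D, auto simp: D_op_lmul letter_der_def nc_bracket_def algebra_simps)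
  qed
  show "?B i j * ?B k l = ?B k l * ?B i j" if "distinct [i, j, k, l]"
  proof -
    have D: "D_op a b * D_op c d = D_op c d * (D_op a b :: ('n, 'k) nc_op)"
      if "distinct [a, b, c, d]" for a b c d
    proof -
      have n: "a \<noteq> b" "b \<noteq> a" "a \<noteq> c" "c \<noteq> a" "b \<noteq> c" "c \<noteq> b"
          "a \<noteq> d" "d \<noteq> a" "b \<noteq> d" "d \<noteq> b" "c \<noteq> d" "d \<noteq> c" using that by auto
      have "D_op a b * D_op c d - D_op c d * (D_op a b :: ('n, 'k) nc_op) = 0"
      proof (rule is_der_eqI)
        fix l
        show "app (D_op a b * D_op c d - D_op c d * D_op a b) (nc_var l)
            = app 0 (nc_var l :: ('n, 'k) ncs)"
          by (cases "l = a"; cases "l = b"; cases "l = c"; cases "l = d")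
            (simp_all add: n app_D_op_var letter_der_def nc_bracket_def is_der_mult[OF is_der_D_op] algebra_simps)
      qed (intro is_der_commutator is_der_D_op is_der_0)+
      then show ?thesis by simp
    qed
    show ?thesis
      using that
      by (cases i; cases j; cases k; cases l) (auto simp: D_op_lmul letter_der_def intro!: D)
  qed
qed

text \<open>The extension of \<open>ad\<close> to all series in the letters \<open>t\<^sub>i\<^sub>j\<close>; on group-like series it is \<open>Ad\<close>.\<close>

abbreviation act_D :: "('n::finite \<times> 'n, 'k::field_char_0) ncs \<Rightarrow> ('n, 'k) nc_op" where
  "act_D \<equiv> act (\<lambda>(i, j). D_op i j)"

lemma raises_D_pair: "raises 1 ((\<lambda>(i, j). D_op i j) p)"
  by (cases p) (simp add: raises_D_op)

lemma act_D_exp: "ord_ge 1 a \<Longrightarrow> act_D (nc_exp a) = op_exp (act_D a)"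
  by (rule act_exp) (rule raises_D_pair)

lemma ad_t_eq: "ad_t a f = app (act_D a) f"
proof -
  have "foldr ad_gen u f = app (prod_list (map (\<lambda>(i, j). D_op i j) u)) f" for u
    by (induction u) (auto simp: ad_gen_eq)
  then show ?thesis by (simp add: ad_t_def app_act nc_lin_def)
qed

lemma app_power: "app (P ^ n) f = (app P ^^ n) f"
  by (induction n) auto

lemma coeff_op_exp:
  "nc_coeff (app (op_exp P) f) w = (\<Sum>n\<le>length w. nc_coeff (app (P ^ n) f) w / fact n)"
  by (simp add: op_exp_def app_act nc_lin_def prod_list_const unit_words'
      sum.reindex[OF inj_replicate_unit] coeff_exp_series)

lemma Ad_t_eq:
  assumes g: "g \<in> exp_free_lie A" and f: "f \<in> free_lie_hat UNIV"
  shows "Ad_t g f = app (act_D g) f"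
proof -
  have "Ad_t g f = app (op_exp (act_D (nc_log g))) f"
  proof (rule ncs_eqI)
    fix w
    have "ad_t (nc_log g) = app (act_D (nc_log g))" by (rule ext) (rule ad_t_eq)
    then show "nc_coeff (Ad_t g f) w = nc_coeff (app (op_exp (act_D (nc_log g))) f) w"
      using f by (simp add: Ad_t_def coeff_op_exp app_power)
  qed
  also have "\<dots> = app (act_D g) f"
    using act_D_exp[OF hat_ord[OF exp_free_lie_log(1)[OF g]]] exp_free_lie_log(2)[OF g]
    by simp
  finally show ?thesis .
qed

text \<open>Lie series in derivations are derivations, and their exponentials are automorphisms.\<close>

lemma is_der_act_hat:
  assumes \<delta>: "\<And>c. raises 1 (\<delta> c)" "\<And>c. is_der (\<delta> c)" and u: "u \<in> free_lie_hat A"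
  shows "is_der (act \<delta> u)"
proof -
  have p: "is_der (act \<delta> u)" if "u \<in> free_lie A" for u
    using that
  proof induction
    case (bracket f g)
    then show ?case using is_der_commutator[of "act \<delta> f" "act \<delta> g"]
      by (simp add: nc_bracket_def act_mult \<delta>)
  qed (simp_all add: act_var \<delta> is_der_0 is_der_add is_der_smult)
  show ?thesis
    unfolding is_der_def
  proof (intro allI raises_eqI)
    fix f N
    let ?P = "act \<delta> u" and ?Q = "act \<delta> (\<Sum>d<N. nc_homog_part d u)"
    have r: "raises N (?P - ?Q)"
      using raises_act[of \<delta>, OF \<delta>(1) ord_ge_homog_trunc[of N u]] by (simp only: act_simps)
    have "raises N (lmul (app (?P - ?Q) f))"
      using raisesD[OF r, of 0 f] by (intro raises_lmul) simp
    then have "raises N ((?P - ?Q) * lmul f - (lmul (app (?P - ?Q) f) + lmul f * (?P - ?Q)))"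
      using r by (intro raises_diff raises_add) (auto intro: raises_mult_left raises_mult_right)
    moreover have "?Q * lmul f - (lmul (app ?Q f) + lmul f * ?Q) = 0"
      using p[OF hat_trunc_mem[OF u]] by (simp only: is_derD diff_self)
    ultimately show "raises N (?P * lmul f - (lmul (app ?P f) + lmul f * ?P))"
      by (simp del: act_sum add: algebra_simps)
  qed
qed

lemma op_exp_der:
  assumes P: "raises 1 P" "is_der P"
  shows "op_exp P * lmul f = lmul (app (op_exp P) f) * op_exp P"
proof -
  have *: "exp_conv P (lmul f) (- P) n = lmul (nc_smult (1 / fact n) (app (P ^ n) f))" for n
  proof (induction n)
    case (Suc n)
    have "P * lmul g + lmul g * (- P) = lmul (app P g)" for g
      using is_derD[OF P(2), of g] by simp
    then show ?case
      unfolding exp_conv.simps Suc.IH by (simp del: lmul_simps(5) of_nat_Suc add: lmul_simps(5)[symmetric])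
  qed simp
  have "op_exp P * lmul f * op_exp (- P) = lmul (app (op_exp P) f)"
  proof (rule raises_eqI, rule raises_trans)
    fix N
    show "raises N (op_exp P * lmul f * op_exp (- P) - (\<Sum>n<N. exp_conv P (lmul f) (- P) n))"
      by (rule op_exp_conv[OF P(1) raises_uminus[OF P(1)]])
    have "ord_ge (N + 0) (app (op_exp P - (\<Sum>n<N. op_smult (1 / fact n) (P ^ n))) f)"
      by (rule raisesD[OF op_exp_trunc[OF P(1)]]) simp
    then have "raises N (lmul (app (op_exp P) f) - (\<Sum>n<N. exp_conv P (lmul f) (- P) n))"
      unfolding * by (simp only: lmul_sum[symmetric] lmul_simps(2)[symmetric] raises_lmul_iff app_minus
          app_sum app_smult add_0_right)
    then show "raises N ((\<Sum>n<N. exp_conv P (lmul f) (- P) n) - lmul (app (op_exp P) f))"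
      by (rule raises_sym)
  qed
  then have "lmul (app (op_exp P) f) * op_exp P = (op_exp P * lmul f * op_exp (- P)) * op_exp P"
    by simp
  also have "\<dots> = op_exp P * lmul f * (op_exp (- P) * op_exp P)"
    by (simp only: mult.assoc)
  finally show ?thesis by (simp add: op_exp_minus P)
qed

lemma act_D_lmul:
  assumes g: "g \<in> exp_free_lie A"
  shows "act_D g * lmul f = lmul (app (act_D g) f) * act_D g"
proof -
  let ?u = "nc_log g"
  have u: "?u \<in> free_lie_hat A" "nc_exp ?u = g" using exp_free_lie_log[OF g] by auto
  have "is_der ((\<lambda>(i, j). D_op i j) p)" for p :: "'a \<times> 'a" by (cases p) (simp add: is_der_D_op)
  then have d: "is_der (act_D ?u)" by (rule is_der_act_hat[OF raises_D_pair _ u(1)])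
  have r: "raises 1 (act_D ?u)" by (rule raises_act[OF raises_D_pair hat_ord[OF u(1)]])
  have "act_D g = op_exp (act_D ?u)"
    using act_D_exp[OF hat_ord[OF u(1)]] u(2) by simp
  then show ?thesis using op_exp_der[OF r d] by simp
qed

section \<open>Associators as identities between operators\<close>

text \<open>The value of the two-letter series \<open>\<Phi>\<close> on a pair of operators.\<close>

definition ev2 :: "(2, 'k::field_char_0) ncs \<Rightarrow> ('a, 'k) nc_op \<Rightarrow> ('a, 'k) nc_op \<Rightarrow> ('a, 'k) nc_op" where
  "ev2 \<Phi> P Q = act (\<lambda>k. if k = 1 then P else Q) \<Phi>"

lemma act_eval2:
  assumes "\<And>c. raises 1 (\<delta> c)" "ord_ge 1 u" "ord_ge 1 v"
  shows "act \<delta> (nc_eval2 \<Phi> u v) = ev2 \<Phi> (act \<delta> u) (act \<delta> v)"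
  unfolding nc_eval2_def ev2_def
  by (subst act_subst) (use assms in \<open>auto simp: if_distrib cong: if_cong\<close>)

lemma ev2_intertwine:
  assumes "raises 1 P" "raises 1 Q" "raises 1 P'" "raises 1 Q'" "X * P = P' * X" "X * Q = Q' * X"
  shows "X * ev2 \<Phi> P Q = ev2 \<Phi> P' Q' * X"
  unfolding ev2_def by (rule act_intertwine) (use assms in auto)

lemma ev2_commute:
  assumes "raises 1 P" "raises 1 Q" "X * P = P * X" "X * Q = Q * X"
  shows "X * ev2 \<Phi> P Q = ev2 \<Phi> P Q * X"
  by (rule ev2_intertwine) (use assms in auto)

text \<open>
  The logarithm of a group-like series without linear part is a series of brackets, so the value of
  the series does not change if central elements are added to its arguments.
\<close>

lemma act_central_shift:
  fixes \<delta> \<epsilon> :: "'c::finite \<Rightarrow> ('a, 'k::field_char_0) nc_op"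
  assumes r: "\<And>c. raises 1 (\<delta> c)" "\<And>c. raises 1 (\<epsilon> c)"
    and z: "\<And>c d. (\<epsilon> c - \<delta> c) * \<delta> d = \<delta> d * (\<epsilon> c - \<delta> c)"
    and zz: "\<And>c d. (\<epsilon> c - \<delta> c) * (\<epsilon> d - \<delta> d) = (\<epsilon> d - \<delta> d) * (\<epsilon> c - \<delta> c)"
    and g: "g \<in> exp_free_lie A" "ord_ge 2 (g - 1)"
  shows "act \<epsilon> g = act \<delta> g"
proof -
  define Z where "Z f = (\<Sum>a\<in>UNIV. op_smult (nc_coeff f [a]) (\<epsilon> a - \<delta> a))" for f :: "('c, 'k) ncs"
  have Zd: "Z f * act \<delta> h = act \<delta> h * Z f" for f h
    by (rule act_intertwine[OF r(1) r(1)]) (simp add: Z_def sum_distrib_left sum_distrib_right z)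
  have ZZ: "Z f * Z h = Z h * Z f" for f h
    unfolding Z_def sum_product
    by (subst sum.swap) (simp add: zz mult.commute)
  have p: "act \<epsilon> f = act \<delta> f + Z f" if "f \<in> free_lie A" for f
    using that
  proof induction
    case (gen a)
    have "Z (nc_var a) = (\<Sum>b\<in>UNIV. if b = a then \<epsilon> a - \<delta> a else 0)"
      unfolding Z_def by (rule sum.cong) (auto simp: coeff_var)
    then show ?case by (simp add: act_var r)
  next
    case (bracket f h)
    have "Z (nc_bracket f h) = 0"
      using free_lie_const[OF bracket.hyps(1)] free_lie_const[OF bracket.hyps(2)]
      by (simp add: Z_def nc_bracket_def coeff_single_times)
    moreover have "(F + Y) * (H + W) - (H + W) * (F + Y) = F * H - H * F"
      if "Y * H = H * Y" "W * F = F * W" "Y * W = W * Y" for F H Y W :: "('a, 'k) nc_op"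
      by (simp add: distrib_left distrib_right that)
    ultimately show ?case
      by (simp add: nc_bracket_def act_mult r bracket.IH Zd ZZ)
  qed (simp_all add: Z_def op.scale_left_distrib sum.distrib op.scale_sum_right op.scale_right_distrib)
  let ?u = "nc_log g"
  have u: "?u \<in> free_lie_hat A" "nc_exp ?u = g" using exp_free_lie_log[OF g(1)] by auto
  have u1: "nc_coeff ?u [a] = 0" for a
    using g(2) by (simp add: coeff_log_single ord_ge_def coeff_one)
  have "act \<epsilon> ?u = act \<delta> ?u"
  proof (rule raises_eqI)
    fix N
    define t where "t = (\<Sum>d<N. nc_homog_part d ?u)"
    have t: "raises N (act \<epsilon> (?u - t))" "raises N (act \<delta> (?u - t))"
      unfolding t_def by (rule raises_act[OF _ ord_ge_homog_trunc], rule r)+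
    have "Z t = 0"
      unfolding Z_def t_def by (rule sum.neutral) (simp add: u1)
    then have "act \<epsilon> t = act \<delta> t"
      using p[OF hat_trunc_mem[OF u(1)], of N] by (simp only: t_def add_0_right)
    then show "raises N (act \<epsilon> ?u - act \<delta> ?u)"
      using raises_diff[OF t] by simp
  qed
  then show ?thesis
    using act_exp[of \<delta>, OF r(1) hat_ord[OF u(1)]] act_exp[of \<epsilon>, OF r(2) hat_ord[OF u(1)]] u(2)
    by simp
qed

text \<open>
  The relations of three strands, for \<open>P = t\<^sub>1\<^sub>2\<close>, \<open>Q = t\<^sub>2\<^sub>3\<close>, \<open>R = t\<^sub>1\<^sub>3\<close>; equivalently
  \<open>P + Q + R\<close> commutes with \<open>P, Q, R\<close>.
\<close>

definition braid3 :: "('a, 'k::field_char_0) nc_op \<Rightarrow> ('a, 'k) nc_op \<Rightarrow> ('a, 'k) nc_op \<Rightarrow> bool" where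
  "braid3 P Q R \<longleftrightarrow> raises 1 P \<and> raises 1 Q \<and> raises 1 R \<and> P * (Q + R) = (Q + R) * P
     \<and> Q * (P + R) = (P + R) * Q \<and> R * (P + Q) = (P + Q) * R"

lemma ev2_central:
  assumes \<Phi>: "\<Phi> \<in> exp_free_lie UNIV" "ord_ge 2 (\<Phi> - 1)"
    and t: "braid3 P Q R" and W: "W = - P - R"
  shows "ev2 \<Phi> P W = ev2 \<Phi> P Q"
  unfolding ev2_def
proof (rule act_central_shift[OF _ _ _ _ \<Phi>])
  have r: "raises 1 P" "raises 1 Q" "raises 1 W"
    using t by (auto simp: braid3_def W intro: raises_diff raises_uminus)
  then show "raises 1 (if k = 1 then P else Q)" "raises 1 (if k = 1 then P else W)" for k :: 2
    by auto
  have "P * (Q + R) = (Q + R) * P" "Q * (P + R) = (P + R) * Q" using t by (simp_all add: braid3_def)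
  then have "(W - Q) * P = P * (W - Q)" "(W - Q) * Q = Q * (W - Q)"
    by (simp_all add: W algebra_simps)
  then show "((if c = 1 then P else W) - (if c = 1 then P else Q)) * (if d = 1 then P else Q)
      = (if d = 1 then P else Q) * ((if c = 1 then P else W) - (if c = 1 then P else Q))" for c d :: 2
    by auto
  show "((if c = 1 then P else W) - (if c = 1 then P else Q)) * ((if d = 1 then P else W) - (if d = 1 then P else Q))
      = ((if d = 1 then P else W) - (if d = 1 then P else Q)) * ((if c = 1 then P else W) - (if c = 1 then P else Q))" for c d :: 2
    by auto
qed

text \<open>The value of a series in the letters \<open>t\<^sub>i\<^sub>j\<close> on the operators \<open>B i j\<close>.\<close>

abbreviation act_B :: "('s::finite \<Rightarrow> 's \<Rightarrow> ('a, 'k::field_char_0) nc_op) \<Rightarrow> ('s \<times> 's, 'k) ncs \<Rightarrow> ('a, 'k) nc_op" where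
  "act_B B \<equiv> act (\<lambda>(i, j). B i j)"

lemma braid_raises: "braid_rel B \<Longrightarrow> raises 1 (B i j)"
  by (simp add: braid_rel_def)

lemma braid_raises_pair: "braid_rel B \<Longrightarrow> raises 1 ((\<lambda>(i, j). B i j) p)"
  by (cases p) (simp add: braid_raises)

lemma act_B_mult: "braid_rel B \<Longrightarrow> act_B B (f * g) = act_B B f * act_B B g"
  by (rule act_mult) (rule braid_raises_pair)

lemma act_B_tt: "braid_rel B \<Longrightarrow> act_B B (tt i j) = B i j"
  unfolding tt_def by (subst act_var) (auto simp: braid_raises)

lemma act_B_exp: "braid_rel B \<Longrightarrow> ord_ge 1 a \<Longrightarrow> act_B B (nc_exp a) = op_exp (act_B B a)"
  by (rule act_exp) (rule braid_raises_pair)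

lemma act_t_ideal:
  assumes B: "braid_rel B" and f: "f \<in> t_ideal"
  shows "act_B B f = 0"
  using f
proof induction
  case (rel r)
  have comm: "B j i = B i j" if "i \<noteq> j" for i j using B that by (simp add: braid_rel_def)
  have "B i j * (B i k + B j k) = (B i k + B j k) * B i j" if "distinct [i, j, k]" for i j k
    using B that unfolding braid_rel_def by blast
  moreover have "B i j * B k l = B k l * B i j" if "distinct [i, j, k, l]" for i j k l
    using B that unfolding braid_rel_def by blast
  ultimately show ?case
    using rel comm unfolding t_relations_def
    by (fastforce simp: nc_bracket_def act_B_mult[OF B] act_B_tt[OF B])
qed (simp_all add: nc_bracket_def act_B_mult[OF B])

lemma act_t_hat:
  assumes B: "braid_rel B" and f: "f \<in> degree_completion t_ideal"
  shows "act_B B f = 0"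
proof (rule raises_all)
  fix N
  have "act_B B (\<Sum>d<N. nc_homog_part d f) = 0"
    using act_t_ideal[OF B] f by (simp add: degree_completion_def)
  moreover have "raises N (act_B B (f - (\<Sum>d<N. nc_homog_part d f)))"
    by (rule raises_act[OF braid_raises_pair[OF B] ord_ge_homog_trunc])
  ultimately show "raises N (act_B B f)" by (simp only: act_simps) simp
qed

lemma exp_t_eq_act:
  assumes B: "braid_rel B" and eq: "g \<approx>\<^sub>t h" and c: "nc_coeff g [] = 1" "nc_coeff h [] = 1"
  shows "act_B B g = act_B B h"
proof -
  have "act_B B (nc_log g) = act_B B (nc_log h)"
    using act_t_hat[OF B] eq by (fastforce simp: exp_t_eq_def)
  then have "act_B B (nc_exp (nc_log g)) = act_B B (nc_exp (nc_log h))"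
    using act_B_exp[OF B ord_ge_nc_log] c by simp
  then show ?thesis using c by (simp add: exp_log)
qed

lemma coeff_subst_Nil [simp]: "nc_coeff (nc_subst \<sigma> f) [] = nc_coeff f []"
  by (simp add: nc_subst_def coeff_one)

lemma coeff_eval2_Nil [simp]: "nc_coeff (nc_eval2 \<Phi> u v) [] = nc_coeff \<Phi> []"
  by (simp add: nc_eval2_def)

lemma coeff_subst_single:
  fixes f :: "('c::finite, 'k::field_char_0) ncs"
  shows "nc_coeff (nc_subst \<sigma> f) [x] = (\<Sum>a\<in>UNIV. nc_coeff f [a] * nc_coeff (\<sigma> a) [x])"
proof -
  have *: "{v :: 'c list. length v \<le> length [x]} = insert [] ((\<lambda>a. [a]) ` UNIV)"
    by (auto simp: le_Suc_eq length_Suc_conv)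
  have "inj (\<lambda>a :: 'c. [a])" by (rule injI) simp
  then have "(\<Sum>v\<in>(\<lambda>a. [a]) ` UNIV. nc_coeff f v * nc_coeff (prod_list (map \<sigma> v)) [x])
      = (\<Sum>a\<in>UNIV. nc_coeff f [a] * nc_coeff (\<sigma> a) [x])"
    by (subst sum.reindex) auto
  then show ?thesis
    unfolding nc_subst_def nc_coeff_Abs * by (subst sum.insert) (auto simp: coeff_one)
qed

lemma UNIV_2: "UNIV = {1, 2 :: 2}"
  using exhaust_2 by auto

lemma coeff_eval2_single:
  "nc_coeff (nc_eval2 \<Phi> u v) [x]
     = nc_coeff \<Phi> [1] * nc_coeff u [x] + nc_coeff \<Phi> [2] * nc_coeff v [x]"
  by (simp add: nc_eval2_def coeff_subst_single UNIV_2)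

lemma ord_ge_tt [simp]: "ord_ge 1 (tt i j)"
  by (simp add: tt_def)

lemma sets3_simps [simp]: "sets3 a b c 1 = a" "sets3 a b c 2 = b" "sets3 a b c 3 = c"
  by (simp_all add: sets3_def)

lemma assoc_simp_eval2:
  "assoc_simp \<Phi> I1 I2 I3 = nc_eval2 \<Phi> (\<Sum>i\<in>I1. \<Sum>j\<in>I2. tt i j) (\<Sum>i\<in>I2. \<Sum>j\<in>I3. tt i j)"
proof -
  let ?s = "\<lambda>(i, j). \<Sum>i'\<in>sets3 I1 I2 I3 i. \<Sum>j'\<in>sets3 I1 I2 I3 j. tt i' j'"
  have o: "ord_ge 1 (?s p)" for p by (cases p) (auto intro!: ord_ge_sum)
  have v: "nc_subst ?s (tt a b) = ?s (a, b)" for a b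
    unfolding tt_def[of a b] by (rule nc_subst_var[OF o])
  have "assoc_simp \<Phi> I1 I2 I3 = nc_subst (\<lambda>k. nc_subst ?s (if k = 1 then tt 1 2 else tt 2 3)) \<Phi>"
    unfolding assoc_simp_def t_simplicial_def assoc_t3_def nc_eval2_def
    by (rule nc_subst_subst[OF _ o]) simp
  also have "(\<lambda>k::2. nc_subst ?s (if k = 1 then tt 1 2 else tt 2 3))
      = (\<lambda>k. if k = 1 then \<Sum>i\<in>I1. \<Sum>j\<in>I2. tt i j else \<Sum>i\<in>I2. \<Sum>j\<in>I3. tt i j)"
    by (rule ext) (simp add: v)
  finally show ?thesis by (simp add: nc_eval2_def)
qed

lemma act_assoc_simp:
  assumes B: "braid_rel B"
  shows "act_B B (assoc_simp \<Phi> I1 I2 I3)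
    = ev2 \<Phi> (\<Sum>i\<in>I1. \<Sum>j\<in>I2. B i j) (\<Sum>i\<in>I2. \<Sum>j\<in>I3. B i j)"
  unfolding assoc_simp_eval2
  by (subst act_eval2[OF braid_raises_pair[OF B]]) (auto simp: act_B_tt[OF B] intro!: ord_ge_sum)

text \<open>
  In degree one the ideal only identifies \<open>t\<^sub>j\<^sub>i\<close> with \<open>t\<^sub>i\<^sub>j\<close>, so the sum of their coefficients is
  well-defined on the quotient.
\<close>

lemma t_ideal_linear_part:
  assumes "f \<in> t_ideal" "i \<noteq> j"
  shows "nc_coeff f [] = 0 \<and> nc_coeff f [(i, j)] + nc_coeff f [(j, i)] = 0"
  using assms(1)
proof induction
  case (rel r)
  then show ?case
    by (auto simp: t_relations_def nc_bracket_def coeff_single_times tt_def coeff_var)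
next
  case (add f g)
  then show ?case by (simp add: algebra_simps add_eq_0_iff)
next
  case (smult f c)
  then show ?case by (simp flip: distrib_left)
next
  case (bracket f g)
  then show ?case using free_lie_const[OF bracket.hyps(2)]
    by (simp add: nc_bracket_def coeff_single_times)
qed simp

lemma exp_t_eq_linear_part:
  assumes "g \<approx>\<^sub>t h" "i \<noteq> j"
  shows "nc_coeff g [(i, j)] + nc_coeff g [(j, i)] = nc_coeff h [(i, j)] + nc_coeff h [(j, i)]"
proof -
  have "nc_homog_part 1 (nc_log g - nc_log h) \<in> t_ideal"
    using assms(1) by (simp add: exp_t_eq_def degree_completion_def)
  from t_ideal_linear_part[OF this assms(2)] show ?thesis
    by (simp add: coeff_log_single One_nat_def algebra_simps)
qed

context
  fixes \<Phi> :: "(2, 'k::field_char_0) ncs"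
  assumes \<Phi>: "\<Phi> \<in> associators"
begin

lemma assoc_group_like: "\<Phi> \<in> exp_free_lie UNIV"
  using \<Phi> by (simp add: associators_def)

lemma assoc_const [simp]: "nc_coeff \<Phi> [] = 1"
  by (rule exp_free_lie_const[OF assoc_group_like])

lemma assoc_pentagon:
  "(assoc_simp \<Phi> {2} {3} {4} :: (4 \<times> 4, 'k) ncs) * assoc_simp \<Phi> {1} {2, 3} {4}
       * assoc_simp \<Phi> {1} {2} {3}
     \<approx>\<^sub>t assoc_simp \<Phi> {1} {2} {3, 4} * assoc_simp \<Phi> {1, 2} {3} {4}"
  using \<Phi> by (simp add: associators_def)

text \<open>
  In the pentagon, the coefficient of \<open>t\<^sub>1\<^sub>2\<close> is twice that of \<open>t\<^sub>1\<^sub>2\<close> in \<open>\<Phi>\<close> on the left and once on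
  the right; dually for \<open>t\<^sub>3\<^sub>4\<close>.
\<close>

lemma assoc_linear_part: "ord_ge 2 (\<Phi> - 1)"
proof -
  have 1: "nc_coeff \<Phi> [1] = 0"
    using exp_t_eq_linear_part[OF assoc_pentagon, of 1 2]
    by (simp add: assoc_simp_eval2 coeff_single_times coeff_eval2_single tt_def coeff_var)
  have 2: "nc_coeff \<Phi> [2] = 0"
    using exp_t_eq_linear_part[OF assoc_pentagon, of 3 4] 1
    by (simp add: assoc_simp_eval2 coeff_single_times coeff_eval2_single tt_def coeff_var)
  have "nc_coeff \<Phi> [k] = 0" for k using 1 2 exhaust_2[of k] by auto
  then show ?thesis by (auto simp: ord_ge_def coeff_one less_Suc_eq numeral_2_eq_2 length_Suc_conv)
qed

end

text \<open>Three such operators come from a family indexed by the pairs of three strands.\<close>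

lemma braid3_rel:
  assumes "braid3 P Q R"
  obtains B :: "3 \<Rightarrow> 3 \<Rightarrow> ('a, 'k::field_char_0) nc_op"
  where "braid_rel B" "B 1 2 = P" "B 2 1 = P" "B 2 3 = Q" "B 3 2 = Q" "B 1 3 = R" "B 3 1 = R"
proof
  define B :: "3 \<Rightarrow> 3 \<Rightarrow> ('a, 'k) nc_op" where
    "B i j = (if {i, j} = {1, 2} then P else if {i, j} = {2, 3} then Q else if {i, j} = {1, 3} then R else 0)" for i j
  show B: "B 1 2 = P" "B 2 1 = P" "B 2 3 = Q" "B 3 2 = Q" "B 1 3 = R" "B 3 1 = R"
    by (simp_all add: B_def doubleton_eq_iff)
  show "braid_rel B"
    unfolding braid_rel_def
  proof (intro conjI allI impI)
    fix i j k l :: 3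
    show "raises 1 (B i j)" using assms by (simp add: B_def braid3_def)
    show "B j i = B i j" by (simp add: B_def insert_commute)
    show "B i j * (B i k + B j k) = (B i k + B j k) * B i j" if "distinct [i, j, k]"
      using that exhaust_3[of i] exhaust_3[of j] exhaust_3[of k] assms unfolding braid3_def
      by (elim disjE) (simp_all add: B add.commute)
    show "B i j * B k l = B k l * B i j" if "distinct [i, j, k, l]"
      using that exhaust_3[of i] exhaust_3[of j] exhaust_3[of k] exhaust_3[of l]
      by (elim disjE) simp_all
  qed
qed

lemma braid3_perm:
  assumes "braid3 P Q R"
  shows "braid3 Q P R" "braid3 P R Q" "braid3 R Q P" "braid3 Q R P" "braid3 R P Q"
  using assms by (simp_all add: braid3_def add.commute)

text \<open>Grouping the strands \<open>b, c\<close> into one.\<close>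

lemma commute_add:
  fixes X Y Z :: "'r::ring_1"
  shows "X * Y = Y * X \<Longrightarrow> X * Z = Z * X \<Longrightarrow> X * (Y + Z) = (Y + Z) * X"
    and "Y * X = X * Y \<Longrightarrow> Z * X = X * Z \<Longrightarrow> (Y + Z) * X = X * (Y + Z)"
  by (simp_all add: distrib_left distrib_right)

lemma braid3_cable:
  assumes B: "braid_rel B" and d: "distinct [a, b, c, d]"
  shows "braid3 (B a b + B a c) (B b d + B c d) (B a d)"
proof -
  have 2: "B j i = B i j" if "i \<noteq> j" for i j using B that unfolding braid_rel_def by blast
  have 3: "B i j * (B i k + B j k) = (B i k + B j k) * B i j" if "distinct [i, j, k]" for i j k
    using B that unfolding braid_rel_def by blast
  have 4: "B i j * B k l = B k l * B i j" if "distinct [i, j, k, l]" for i j k l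
    using B that unfolding braid_rel_def by blast
  have s: "B b a = B a b" "B c a = B a c" "B d a = B a d" "B d b = B b d" "B d c = B c d"
    using d by (auto intro: 2)
  have ab: "B a b * (B a d + B b d) = (B a d + B b d) * B a b" "B a b * B c d = B c d * B a b"
    using d by (auto intro!: 3 4)
  have ac: "B a c * (B a d + B c d) = (B a d + B c d) * B a c" "B a c * B b d = B b d * B a c"
    using d by (auto intro!: 3 4)
  have bd: "B b d * (B a b + B a d) = (B a b + B a d) * B b d" "B b d * B a c = B a c * B b d"
    using d 3[of b d a] 4[of b d a c] unfolding s by auto
  have cd: "B c d * (B a c + B a d) = (B a c + B a d) * B c d" "B c d * B a b = B a b * B c d"
    using d 3[of c d a] 4[of c d a b] unfolding s by auto
  have ad: "B a d * (B a b + B b d) = (B a b + B b d) * B a d" "B a d * (B a c + B c d) = (B a c + B c d) * B a d"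
    using d 3[of a d b] 3[of a d c] unfolding s by auto
  have "(B a b + B a c) * (B b d + B c d + B a d) = (B b d + B c d + B a d) * (B a b + B a c)"
    using commute_add(1)[OF ab] commute_add(1)[OF ac]
    by (intro commute_add(2)) (simp_all only: ac_simps)
  moreover have "(B b d + B c d) * (B a b + B a c + B a d) = (B a b + B a c + B a d) * (B b d + B c d)"
    using commute_add(1)[OF bd] commute_add(1)[OF cd]
    by (intro commute_add(2)) (simp_all only: ac_simps)
  moreover have "B a d * (B a b + B a c + (B b d + B c d)) = (B a b + B a c + (B b d + B c d)) * B a d"
    using commute_add(1)[OF ad] by (simp only: ac_simps)
  ultimately show ?thesis by (simp add: braid3_def raises_add braid_raises[OF B])
qed

lemma braid3_strands:
  assumes B: "braid_rel B" and d: "distinct [a, b, c]"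
  shows "braid3 (B a b) (B b c) (B a c)"
proof -
  have 2: "B j i = B i j" if "i \<noteq> j" for i j using B that unfolding braid_rel_def by blast
  have 3: "B i j * (B i k + B j k) = (B i k + B j k) * B i j" if "distinct [i, j, k]" for i j k
    using B that unfolding braid_rel_def by blast
  have s: "B b a = B a b" "B c b = B b c" "B c a = B a c"
    using d by (auto intro: 2)
  show ?thesis
    using 3[of a b c] 3[of b c a] 3[of a c b] d unfolding s braid3_def
    by (auto simp: braid_raises[OF B] add.commute)
qed

text \<open>\<open>half_exp P\<close> is \<open>e\<^bsup>P/2\<^esup>\<close>.\<close>

definition half_exp :: "('a, 'k::field_char_0) nc_op \<Rightarrow> ('a, 'k) nc_op" where
  "half_exp P = op_exp (op_smult (1 / 2) P)"

lemma half_exp_minus: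
  assumes "raises 1 P"
  shows "half_exp P * half_exp (- P) = 1" "half_exp (- P) * half_exp P = 1"
  using op_exp_minus[OF raises_smult[OF assms]] by (simp_all add: half_exp_def)

lemma half_exp_add:
  assumes "raises 1 P" "raises 1 Q" "P * Q = Q * P"
  shows "half_exp (P + Q) = half_exp P * half_exp Q"
  using op_exp_add[OF raises_smult[OF assms(1)] raises_smult[OF assms(2)]] assms(3)
  by (simp add: half_exp_def op.scale_right_distrib)

lemma half_exp_commute:
  assumes "raises 1 P" "X * P = P * X"
  shows "X * half_exp P = half_exp P * X"
  unfolding half_exp_def
  by (rule op_exp_intertwine) (use assms raises_smult[OF assms(1)] in auto)

context
  fixes \<Phi> :: "(2, 'k::field_char_0) ncs"
  assumes \<Phi>: "\<Phi> \<in> associators"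
begin

lemma assoc_inverse:
  assumes t: "braid3 P Q (R :: ('a, 'k) nc_op)"
  shows "ev2 \<Phi> Q P * ev2 \<Phi> P Q = 1" "ev2 \<Phi> P Q * ev2 \<Phi> Q P = 1"
proof -
  have *: "ev2 \<Phi> Q P * ev2 \<Phi> P Q = 1" if t: "braid3 P Q R" for P Q R :: "('a, 'k) nc_op"
  proof -
    obtain B :: "3 \<Rightarrow> 3 \<Rightarrow> ('a, 'k) nc_op" where B: "braid_rel B" "B 1 2 = P" "B 2 1 = P" "B 2 3 = Q" "B 3 2 = Q" "B 1 3 = R" "B 3 1 = R"
      using braid3_rel[OF t] .
    let ?g = "assoc_t3 \<Phi> :: (3 \<times> 3, 'k) ncs"
    have g: "?g \<in> exp_free_lie UNIV"
      unfolding assoc_t3_def tt_def by (intro eval2_mem assoc_group_like[OF \<Phi>] hat_var) auto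
    have "(assoc_simp \<Phi> {3} {2} {1} :: (3 \<times> 3, 'k) ncs) \<approx>\<^sub>t nc_inverse ?g"
      using \<Phi> by (simp add: associators_def)
    then have "act_B B (assoc_simp \<Phi> {3} {2} {1}) = act_B B (nc_inverse ?g)"
      by (rule exp_t_eq_act[OF B(1)])
        (simp_all add: assoc_simp_eval2 assoc_const[OF \<Phi>] exp_free_lie_const[OF exp_free_lie_inverse(3)[OF g]])
    moreover have "act_B B (nc_inverse ?g) * act_B B ?g = 1"
      unfolding act_B_mult[OF B(1), symmetric] exp_free_lie_inverse[OF g] by (rule act_one)
    moreover have "act_B B ?g = ev2 \<Phi> P Q"
      unfolding assoc_t3_def
      by (subst act_eval2[OF braid_raises_pair[OF B(1)]]) (simp_all add: act_B_tt B)
    ultimately show ?thesis by (simp add: act_assoc_simp B)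
  qed
  show "ev2 \<Phi> Q P * ev2 \<Phi> P Q = 1" "ev2 \<Phi> P Q * ev2 \<Phi> Q P = 1"
    using *[OF t] *[OF braid3_perm(1)[OF t]] by auto
qed

lemma assoc_hexagon:
  assumes t: "braid3 P Q (R :: ('a, 'k) nc_op)"
  shows "half_exp Q * ev2 \<Phi> P Q * half_exp P * ev2 \<Phi> R P * half_exp R * ev2 \<Phi> Q R = half_exp (P + Q + R)"
proof -
  obtain B :: "3 \<Rightarrow> 3 \<Rightarrow> ('a, 'k) nc_op" where B: "braid_rel B" "B 1 2 = P" "B 2 1 = P" "B 2 3 = Q" "B 3 2 = Q" "B 1 3 = R" "B 3 1 = R"
    using braid3_rel[OF t] .
  let ?e = "\<lambda>a. nc_exp (nc_smult (1/2) a) :: (3 \<times> 3, 'k) ncs"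
  have e: "act_B B (?e a) = half_exp (act_B B a)" if "ord_ge 1 a" for a
    using act_B_exp[OF B(1) ord_ge_smult[OF that]] by (simp add: half_exp_def)
  have "?e (tt 2 3) * assoc_simp \<Phi> {1} {2} {3} * ?e (tt 1 2) * assoc_simp \<Phi> {3} {1} {2}
       * ?e (tt 3 1) * assoc_simp \<Phi> {2} {3} {1}
     \<approx>\<^sub>t ?e (tt 1 2 + tt 2 3 + tt 3 1)"
    using \<Phi> by (simp add: associators_def)
  then have "act_B B (?e (tt 2 3) * assoc_simp \<Phi> {1} {2} {3} * ?e (tt 1 2) * assoc_simp \<Phi> {3} {1} {2}
       * ?e (tt 3 1) * assoc_simp \<Phi> {2} {3} {1}) = act_B B (?e (tt 1 2 + tt 2 3 + tt 3 1))"
    by (rule exp_t_eq_act[OF B(1)]) (simp_all add: assoc_simp_eval2 assoc_const[OF \<Phi>])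
  then show ?thesis
    by (simp add: act_B_mult B act_assoc_simp e act_B_tt ord_ge_add)
qed

text \<open>
  The hexagon on the strands in the order \<open>1, 3, 2\<close>, solved for \<open>\<Phi>(R, Q)\<close>. It expresses the factor
  \<open>e\<^bsup>-(x+y)/2\<^esup> \<Phi>(y, -x-y)\<close> of \<open>\<mu>\<^sub>\<Phi>\<close>.
\<close>

lemma assoc_hexagon_mirror:
  assumes t: "braid3 P Q (R :: ('a, 'k) nc_op)"
  shows "half_exp (- (P + R)) * ev2 \<Phi> R Q = ev2 \<Phi> P Q * half_exp (- P) * ev2 \<Phi> R P * half_exp (- R)"
proof -
  have r: "raises 1 P" "raises 1 Q" "raises 1 R" using t by (simp_all add: braid3_def)
  note i = assoc_inverse[OF braid3_perm(2)[OF t]] assoc_inverse[OF t]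
  have "half_exp Q * half_exp (P + R) = half_exp (P + Q + R)"
    using half_exp_add[OF r(2) raises_add[OF r(1,3)]] t by (simp add: braid3_def add.left_commute add.assoc)
  then have h: "half_exp Q * (ev2 \<Phi> R Q * half_exp R * ev2 \<Phi> P R * half_exp P * ev2 \<Phi> Q P)
      = half_exp Q * half_exp (P + R)"
    using assoc_hexagon[OF braid3_perm(3)[OF t]] by (simp add: mult.assoc ac_simps(1,2,3))
  have "ev2 \<Phi> R Q * half_exp R * ev2 \<Phi> P R * half_exp P * ev2 \<Phi> Q P = half_exp (P + R)"
    using arg_cong[OF h, of "\<lambda>X. half_exp (- Q) * X"]
    by (simp only: mult.assoc[symmetric] half_exp_minus[OF r(2)] mult_1)
  then have "half_exp (- (P + R)) * ev2 \<Phi> R Q * (half_exp R * (ev2 \<Phi> P R * (half_exp P * ev2 \<Phi> Q P)))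
      = half_exp (- (P + R)) * half_exp (P + R)" by (simp only: mult.assoc)
  then have "half_exp (- (P + R)) * ev2 \<Phi> R Q * (half_exp R * (ev2 \<Phi> P R * (half_exp P * ev2 \<Phi> Q P)))
      * (ev2 \<Phi> P Q * half_exp (- P) * ev2 \<Phi> R P * half_exp (- R))
      = ev2 \<Phi> P Q * half_exp (- P) * ev2 \<Phi> R P * half_exp (- R)"
    by (simp only: half_exp_minus[OF raises_add[OF r(1,3)]] mult_1)
  moreover have "X * (half_exp R * (ev2 \<Phi> P R * (half_exp P * ev2 \<Phi> Q P)))
      * (ev2 \<Phi> P Q * half_exp (- P) * ev2 \<Phi> R P * half_exp (- R)) = X" for X
  proof -
    have "X * (half_exp R * (ev2 \<Phi> P R * (half_exp P * ev2 \<Phi> Q P)))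
      * (ev2 \<Phi> P Q * half_exp (- P) * ev2 \<Phi> R P * half_exp (- R))
      = X * (half_exp R * (ev2 \<Phi> P R * (half_exp P * (ev2 \<Phi> Q P * ev2 \<Phi> P Q) * half_exp (- P)) * ev2 \<Phi> R P) * half_exp (- R))"
      by (simp only: mult.assoc)
    then show ?thesis by (simp add: i half_exp_minus r)
  qed
  ultimately show ?thesis by simp
qed

lemma assoc_pentagon_op:
  assumes B: "braid_rel (B :: 's \<Rightarrow> 's \<Rightarrow> ('a, 'k) nc_op)" and d: "distinct [a, b, c, d]"
  shows "ev2 \<Phi> (B b c) (B c d) * ev2 \<Phi> (B a b + B a c) (B b d + B c d) * ev2 \<Phi> (B a b) (B b c)
    = ev2 \<Phi> (B a b) (B b c + B b d) * ev2 \<Phi> (B a c + B b c) (B c d)"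
proof -
  define \<pi> :: "4 \<Rightarrow> 's" where "\<pi> s = (if s = 1 then a else if s = 2 then b else if s = 3 then c else d)" for s
  have \<pi>: "\<pi> 1 = a" "\<pi> 2 = b" "\<pi> 3 = c" "\<pi> 4 = d" by (simp_all add: \<pi>_def)
  have inj: "\<pi> s = \<pi> t \<longleftrightarrow> s = t" for s t
    using exhaust_4[of s] exhaust_4[of t] d by (elim disjE) (simp_all only: \<pi>, auto)
  define C where "C s t = B (\<pi> s) (\<pi> t)" for s t
  have C: "braid_rel C"
    using B unfolding braid_rel_def C_def by (auto simp: inj)
  have "act_B C (assoc_simp \<Phi> {2} {3} {4} * assoc_simp \<Phi> {1} {2, 3} {4} * assoc_simp \<Phi> {1} {2} {3})
     = act_B C (assoc_simp \<Phi> {1} {2} {3, 4} * assoc_simp \<Phi> {1, 2} {3} {4})"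
    by (rule exp_t_eq_act[OF C assoc_pentagon[OF \<Phi>]]) (simp_all add: assoc_simp_eval2 assoc_const[OF \<Phi>])
  then show ?thesis
    by (simp add: act_B_mult[OF C] act_assoc_simp[OF C]) (simp add: C_def \<pi>)
qed

end

section \<open>The identities between the components\<close>

text \<open>
  In the notation of the strands \<open>z, a, b, c\<close>, the factors \<open>G ab bc\<close>, \<open>V\<close>, \<open>W3\<close> and \<open>G oa ab\<close>, \<open>U2\<close>
  belong to the left hand side of the theorem, \<open>G oa (ab + ac)\<close>, \<open>W2'\<close> and \<open>G ob bc\<close>, \<open>U3'\<close> to the
  right hand side. \<open>Z\<close> is the element of the centralizer by which the products differ.
\<close>

lemma assoc_component_identities:
  fixes \<Phi> :: "(2, 'k::field_char_0) ncs" and B :: "'s \<Rightarrow> 's \<Rightarrow> ('a, 'k) nc_op"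
  assumes \<Phi>: "\<Phi> \<in> associators" and B: "braid_rel B" and d: "distinct [z, a, b, c]"
  defines "G \<equiv> ev2 \<Phi>"
  defines "oa \<equiv> B z a" and "ob \<equiv> B z b" and "oc \<equiv> B z c"
    and "ab \<equiv> B a b" and "ac \<equiv> B a c" and "bc \<equiv> B b c"
  defines "V \<equiv> G (oa + ob) (ac + bc)"
    and "W3 \<equiv> half_exp (- (oa + ob + oc)) * G oc (ac + bc) * half_exp oc"
    and "U2 \<equiv> half_exp (- (oa + ob)) * G ob ab * half_exp ob"
    and "W2' \<equiv> half_exp (- (oa + (ob + oc))) * G (ob + oc) (ab + ac) * half_exp (ob + oc)"
    and "U3' \<equiv> half_exp (- (ob + oc)) * G oc bc * half_exp oc"
  shows "\<exists>Z. G oa (ab + ac) = G ab bc * V * G oa ab * Z \<and> Z * oa = oa * Z"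
    and "\<exists>Z. W2' * G ob bc = G ab bc * V * U2 * Z \<and> Z * ob = ob * Z"
    and "\<exists>Z. W2' * U3' = G ab bc * W3 * Z \<and> Z * oc = oc * Z"
proof -
  have 2: "B j i = B i j" if "i \<noteq> j" for i j using B that unfolding braid_rel_def by blast
  have 3: "B i j * (B i k + B j k) = (B i k + B j k) * B i j" if "distinct [i, j, k]" for i j k
    using B that unfolding braid_rel_def by blast
  have 4: "B i j * B k l = B k l * B i j" if "distinct [i, j, k, l]" for i j k l
    using B that unfolding braid_rel_def by blast
  have s: "B a z = oa" "B b z = ob" "B c z = oc" "B b a = ab" "B c a = ac" "B c b = bc"
    "B z a = oa" "B z b = ob" "B z c = oc" "B a b = ab" "B a c = ac" "B b c = bc"
    using d 2 unfolding oa_def ob_def oc_def ab_def ac_def bc_def by auto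
  have r: "raises 1 oa" "raises 1 ob" "raises 1 oc" "raises 1 ab" "raises 1 ac" "raises 1 bc"
    unfolding oa_def ob_def oc_def ab_def ac_def bc_def by (rule braid_raises[OF B])+
  note tri = braid3_strands[OF B] and cab = braid3_cable[OF B]
  have t1: "braid3 oa ab ob" using tri[of z a b] d by (simp add: s)
  have t2: "braid3 ob bc oc" using tri[of z b c] d by (simp add: s)
  have t3: "braid3 oa (ab + ac) (ob + oc)" using braid3_perm(3)[OF cab[of z b c a]] d by (auto simp: s)
  have t4: "braid3 (oa + ob) (ac + bc) oc" using cab[of z a b c] d by (simp add: s)
  have t5: "braid3 (ob + ab) bc (oc + ac)" using braid3_perm(2)[OF cab[of b z a c]] d by (auto simp: s)
  note pent = assoc_pentagon_op[OF \<Phi> B, folded G_def]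
  have P1: "G ab bc * V * G oa ab = G oa (ab + ac) * G (ob + ab) bc"
    using pent[of z a b c] d by (simp add: s V_def)
  have P2: "G ob oa * G (oc + bc) (oa + ab) * G bc ob = G bc (ob + ab) * G (ob + oc) oa"
    using pent[of c b z a] d by (auto simp: s add.commute)
  have P3: "G ob ab * G (oc + bc) (oa + ab) * G oc ob = G oc (oa + ob) * G (ob + bc) ab"
    using pent[of c z b a] d by (auto simp: s add.commute)
  note hex = assoc_hexagon_mirror[OF \<Phi>]
  have cancel: "half_exp (- X) * half_exp X = 1" if "raises 1 X" for X :: "('a, 'k) nc_op"
    by (rule half_exp_minus[OF that])
  have U2: "U2 = G oa ab * half_exp (- oa) * G ob oa"
    unfolding U2_def hex[OF t1, folded G_def] by (simp add: mult.assoc cancel r)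
  have W2': "W2' = G oa (ab + ac) * half_exp (- oa) * G (ob + oc) oa"
    unfolding W2'_def hex[OF t3, folded G_def] by (simp add: mult.assoc cancel r raises_add del: minus_add_distrib)
  have W3: "W3 = V * half_exp (- (oa + ob)) * G oc (oa + ob)"
    unfolding W3_def hex[OF t4, folded G_def] by (simp add: mult.assoc cancel r V_def)
  have U3': "U3' = G ob bc * half_exp (- ob) * G oc ob"
    unfolding U3'_def hex[OF t2, folded G_def] by (simp add: mult.assoc cancel r)
  note i5 = assoc_inverse[OF \<Phi> t5, folded G_def] and i2 = assoc_inverse[OF \<Phi> t2, folded G_def]

  \<comment> \<open>first letter: the pentagon on \<open>z, a, b, c\<close>\<close>
  have c1: "oa * bc = bc * oa" "oa * (ob + ab) = (ob + ab) * oa"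
    using 4[of z a b c] 3[of z a b] d by (simp_all add: s)
  have "G ab bc * V * G oa ab * G bc (ob + ab) = G oa (ab + ac) * (G (ob + ab) bc * G bc (ob + ab))"
    unfolding P1 by (simp only: mult.assoc)
  then have "G oa (ab + ac) = G ab bc * V * G oa ab * G bc (ob + ab)" by (simp add: i5)
  moreover have "oa * G bc (ob + ab) = G bc (ob + ab) * oa"
    unfolding G_def by (rule ev2_commute) (simp_all add: r raises_add c1)
  ultimately show "\<exists>Z. G oa (ab + ac) = G ab bc * V * G oa ab * Z \<and> Z * oa = oa * Z" by metis

  \<comment> \<open>second letter: in addition the pentagon on \<open>c, b, z, a\<close>\<close>
  define Z where "Z = G (oc + bc) (oa + ab)"
  have c2: "ob * (oc + bc) = (oc + bc) * ob" "ob * (oa + ab) = (oa + ab) * ob"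
    using 3[of z b c] 3[of z b a] d by (auto simp: s)
  have Z: "ob * Z = Z * ob"
    unfolding G_def Z_def by (rule ev2_commute) (simp_all add: r raises_add c2)
  have "half_exp (- oa) * G (ob + ab) bc = G (ob + ab) bc * half_exp (- oa)"
  proof -
    have "oa * G (ob + ab) bc = G (ob + ab) bc * oa"
      unfolding G_def by (rule ev2_commute) (simp_all add: r raises_add c1)
    then have "G (ob + ab) bc * half_exp (- oa) = half_exp (- oa) * G (ob + ab) bc"
      by (intro half_exp_commute) (simp_all add: r raises_uminus)
    then show ?thesis ..
  qed
  note e = this
  have "G ob oa * Z * (G bc ob * G ob bc) = (G ob oa * Z * G bc ob) * G ob bc"
    by (simp only: mult.assoc)
  also have "\<dots> = G bc (ob + ab) * G (ob + oc) oa * G ob bc"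
    unfolding Z_def P2 by simp
  finally have q: "G ob oa * Z = G bc (ob + ab) * G (ob + oc) oa * G ob bc" by (simp add: i2)
  have "G ab bc * V * U2 * Z = (G ab bc * V * G oa ab) * half_exp (- oa) * (G ob oa * Z)"
    by (simp only: U2 mult.assoc)
  also have "\<dots> = G oa (ab + ac) * (G (ob + ab) bc * half_exp (- oa))
      * (G bc (ob + ab) * G (ob + oc) oa * G ob bc)"
    unfolding P1 q by (simp only: mult.assoc)
  also have "\<dots> = G oa (ab + ac) * half_exp (- oa) * (G (ob + ab) bc * G bc (ob + ab)) * G (ob + oc) oa * G ob bc"
    unfolding e[symmetric] by (simp only: mult.assoc)
  also have "\<dots> = W2' * G ob bc" by (simp add: i5 W2')
  finally have k2: "W2' * G ob bc = G ab bc * V * U2 * Z" by simp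
  with Z show "\<exists>Z. W2' * G ob bc = G ab bc * V * U2 * Z \<and> Z * ob = ob * Z" by metis

  \<comment> \<open>third letter: reduced to the second by one more hexagon, then the pentagon on \<open>c, z, b, a\<close>\<close>
  have c3: "oc * ab = ab * oc" "oc * (ob + bc) = (ob + bc) * oc"
    using 4[of z c a b] 3[of z c b] d by (auto simp: s)
  have "Z * ob = ob * Z" using Z by simp
  then have e2: "Z * half_exp (- ob) = half_exp (- ob) * Z"
    by (intro half_exp_commute) (simp_all add: r raises_uminus)
  have "W2' * U3' = (W2' * G ob bc) * half_exp (- ob) * G oc ob"
    by (simp only: U3' mult.assoc)
  also have "\<dots> = G ab bc * V * U2 * (Z * half_exp (- ob)) * G oc ob"
    unfolding k2 by (simp only: mult.assoc)
  also have "\<dots> = G ab bc * V * (G oa ab * half_exp (- oa) * G ob oa * half_exp (- ob)) * Z * G oc ob"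
    unfolding e2 U2 by (simp only: mult.assoc)
  also have "\<dots> = G ab bc * V * (half_exp (- (oa + ob)) * G ob ab) * Z * G oc ob"
    by (simp only: hex[OF t1, folded G_def])
  also have "\<dots> = G ab bc * V * half_exp (- (oa + ob)) * (G ob ab * Z * G oc ob)"
    by (simp only: mult.assoc)
  also have "\<dots> = G ab bc * W3 * G (ob + bc) ab"
    unfolding Z_def P3 W3 by (simp only: mult.assoc)
  finally have k3: "W2' * U3' = G ab bc * W3 * G (ob + bc) ab" .
  have "oc * G (ob + bc) ab = G (ob + bc) ab * oc"
    unfolding G_def by (rule ev2_commute) (simp_all add: r raises_add c3)
  with k3 show "\<exists>Z. W2' * U3' = G ab bc * W3 * Z \<and> Z * oc = oc * Z" by metis
qed

section \<open>Composition of tangential automorphisms\<close>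

lemma nc_inverse_mult:
  assumes "g \<in> exp_free_lie A" "h \<in> exp_free_lie A"
  shows "nc_inverse (g * h) = nc_inverse h * nc_inverse g"
proof (rule nc_inverse_eq)
  note g = exp_free_lie_inverse[OF assms(1)] and h = exp_free_lie_inverse[OF assms(2)]
  have "g * h * (nc_inverse h * nc_inverse g) = g * (h * nc_inverse h) * nc_inverse g"
    by (simp only: mult.assoc)
  then show "g * h * (nc_inverse h * nc_inverse g) = 1" by (simp add: g h)
  have "nc_inverse h * nc_inverse g * (g * h) = nc_inverse h * (nc_inverse g * g) * h"
    by (simp only: mult.assoc)
  then show "nc_inverse h * nc_inverse g * (g * h) = 1" by (simp add: g h)
qed

text \<open>The images of the letters under the tangential automorphism with components \<open>U\<close>.\<close>

abbreviation conj_letters :: "('n::finite \<Rightarrow> ('n, 'k::field_char_0) ncs) \<Rightarrow> 'n \<Rightarrow> ('n, 'k) ncs" where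
  "conj_letters U \<equiv> \<lambda>k. U k * nc_var k * nc_inverse (U k)"

text \<open>
  The automorphism with components \<open>W\<close> conjugates all letters that occur in \<open>U l\<close> with the same
  element \<open>W l\<close>, hence it conjugates \<open>U l\<close> itself.
\<close>

lemma tang_tang_var:
  assumes W: "\<And>k. W k \<in> exp_free_lie UNIV" and U: "\<And>k. U k \<in> exp_free_lie UNIV"
    and l: "U l = nc_subst (\<lambda>j. \<Sum>i\<in>I j. nc_var i) U0" and I: "\<And>i j. i \<in> I j \<Longrightarrow> W i = W l"
  shows "nc_subst (conj_letters W) (conj_letters U l) = conj_letters (\<lambda>k. W k * U k) l"
proof -
  let ?T = "nc_subst (conj_letters W)" and ?\<rho> = "\<lambda>j. \<Sum>i\<in>I j. nc_var i"
  let ?u = "nc_inverse (U l)" and ?w = "nc_inverse (W l)"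
  have o: "ord_ge 1 (conj_letters W k)" for k by (rule tang_ord[OF W])
  have \<rho>: "ord_ge 1 (?\<rho> j)" for j by (rule ord_ge_sum) simp
  have T\<rho>: "ord_ge 1 (?T (?\<rho> j))" for j by (rule nc_subst_ord[OF \<rho>])
  have wi: "?w * W l = 1" "W l * ?w = 1" using exp_free_lie_inverse[OF W] by auto
  have ui: "U l * ?u = 1" "?u * U l = 1" using exp_free_lie_inverse[OF U] by auto
  have Tm: "?T (f * h) = ?T f * ?T h" for f h by (rule nc_subst_mult[OF o])
  have T1: "?T 1 = 1" by (rule nc_subst_one[OF o])
  have Tv: "?T (nc_var k) = conj_letters W k" for k by (rule nc_subst_var[OF o])
  have "?T (?\<rho> j) * W l = W l * ?\<rho> j" for j
  proof -
    have "?T (?\<rho> j) * W l = (\<Sum>i\<in>I j. W l * nc_var i * (?w * W l))"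
      unfolding nc_subst_linear Tv sum_distrib_right
      by (rule sum.cong) (simp_all add: I mult.assoc)
    then show ?thesis by (simp add: wi sum_distrib_left)
  qed
  then have "lmul (W l) * act (\<lambda>j. lmul (?\<rho> j)) U0 = act (\<lambda>j. lmul (?T (?\<rho> j))) U0 * lmul (W l)"
    by (intro act_intertwine raises_lmul \<rho> T\<rho>) (simp only: lmul_simps[symmetric])
  also have "act (\<lambda>j. lmul (?\<rho> j)) U0 = lmul (U l)"
    unfolding l by (rule lmul_subst[OF \<rho>, symmetric])
  also have "act (\<lambda>j. lmul (?T (?\<rho> j))) U0 = lmul (?T (U l))"
    unfolding l nc_subst_subst[OF \<rho> o] by (rule lmul_subst[OF T\<rho>, symmetric])
  finally have TU: "W l * U l = ?T (U l) * W l"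
    by (simp only: lmul_simps[symmetric] lmul_eq_iff)
  have TuU: "?T ?u * ?T (U l) = 1" unfolding Tm[symmetric] ui T1 ..
  have "?T ?u * (W l * U l) = (?T ?u * ?T (U l)) * W l" unfolding TU by (simp only: mult.assoc)
  then have "?T ?u * (W l * U l) = W l" by (simp only: TuU mult_1)
  then have "?T ?u * (W l * U l) * (?u * ?w) = W l * ?u * ?w"
    by (simp only: mult.assoc)
  moreover have "?T ?u * (W l * U l) * (?u * ?w) = ?T ?u * (W l * (U l * ?u) * ?w)"
    by (simp only: mult.assoc)
  ultimately have Tu: "?T ?u = W l * ?u * ?w" by (simp add: ui wi)
  have "?T (conj_letters U l) = (?T (U l) * W l) * nc_var l * (?w * W l) * ?u * ?w"
    unfolding Tm Tv Tu by (simp only: mult.assoc)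
  also have "\<dots> = (W l * U l) * nc_var l * (?u * ?w)"
    unfolding TU[symmetric] wi by (simp only: mult.assoc mult_1)
  finally show ?thesis by (simp only: nc_inverse_mult[OF W U])
qed

lemma app_act_D_mult:
  assumes "g \<in> exp_free_lie A"
  shows "app (act_D g) (f * h) = app (act_D g) f * app (act_D g) h"
  using arg_cong[OF act_D_lmul[OF assms], of "\<lambda>T. app T h" f] by simp

lemma app_act_D_one:
  assumes g: "g \<in> exp_free_lie A"
  shows "app (act_D g) 1 = 1"
proof -
  have "act_D g * act_D (nc_inverse g) = act_D (g * nc_inverse g)"
    by (rule act_mult[symmetric]) (rule raises_D_pair)
  then have i: "act_D g * act_D (nc_inverse g) = 1"
    by (simp add: exp_free_lie_inverse[OF g] act_one)
  have "lmul (app (act_D g) 1) * (act_D g * act_D (nc_inverse g)) = act_D g * lmul 1 * act_D (nc_inverse g)"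
    unfolding act_D_lmul[OF g] by (simp only: mult.assoc)
  then have "lmul (app (act_D g) 1) = lmul 1" by (simp add: i)
  then show ?thesis by (simp only: lmul_eq_iff)
qed

text \<open>
  \<open>Ad g\<close> is conjugation with the operator of \<open>g\<close>, and a conjugate of \<open>x\<close> does not change if the
  conjugating element is multiplied from the right with an element of the centralizer of \<open>x\<close>.
\<close>

lemma app_act_D_conj:
  assumes g: "g \<in> exp_free_lie A" and M: "M \<in> exp_free_lie C" and N: "N \<in> exp_free_lie C"
    and eq: "lmul N = act_D g * lmul M * Z" and Z: "Z * lmul x = lmul x * Z"
  shows "app (act_D g) (M * x * nc_inverse M) = N * x * nc_inverse N"
proof -
  let ?y = "app (act_D g) (M * x * nc_inverse M)"
  have "lmul (?y * N) = (lmul ?y * act_D g) * lmul M * Z"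
    unfolding lmul_simps eq by (simp only: mult.assoc)
  also have "\<dots> = act_D g * lmul (M * x * (nc_inverse M * M)) * Z"
    unfolding act_D_lmul[OF g, symmetric] by (simp only: lmul_simps mult.assoc)
  also have "\<dots> = act_D g * lmul M * (lmul x * Z)"
    by (simp add: exp_free_lie_inverse[OF M] mult.assoc)
  also have "\<dots> = lmul (N * x)"
    unfolding Z[symmetric] lmul_simps eq by (simp only: mult.assoc)
  finally have "?y * N = N * x" by (simp only: lmul_eq_iff)
  then have "N * x * nc_inverse N = ?y * (N * nc_inverse N)" by (simp only: mult.assoc[symmetric])
  then show ?thesis by (simp add: exp_free_lie_inverse[OF N])
qed

lemma continuous_hom_eqI:
  fixes F H :: "('a::finite, 'k::field_char_0) ncs \<Rightarrow> ('b, 'k) ncs"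
  assumes "lin_filt F" "lin_filt H" "\<And>f h. F (f * h) = F f * F h" "\<And>f h. H (f * h) = H f * H h"
    "F 1 = 1" "H 1 = 1" "\<And>a. F (nc_var a) = H (nc_var a)"
  shows "F f = H f"
proof (rule lin_filt_eqI[OF assms(1,2)])
  fix v show "F (nc_mono v) = H (nc_mono v)"
    by (induction v) (simp_all add: nc_mono_Nil nc_mono_Cons assms)
qed

section \<open>Simplicial images of the automorphism\<close>

text \<open>The components of the simplicial image of \<open>\<mu>\<^sub>\<Phi>\<close>.\<close>

definition simplicial_comp ::
    "(2, 'k::field_char_0) ncs \<Rightarrow> (2 \<Rightarrow> 'm::finite set) \<Rightarrow> 'm \<Rightarrow> ('m, 'k) ncs" where
  "simplicial_comp \<Phi> I l = (if \<exists>k. l \<in> I k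
     then nc_subst (\<lambda>j. \<Sum>i\<in>I j. nc_var i) (mu_comp \<Phi> (THE k. l \<in> I k)) else 1)"

lemma simplicial_comp_mem:
  assumes "\<Phi> \<in> exp_free_lie UNIV"
  shows "simplicial_comp \<Phi> I l \<in> exp_free_lie UNIV"
proof -
  have "nc_subst (\<lambda>j. \<Sum>i\<in>I j. nc_var i) (mu_comp \<Phi> k) \<in> exp_free_lie UNIV" for k
    by (rule exp_free_lie_subst[OF _ _ mu_comp_mem[OF assms]])
      (auto intro!: ord_ge_sum hat_sum hat_var)
  then show ?thesis by (simp add: simplicial_comp_def exp_free_lie_one)
qed

lemma simplicial_comp_eq:
  assumes "\<And>j. l \<in> I j \<longleftrightarrow> j = k"
  shows "simplicial_comp \<Phi> I l = nc_subst (\<lambda>j. \<Sum>i\<in>I j. nc_var i) (mu_comp \<Phi> k)"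
  by (simp add: simplicial_comp_def assms)

lemma simplicial_comp_one:
  assumes "\<And>j. l \<notin> I j"
  shows "simplicial_comp \<Phi> I l = 1"
  by (simp add: simplicial_comp_def assms)

lemma lmul_simplicial_comp:
  fixes I :: "2 \<Rightarrow> 'm::finite set"
  defines "S \<equiv> \<lambda>j. \<Sum>i\<in>I j. lmul (nc_var i)"
  shows "(\<And>j. l \<in> I j \<longleftrightarrow> j = 1) \<Longrightarrow> lmul (simplicial_comp \<Phi> I l) = ev2 \<Phi> (S 1) (- S 1 - S 2)"
    and "(\<And>j. l \<in> I j \<longleftrightarrow> j = 2) \<Longrightarrow> lmul (simplicial_comp \<Phi> I l)
      = half_exp (- (S 1 + S 2)) * ev2 \<Phi> (S 2) (- S 1 - S 2) * half_exp (S 2)"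
proof -
  let ?\<sigma> = "\<lambda>j. \<Sum>i\<in>I j. nc_var i"
  have o: "ord_ge 1 (?\<sigma> j)" for j by (rule ord_ge_sum) simp
  have r: "raises 1 (lmul (?\<sigma> j))" for j by (rule raises_lmul[OF o])
  have S: "lmul (?\<sigma> j) = S j" for j by (simp add: S_def)
  have v: "ord_ge 1 (- nc_var 1 - nc_var 2 :: (2, 'a) ncs)" "ord_ge 1 (nc_var 1 + nc_var 2 :: (2, 'a) ncs)"
    by (simp_all add: ord_ge_diff ord_ge_add)
  have e: "lmul (nc_subst ?\<sigma> (nc_exp (nc_smult c a))) = op_exp (op_smult c (lmul (nc_subst ?\<sigma> a)))"
    if "ord_ge 1 a" for a c
    using nc_exp_subst[OF o ord_ge_smult[OF that]] lmul_exp[OF nc_subst_ord[OF ord_ge_smult[OF that]]]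
    by simp
  have p: "lmul (nc_subst ?\<sigma> (nc_eval2 \<Phi> a b)) = ev2 \<Phi> (lmul (nc_subst ?\<sigma> a)) (lmul (nc_subst ?\<sigma> b))"
    if "ord_ge 1 a" "ord_ge 1 b" for a b
    unfolding lmul_subst[OF o] by (rule act_eval2[OF r that])
  have q: "lmul (nc_subst ?\<sigma> (nc_var j)) = S j" for j
    unfolding nc_subst_var[OF o] S ..
  show "lmul (simplicial_comp \<Phi> I l) = ev2 \<Phi> (S 1) (- S 1 - S 2)" if "\<And>j. l \<in> I j \<longleftrightarrow> j = 1"
    unfolding simplicial_comp_eq[OF that] mu_comp_def
    by (simp only: if_True p[OF ord_ge_nc_var v(1)] nc_subst_linear lmul_simps q simp_thms)
  show "lmul (simplicial_comp \<Phi> I l)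
      = half_exp (- (S 1 + S 2)) * ev2 \<Phi> (S 2) (- S 1 - S 2) * half_exp (S 2)"
    if "\<And>j. l \<in> I j \<longleftrightarrow> j = 2"
  proof -
    have "lmul (nc_subst ?\<sigma> (mu_comp \<Phi> 2))
        = op_exp (op_smult (-1/2) (S 1 + S 2)) * ev2 \<Phi> (S 2) (- S 1 - S 2) * op_exp (op_smult (1/2) (S 2))"
    proof -
      have "lmul (nc_subst ?\<sigma> (nc_exp (nc_smult (-1/2) (nc_var 1 + nc_var 2))))
          = op_exp (op_smult (-1/2) (S 1 + S 2))"
        by (simp only: e[OF v(2)] nc_subst_linear lmul_simps q)
      moreover have "lmul (nc_subst ?\<sigma> (nc_exp (nc_smult (1/2) (nc_var 2)))) = op_exp (op_smult (1/2) (S 2))"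
        by (simp only: e[OF ord_ge_nc_var] q)
      moreover have "lmul (nc_subst ?\<sigma> (nc_eval2 \<Phi> (nc_var 2) (- nc_var 1 - nc_var 2)))
          = ev2 \<Phi> (S 2) (- S 1 - S 2)"
        by (simp only: p[OF ord_ge_nc_var v(1)] nc_subst_linear lmul_simps q)
      ultimately show ?thesis
        unfolding mu_comp_def by (simp add: nc_subst_mult[OF o])
    qed
    then show ?thesis
      unfolding simplicial_comp_eq[OF that] by (simp add: half_exp_def op.scale_right_diff_distrib op.scale_right_distrib)
  qed
qed

lemma TAut_simplicial_mu:
  assumes "\<Phi> \<in> associators"
  shows "TAut_simplicial I (mu \<Phi>) = tang (simplicial_comp \<Phi> I)"
  unfolding TAut_simplicial_def simplicial_comp_def
    normalized_components_mu[OF assoc_group_like[OF assms] assoc_linear_part[OF assms]] ..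

theorem mainTheorem2:
  fixes \<Phi> :: "(2, 'k::field_char_0) ncs"
  assumes "\<Phi> \<in> associators"
  shows "Ad_t (nc_eval2 \<Phi> (tt 1 2) (tt 2 3)) \<circ>\<^sub>T TAut_simplicial (sets2 {1, 2} {3}) (mu \<Phi>)
           \<circ>\<^sub>T TAut_simplicial (sets2 {1} {2}) (mu \<Phi>)
         = TAut_simplicial (sets2 {1} {2, 3}) (mu \<Phi>)
           \<circ>\<^sub>T (TAut_simplicial (sets2 {2} {3}) (mu \<Phi>) :: (3, 'k) ncs \<Rightarrow> (3, 'k) ncs)"
proof -
  note gl = assoc_group_like[OF assms] and lin = assoc_linear_part[OF assms]
  define g :: "(3 \<times> 3, 'k) ncs" where "g = nc_eval2 \<Phi> (tt 1 2) (tt 2 3)"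
  define W where "W = (simplicial_comp \<Phi> (sets2 {1, 2} {3}) :: 3 \<Rightarrow> (3, 'k) ncs)"
  define U where "U = (simplicial_comp \<Phi> (sets2 {1} {2}) :: 3 \<Rightarrow> (3, 'k) ncs)"
  define W' where "W' = (simplicial_comp \<Phi> (sets2 {1} {2, 3}) :: 3 \<Rightarrow> (3, 'k) ncs)"
  define U' where "U' = (simplicial_comp \<Phi> (sets2 {2} {3}) :: 3 \<Rightarrow> (3, 'k) ncs)"
  have mem: "W k \<in> exp_free_lie UNIV" "U k \<in> exp_free_lie UNIV"
    "W' k \<in> exp_free_lie UNIV" "U' k \<in> exp_free_lie UNIV" for k
    unfolding W_def U_def W'_def U'_def by (rule simplicial_comp_mem[OF gl])+
  have g: "g \<in> exp_free_lie UNIV"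
    unfolding g_def tt_def by (intro eval2_mem gl hat_var) auto
  let ?S = "\<lambda>V. nc_subst (conj_letters V)" and ?\<alpha> = "act_D g"

  have sets2: "sets2 A C j = (if j = 1 then A else C)" for A C :: "3 set" and j
    by (simp add: sets2_def)
  have two: "j \<noteq> 1 \<longleftrightarrow> j = 2" for j :: 2 using exhaust_2[of j] by auto
  let ?L = "\<lambda>k :: 3. lmul (nc_var k) :: (3, 'k) nc_op"
  have lm: "lmul (W 1) = ev2 \<Phi> (?L 1 + ?L 2) (- (?L 1 + ?L 2) - ?L 3)"
    "lmul (W 2) = ev2 \<Phi> (?L 1 + ?L 2) (- (?L 1 + ?L 2) - ?L 3)"
    "lmul (W 3) = half_exp (- (?L 1 + ?L 2 + ?L 3)) * ev2 \<Phi> (?L 3) (- (?L 1 + ?L 2) - ?L 3) * half_exp (?L 3)"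
    "lmul (U 1) = ev2 \<Phi> (?L 1) (- ?L 1 - ?L 2)"
    "lmul (U 2) = half_exp (- (?L 1 + ?L 2)) * ev2 \<Phi> (?L 2) (- ?L 1 - ?L 2) * half_exp (?L 2)"
    "lmul (W' 1) = ev2 \<Phi> (?L 1) (- ?L 1 - (?L 2 + ?L 3))"
    "lmul (W' 2) = half_exp (- (?L 1 + (?L 2 + ?L 3))) * ev2 \<Phi> (?L 2 + ?L 3) (- ?L 1 - (?L 2 + ?L 3)) * half_exp (?L 2 + ?L 3)"
    "lmul (W' 3) = half_exp (- (?L 1 + (?L 2 + ?L 3))) * ev2 \<Phi> (?L 2 + ?L 3) (- ?L 1 - (?L 2 + ?L 3)) * half_exp (?L 2 + ?L 3)"
    "lmul (U' 2) = ev2 \<Phi> (?L 2) (- ?L 2 - ?L 3)"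
    "lmul (U' 3) = half_exp (- (?L 2 + ?L 3)) * ev2 \<Phi> (?L 3) (- ?L 2 - ?L 3) * half_exp (?L 3)"
    unfolding W_def U_def W'_def U'_def
    by (simp_all add: lmul_simplicial_comp(1)[of _ "sets2 _ _"] lmul_simplicial_comp(2)[of _ "sets2 _ _"] sets2 two)
  have U3: "U 3 = 1" and U1': "U' 1 = 1"
    unfolding U_def U'_def by (rule simplicial_comp_one, simp add: sets2)+
  have q: "braid_rel (strand_op :: 3 option \<Rightarrow> 3 option \<Rightarrow> (3, 'k) nc_op)" by (rule braid_strand_op)
  let ?D = "\<lambda>i j :: 3. D_op i j :: (3, 'k) nc_op"
  have t: "braid3 (?L 1) (?D 1 2) (?L 2)" "braid3 (?L 2) (?D 2 3) (?L 3)"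
    using braid3_strands[OF q, of None "Some 1" "Some 2"] braid3_strands[OF q, of None "Some 2" "Some 3"]
    by simp_all
  have t': "braid3 (?L 1 + ?L 2) (?D 1 3 + ?D 2 3) (?L 3)"
    "braid3 (?L 2 + ?L 3) (?D 1 2 + ?D 1 3) (?L 1)"
    using braid3_cable[OF q, of None "Some 1" "Some 2" "Some 3"]
      braid3_cable[OF q, of None "Some 2" "Some 3" "Some 1"]
    by (simp_all add: D_op_sym[of 2 1] D_op_sym[of 3 1])
  note central = ev2_central[OF gl lin]
  have G: "ev2 \<Phi> (?L 1 + ?L 2) (- (?L 1 + ?L 2) - ?L 3) = ev2 \<Phi> (?L 1 + ?L 2) (?D 1 3 + ?D 2 3)"
    "ev2 \<Phi> (?L 3) (- (?L 1 + ?L 2) - ?L 3) = ev2 \<Phi> (?L 3) (?D 1 3 + ?D 2 3)"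
    "ev2 \<Phi> (?L 1) (- ?L 1 - ?L 2) = ev2 \<Phi> (?L 1) (?D 1 2)"
    "ev2 \<Phi> (?L 2) (- ?L 1 - ?L 2) = ev2 \<Phi> (?L 2) (?D 1 2)"
    "ev2 \<Phi> (?L 1) (- ?L 1 - (?L 2 + ?L 3)) = ev2 \<Phi> (?L 1) (?D 1 2 + ?D 1 3)"
    "ev2 \<Phi> (?L 2 + ?L 3) (- ?L 1 - (?L 2 + ?L 3)) = ev2 \<Phi> (?L 2 + ?L 3) (?D 1 2 + ?D 1 3)"
    "ev2 \<Phi> (?L 2) (- ?L 2 - ?L 3) = ev2 \<Phi> (?L 2) (?D 2 3)"
    "ev2 \<Phi> (?L 3) (- ?L 2 - ?L 3) = ev2 \<Phi> (?L 3) (?D 2 3)"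
    by (rule central[OF t'(1)], simp) (rule central[OF braid3_perm(3)[OF t'(1)]], simp,
      rule central[OF t(1)], simp, rule central[OF braid3_perm(3)[OF t(1)]], simp,
      rule central[OF braid3_perm(3)[OF t'(2)]], simp, rule central[OF t'(2)], simp,
      rule central[OF t(2)], simp, rule central[OF braid3_perm(3)[OF t(2)]], simp)
  have \<alpha>: "?\<alpha> = ev2 \<Phi> (?D 1 2) (?D 2 3)"
  proof -
    have v: "act_D (tt i j) = ?D i j" for i j
      unfolding tt_def by (subst act_var) (auto simp: raises_D_op)
    show ?thesis
      unfolding g_def by (subst act_eval2) (auto simp: raises_D_op v)
  qed
  \<comment> \<open>the identities for the strands \<open>0, 1, 2, 3\<close>, the strand 0 being \<open>None\<close>\<close>
  have dist: "distinct [None, Some 1, Some 2, Some (3 :: 3)]" by simp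
  note id = assoc_component_identities[OF assms q dist, unfolded strand_op.simps]
  have Z: "\<exists>Z. lmul (W' k * U' k) = ?\<alpha> * lmul (W k * U k) * Z \<and> Z * ?L k = ?L k * Z" for k
  proof -
    have "\<exists>Z. lmul (W' 1 * U' 1) = ?\<alpha> * lmul (W 1 * U 1) * Z \<and> Z * ?L 1 = ?L 1 * Z"
      using id(1) by (simp only: lmul_simps lm G \<alpha> U1' mult_1_right mult.assoc)
    moreover have "\<exists>Z. lmul (W' 2 * U' 2) = ?\<alpha> * lmul (W 2 * U 2) * Z \<and> Z * ?L 2 = ?L 2 * Z"
      using id(2) by (simp only: lmul_simps lm G \<alpha> mult.assoc)
    moreover have "\<exists>Z. lmul (W' 3 * U' 3) = ?\<alpha> * lmul (W 3 * U 3) * Z \<and> Z * ?L 3 = ?L 3 * Z"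
      using id(3) by (simp only: lmul_simps lm G \<alpha> U3 mult_1_right mult.assoc)
    ultimately show ?thesis using exhaust_3[of k] by metis
  qed

  have ord: "ord_ge 1 (conj_letters W k)" "ord_ge 1 (conj_letters U k)"
    "ord_ge 1 (conj_letters W' k)" "ord_ge 1 (conj_letters U' k)" for k
    by (rule tang_ord, rule mem)+
  have W12: "W 1 = W 2" and W'23: "W' 2 = W' 3"
    unfolding lmul_eq_iff[symmetric] lm by (rule refl)+
  \<comment> \<open>a trivial component is a substitution into a constant, so \<open>tang_tang_var\<close> covers it\<close>
  have trivial: "(1 :: (3, 'k) ncs) = nc_subst (\<lambda>j :: 2. \<Sum>i\<in>{}. nc_var i) 1"
    by (rule nc_subst_one[symmetric]) simp
  have WU: "?S W (?S U (nc_var k)) = conj_letters (\<lambda>k. W k * U k) k" for k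
    unfolding nc_subst_var[OF ord(2)]
  proof (cases "k = 3")
    case True
    then show "?S W (conj_letters U k) = conj_letters (\<lambda>k. W k * U k) k"
      using U3 trivial by (intro tang_tang_var[where I = "\<lambda>_. {}"] mem) auto
  next
    case False
    then have "k = 1 \<or> k = 2" using exhaust_3[of k] by auto
    then have "U k = nc_subst (\<lambda>j. \<Sum>i\<in>sets2 {1} {2} j. nc_var i) (mu_comp \<Phi> (if k = 1 then 1 else 2))"
      unfolding U_def by (intro simplicial_comp_eq) (auto simp: sets2 two)
    then show "?S W (conj_letters U k) = conj_letters (\<lambda>k. W k * U k) k"
      by (rule tang_tang_var[OF mem(1,2)])
        (use \<open>k = 1 \<or> k = 2\<close> W12 in \<open>auto simp: sets2 split: if_splits\<close>)
  qed
  have W'U': "?S W' (?S U' (nc_var k)) = conj_letters (\<lambda>k. W' k * U' k) k" for k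
    unfolding nc_subst_var[OF ord(4)]
  proof (cases "k = 1")
    case True
    then show "?S W' (conj_letters U' k) = conj_letters (\<lambda>k. W' k * U' k) k"
      using U1' trivial by (intro tang_tang_var[where I = "\<lambda>_. {}"] mem) auto
  next
    case False
    then have "k = 2 \<or> k = 3" using exhaust_3[of k] by auto
    then have "U' k = nc_subst (\<lambda>j. \<Sum>i\<in>sets2 {2} {3} j. nc_var i) (mu_comp \<Phi> (if k = 2 then 1 else 2))"
      unfolding U'_def by (intro simplicial_comp_eq) (auto simp: sets2 two)
    then show "?S W' (conj_letters U' k) = conj_letters (\<lambda>k. W' k * U' k) k"
      by (rule tang_tang_var[OF mem(3,4)])
        (use \<open>k = 2 \<or> k = 3\<close> W'23 in \<open>auto simp: sets2 split: if_splits\<close>)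
  qed
  have letter: "app ?\<alpha> (?S W (?S U (nc_var k))) = ?S W' (?S U' (nc_var k))" for k
  proof -
    obtain Z where "lmul (W' k * U' k) = ?\<alpha> * lmul (W k * U k) * Z" "Z * ?L k = ?L k * Z"
      using Z[of k] by blast
    then show ?thesis
      unfolding WU W'U' by (rule app_act_D_conj[OF g exp_free_lie_mult[OF mem(1,2)] exp_free_lie_mult[OF mem(3,4)]])
  qed
  have eq: "app ?\<alpha> (?S W (?S U f)) = ?S W' (?S U' f)" for f
  proof (rule continuous_hom_eqI[where F = "\<lambda>f. app ?\<alpha> (?S W (?S U f))" and H = "\<lambda>f. ?S W' (?S U' f)"])
    show "lin_filt (\<lambda>f. app ?\<alpha> (?S W (?S U f)))" "lin_filt (\<lambda>f. ?S W' (?S U' f))"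
      by (rule lin_filt_comp[OF lin_filt_app lin_filt_comp[OF lin_filt_subst lin_filt_subst]],
          rule lin_filt_comp[OF lin_filt_subst lin_filt_subst])
    show "app ?\<alpha> (?S W (?S U (nc_var k))) = ?S W' (?S U' (nc_var k))" for k by (rule letter)
  qed (simp_all only: nc_subst_mult[OF ord(1)] nc_subst_mult[OF ord(2)] nc_subst_mult[OF ord(3)]
      nc_subst_mult[OF ord(4)] nc_subst_one[OF ord(1)] nc_subst_one[OF ord(2)] nc_subst_one[OF ord(3)]
      nc_subst_one[OF ord(4)] app_act_D_mult[OF g] app_act_D_one[OF g])
  show ?thesis
    unfolding TAut_simplicial_mu[OF assms] TAut_comp_def
    unfolding g_def[symmetric] W_def[symmetric] U_def[symmetric] W'_def[symmetric] U'_def[symmetric]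
  proof
    fix f
    show "compose (free_lie_hat UNIV) (Ad_t g) (compose (free_lie_hat UNIV) (tang W) (tang U)) f
        = compose (free_lie_hat UNIV) (tang W') (tang U') f"
    proof (cases "f \<in> free_lie_hat UNIV")
      case True
      note U = tang_hat[OF mem(2) True] and U' = tang_hat[OF mem(4) True]
      have "Ad_t g (tang W (tang U f)) = app ?\<alpha> (?S W (?S U f))"
        using Ad_t_eq[OF g tang_hat[OF mem(1) U]] tang_apply[OF U] tang_apply[OF True] by simp
      also have "\<dots> = tang W' (tang U' f)"
        using tang_apply[OF U'] tang_apply[OF True] by (simp add: eq)
      finally show ?thesis using True by (simp add: compose_def)
    qed (simp add: compose_def)
  qed
qed

end
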